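(* Let $d\in\mathbb{N}$ and $\theta_-,\theta_+>0$, and put $\theta_{\mathrm{Ellip}}:=\max\{\theta_-^{-1},\theta_+\}$. There exist $\delta_0\in(0,1/2)$ depending only on $d$ and $\theta_{\mathrm{Ellip}}$, and $M>0$ depending only on $d$, such that the following holds. Let $L\in\mathbb{N}$, let $A\colon\Lambda_L\to\mathbb{R}^{d\times d}$ be a measurable symmetric matrix function with $\theta_-|\xi|^2\le\xi\cdot A(x)\xi\le\theta_+|\xi|^2$ for all $x\in\Lambda_L$, $\xi\in\mathbb{R}^d$, let $\delta\in(0,\delta_0)$, and put $$\kappa=\frac12\Bigl(\frac{\delta}{2}\Bigr)^{M(1+\theta_-^{-2/3})}.$$ Then for all $0<E_-<E_+\le\kappa$, all $\psi\in\mathcal{D}(H^L(A))$ satisfying $H^L(A)\psi=E\psi$ for some $E\in(E_-,E_+)$, and all $(1,\delta)$-equidistributed sequences $Z$, $$\|\nabla\psi\|_{L^2(S_{Z,\delta}(L))}^2\ \ge\ \tilde C\,\|\psi\|_{L^2(\Lambda_L)}^2,\qquad \tilde C=\frac12\,\frac{\delta^2E_-^2}{2\theta_+\bigl(8\theta_++\delta^2E_-\bigr)}\Bigl(\frac{\delta}{2}\Bigr)^{M(1+\theta_-^{-2/3})}.$$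
   Context: $\Lambda_L=(-L/2,L/2)^d$, and $B(x,r)$ is the ball of center $x$ and radius $r$. $H^L(A)$ is the unique selfadjoint operator in $L^2(\Lambda_L)$ associated with the closed form $(u,v)\mapsto\int_{\Lambda_L}\overline{\nabla u}\cdot A\nabla v$ with form domain $H^1_0(\Lambda_L)$ (Dirichlet boundary conditions). For $\delta\in(0,1/2)$, a sequence $Z=(z_j)_{j\in\mathbb{Z}^d}\subset\mathbb{R}^d$ is $(1,\delta)$-equidistributed if $B(z_j,\delta)\subset j+\Lambda_1$ for all $j\in\mathbb{Z}^d$; $S_{Z,\delta}(L)=\Lambda_L\cap\bigcup_{j\in\mathbb{Z}^d}B(z_j,\delta)$. *)

theory Defs
  imports "HOL-Analysis.Analysis"
begin

definition cube :: "real \<Rightarrow> (real ^ 'n) set" where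
  "cube L = {x. \<forall>i. - L / 2 < x $ i \<and> x $ i < L / 2}"

text \<open>
  Elements of \<open>L\<^sup>2(\<Omega>)\<close> are represented by square-integrable functions on the whole space whose
  values outside \<open>\<Omega>\<close> are irrelevant; functions agreeing almost everywhere on \<open>\<Omega>\<close> are not
  identified. The norms, \<open>H\<^sup>1\<close>, \<open>H\<^sup>1\<^sub>0\<close>, the form and the operator are invariant under such changes.
\<close>

definition L2_space :: "'a::euclidean_space set \<Rightarrow> ('a \<Rightarrow> 'b::euclidean_space) set" where
  "L2_space \<Omega> = {f. f \<in> borel_measurable (lebesgue_on \<Omega>) \<and>
                     integrable (lebesgue_on \<Omega>) (\<lambda>x. (norm (f x))\<^sup>2)}"

definition L2_norm :: "'a::euclidean_space set \<Rightarrow> ('a \<Rightarrow> 'b::euclidean_space) \<Rightarrow> real" where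
  "L2_norm S f = sqrt (\<integral>x. (norm (f x))\<^sup>2 \<partial>lebesgue_on S)"

definition L2_inner :: "'a::euclidean_space set \<Rightarrow> ('a \<Rightarrow> complex) \<Rightarrow> ('a \<Rightarrow> complex) \<Rightarrow> complex" where
  "L2_inner \<Omega> u v = (\<integral>x. cnj (u x) * v x \<partial>lebesgue_on \<Omega>)"

primrec C_k :: "nat \<Rightarrow> ('a::euclidean_space \<Rightarrow> 'b::real_normed_vector) \<Rightarrow> bool" where
  "C_k 0 f \<longleftrightarrow> continuous_on UNIV f"
| "C_k (Suc k) f \<longleftrightarrow> (\<forall>x. f differentiable (at x)) \<and>
     (\<forall>b\<in>Basis. C_k k (\<lambda>x. frechet_derivative f (at x) b))"

definition test_functions :: "'a::euclidean_space set \<Rightarrow> ('a \<Rightarrow> complex) set" where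
  "test_functions \<Omega> = {\<phi>. (\<forall>k. C_k k \<phi>) \<and> compact (closure {x. \<phi> x \<noteq> 0}) \<and>
                            closure {x. \<phi> x \<noteq> 0} \<subseteq> \<Omega>}"

definition is_weak_grad ::
    "(real ^ 'n) set \<Rightarrow> (real ^ 'n \<Rightarrow> complex) \<Rightarrow> (real ^ 'n \<Rightarrow> complex ^ 'n) \<Rightarrow> bool" where
  "is_weak_grad \<Omega> u g \<longleftrightarrow> (\<forall>\<phi>\<in>test_functions \<Omega>. \<forall>i.
     (\<integral>x. u x * frechet_derivative \<phi> (at x) (axis i 1) \<partial>lebesgue_on \<Omega>)
       = - (\<integral>x. g x $ i * \<phi> x \<partial>lebesgue_on \<Omega>))"

definition H1 :: "(real ^ 'n) set \<Rightarrow> (real ^ 'n \<Rightarrow> complex) set" where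
  "H1 \<Omega> = {u \<in> L2_space \<Omega>. \<exists>g\<in>L2_space \<Omega>. is_weak_grad \<Omega> u g}"

text \<open>
  The weak gradient is unique almost everywhere on \<open>\<Omega>\<close>; the choice operator only picks a
  representative. It is meaningful only for members of \<^term>\<open>H1 \<Omega>\<close>.
\<close>

definition weak_grad ::
    "(real ^ 'n) set \<Rightarrow> (real ^ 'n \<Rightarrow> complex) \<Rightarrow> (real ^ 'n \<Rightarrow> complex ^ 'n)" where
  "weak_grad \<Omega> u = (SOME g. g \<in> L2_space \<Omega> \<and> is_weak_grad \<Omega> u g)"

definition H1_norm :: "(real ^ 'n) set \<Rightarrow> (real ^ 'n \<Rightarrow> complex) \<Rightarrow> real" where
  "H1_norm \<Omega> u = sqrt ((L2_norm \<Omega> u)\<^sup>2 + (L2_norm \<Omega> (weak_grad \<Omega> u))\<^sup>2)"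

definition H1_0 :: "(real ^ 'n) set \<Rightarrow> (real ^ 'n \<Rightarrow> complex) set" where
  "H1_0 \<Omega> = {u \<in> H1 \<Omega>. \<forall>\<epsilon>>0. \<exists>\<phi>\<in>test_functions \<Omega>. H1_norm \<Omega> (\<lambda>x. u x - \<phi> x) < \<epsilon>}"

definition elliptic_form :: "(real ^ 'n) set \<Rightarrow> (real ^ 'n \<Rightarrow> real ^ 'n ^ 'n) \<Rightarrow>
    (real ^ 'n \<Rightarrow> complex) \<Rightarrow> (real ^ 'n \<Rightarrow> complex) \<Rightarrow> complex" where
  "elliptic_form \<Omega> A u v =
     (\<integral>x. (\<Sum>i\<in>UNIV. cnj (weak_grad \<Omega> u x $ i) *
             (\<Sum>j\<in>UNIV. complex_of_real (A x $ i $ j) * weak_grad \<Omega> v x $ j)) \<partial>lebesgue_on \<Omega>)"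

text \<open>
  The graph of the operator associated, in the sense of the first representation theorem, with
  the form \<^term>\<open>elliptic_form \<Omega> A\<close> on the form domain \<^term>\<open>H1_0 \<Omega>\<close>: a function \<open>\<psi>\<close> lies in the
  operator domain and is mapped to (the class of) \<open>f\<close> if and only if \<open>(\<psi>, f)\<close> is in this set.
  As \<open>L\<^sup>2\<close> elements are represented by functions, the graph contains all representatives.
\<close>

definition dirichlet_operator :: "(real ^ 'n) set \<Rightarrow> (real ^ 'n \<Rightarrow> real ^ 'n ^ 'n) \<Rightarrow>
    ((real ^ 'n \<Rightarrow> complex) \<times> (real ^ 'n \<Rightarrow> complex)) set" where
  "dirichlet_operator \<Omega> A = {(\<psi>, f). \<psi> \<in> H1_0 \<Omega> \<and> f \<in> L2_space \<Omega> \<and>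
     (\<forall>v\<in>H1_0 \<Omega>. elliptic_form \<Omega> A v \<psi> = L2_inner \<Omega> v f)}"

definition equidistributed :: "real \<Rightarrow> (int ^ 'n \<Rightarrow> real ^ 'n) \<Rightarrow> bool" where
  "equidistributed \<delta> Z \<longleftrightarrow>
     (\<forall>j. ball (Z j) \<delta> \<subseteq> (\<lambda>x. (\<chi> i. real_of_int (j $ i)) + x) ` cube 1)"

definition S_set :: "(int ^ 'n \<Rightarrow> real ^ 'n) \<Rightarrow> real \<Rightarrow> real \<Rightarrow> (real ^ 'n) set" where
  "S_set Z \<delta> L = cube L \<inter> (\<Union>j. ball (Z j) \<delta>)"

end

theory Submission
  imports Defs
begin

text \<open>
  At energies this small an eigenfunction is, on average, almost constant on unit cubes, and a Poincare
  inequality then does the work of a unique continuation estimate.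

  Write \<open>d\<close> for the dimension, \<open>g\<close> for the weak gradient of \<open>\<psi>\<close> and \<open>\<Omega>\<close> for the cube of side
  \<open>L\<close>. Testing the eigenvalue equation with \<open>\<psi>\<close> itself gives \<open>\<theta>m * \<parallel>g\<parallel>\<^sup>2 \<le> E * \<parallel>\<psi>\<parallel>\<^sup>2\<close>
  (\<open>eigenfunction_energy\<close>). Each ball \<open>B(z\<^sub>j, \<delta>)\<close> contains a cube \<open>Q'\<^sub>j\<close> of side
  \<open>s = \<delta> / (2 * d)\<close>, which lies in the unit cube \<open>Q\<^sub>j\<close> around \<open>j\<close>. Comparing the values of a
  function on \<open>Q\<^sub>j\<close> with those on \<open>Q'\<^sub>j\<close> (\<open>poincare_subcube\<close>) and summing over all \<open>j\<close>
  (\<open>poincare_tiling\<close>, \<open>H1_0_inequality_from_test_functions\<close>) yields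
  \<open>\<parallel>\<psi>\<parallel>\<^sup>2 \<le> c * s powr (- d) * (\<Sum>j. \<parallel>\<psi>\<parallel>\<^sup>2 on Q'\<^sub>j) + c * s powr (- d) * \<parallel>g\<parallel>\<^sup>2\<close>
  with \<open>c\<close> depending on \<open>d\<close> only. The last term is at most \<open>c * s powr (- d) * E / \<theta>m * \<parallel>\<psi>\<parallel>\<^sup>2\<close>;
  for \<open>E \<le> \<kappa>\<close> it is absorbed into the left-hand side. This is where the exponent \<open>-2/3\<close> enters:
  with \<open>y = \<theta>m powr (-2/3)\<close> the factor \<open>1 / \<theta>m = y powr (3/2)\<close> is dominated by an exponential in
  \<open>y\<close>, and \<open>\<kappa>\<close> contains such an exponential (\<open>powr_constant_bound\<close>).

  It remains to bound \<open>\<psi>\<close> on \<open>Q'\<^sub>j\<close> by its gradient on the ball. Testing the equation with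
  \<open>\<eta>\<^sup>2 \<psi>\<close>, where \<open>\<eta>\<close> is a smooth cutoff living in the ball with slope of order \<open>1 / \<delta>\<close>, the
  term \<open>E * \<parallel>\<eta> \<psi>\<parallel>\<^sup>2\<close> is controlled by \<open>g\<close> on the ball and by half of itself: a reversed
  Caccioppoli inequality (\<open>caccioppoli\<close>). The balls are disjoint, so summation over \<open>j\<close> gives the
  gradient on the union.

  For these arguments to apply to weak gradients that are picked by a choice operator, weak gradients
  must be unique almost everywhere (\<open>fundamental_lemma_calculus_of_variations\<close>), classical gradients of
  test functions must be weak gradients (\<open>integral_partial_derivative_zero\<close>), and multiplication
  by a smooth function must preserve \<^const>\<open>H1_0\<close> (\<open>H1_0_mult\<close>).
\<close>

section \<open>Calculus of k-times differentiable functions\<close>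

lemma C_k_SucI:
  assumes "\<And>x. (f has_derivative f' x) (at x)" and "\<And>b. b \<in> Basis \<Longrightarrow> C_k k (\<lambda>x. f' x b)"
  shows "C_k (Suc k) f"
proof -
  have "frechet_derivative f (at x) = f' x" for x
    using frechet_derivative_at[OF assms(1)] by simp
  then show ?thesis
    using assms by (auto simp: differentiable_def)
qed

lemma C_k_Suc_has_derivative:
  "C_k (Suc k) f \<Longrightarrow> (f has_derivative frechet_derivative f (at x)) (at x)"
  by (simp add: frechet_derivative_works[symmetric])

lemma C_k_SucD: "C_k (Suc k) f \<Longrightarrow> C_k k f"
proof (induction k arbitrary: f)
  case 0
  then show ?case
    by (auto simp: continuous_on_eq_continuous_at intro: differentiable_imp_continuous_within)
next
  case (Suc k)
  then show ?case by (metis C_k.simps(2))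
qed

lemma C_k_continuous: "C_k k f \<Longrightarrow> continuous_on S f"
proof (induction k)
  case 0 then show ?case using continuous_on_subset by auto
qed (use C_k_SucD in blast)

lemma C_k_const: "C_k k (\<lambda>x. c)"
proof (induction k arbitrary: c)
  case (Suc k)
  show ?case by (rule C_k_SucI[where f'="\<lambda>x h. 0"]) (auto intro: Suc)
qed simp

lemma C_k_add: "C_k k f \<Longrightarrow> C_k k g \<Longrightarrow> C_k k (\<lambda>x. f x + g x)"
proof (induction k arbitrary: f g)
  case (Suc k)
  show ?case
    by (rule C_k_SucI, rule has_derivative_add; (rule C_k_Suc_has_derivative Suc)?)
       (use Suc in auto)
qed (auto intro: continuous_intros)

lemma C_k_bounded_linear: "bounded_linear T \<Longrightarrow> C_k k f \<Longrightarrow> C_k k (\<lambda>x. T (f x))"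
proof (induction k arbitrary: f)
  case 0 then show ?case by (auto intro: bounded_linear.continuous_on)
next
  case (Suc k)
  show ?case
    by (rule C_k_SucI, rule bounded_linear.has_derivative; (rule C_k_Suc_has_derivative Suc)?)
       (use Suc in auto)
qed

lemma C_k_mult:
  fixes f g :: "_ \<Rightarrow> 'b::real_normed_algebra"
  shows "C_k k f \<Longrightarrow> C_k k g \<Longrightarrow> C_k k (\<lambda>x. f x * g x)"
proof (induction k arbitrary: f g)
  case (Suc k)
  show ?case
    by (rule C_k_SucI, rule has_derivative_mult; (rule C_k_Suc_has_derivative Suc)?)
       (use Suc C_k_SucD[OF Suc(2)] C_k_SucD[OF Suc(3)] in \<open>auto intro!: C_k_add\<close>)
qed (auto intro: continuous_intros)

lemma C_k_prod:
  fixes f :: "'i \<Rightarrow> _ \<Rightarrow> 'b::{real_normed_algebra, comm_ring_1}"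
  assumes "finite I" "\<And>i. i \<in> I \<Longrightarrow> C_k k (f i)"
  shows "C_k k (\<lambda>x. \<Prod>i\<in>I. f i x)"
  using assms by (induction I) (auto intro: C_k_const C_k_mult)

section \<open>Smooth cutoff functions\<close>

text \<open>
  The functions \<open>t \<mapsto> t powr (- m) * exp (- c / t)\<close>, extended by 0 to the left half line. Up to linear
  combinations the family is closed under differentiation, which makes smoothness an induction.
\<close>

definition flat_exp :: "real \<Rightarrow> nat \<Rightarrow> real \<Rightarrow> real" where
  "flat_exp c m t = (if 0 < t then (1 / t) ^ m * exp (- c / t) else 0)"

lemma flat_exp_nonneg: "0 \<le> flat_exp c m t"
  by (simp add: flat_exp_def)

lemma power_le_fact_exp:
  assumes "0 \<le> (y::real)" shows "y ^ n \<le> fact n * exp y"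
proof -
  have "y ^ n /\<^sub>R fact n \<le> (\<Sum>k. y ^ k /\<^sub>R fact k)"
    using sum_le_suminf[OF summable_exp_generic[of y], of "{n}"] assms by auto
  then show ?thesis
    by (simp add: exp_def field_simps divide_inverse[symmetric])
qed

text \<open>
  With \<open>n = 2\<close> this is flatness at the origin, where the derivative is not given by the
  differentiation rules; with \<open>n = 0\<close> it bounds the derivative of the cutoff.
\<close>

lemma flat_exp_le:
  assumes "0 < c"
  shows "flat_exp c m t \<le> fact (m + n) / c ^ (m + n) * \<bar>t\<bar> ^ n"
proof (cases "0 < t")
  case True
  have "(c / t) ^ (m + n) \<le> fact (m + n) * exp (c / t)"
    by (rule power_le_fact_exp) (use assms True in auto)
  then have "exp (- (c / t)) * (c / t) ^ (m + n) \<le> exp (- (c / t)) * (fact (m + n) * exp (c / t))"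
    by (rule mult_left_mono) simp
  also have "\<dots> = fact (m + n)"
    by (simp add: exp_minus)
  finally have "exp (- (c / t)) * (c / t) ^ (m + n) \<le> fact (m + n)" .
  then show ?thesis
    using True assms by (simp add: flat_exp_def power_add power_divide field_simps)
qed (use assms in \<open>auto simp: flat_exp_def\<close>)

lemma flat_exp_deriv:
  assumes "0 < c"
  shows "(flat_exp c m has_real_derivative
            (c * flat_exp c (m + 2) t - real m * flat_exp c (m + 1) t)) (at t)"
proof (cases "t = 0")
  case True
  define K where "K = fact (m + 2) / c ^ (m + 2)"
  have K: "\<bar>flat_exp c m h / h\<bar> \<le> K * \<bar>h\<bar>" for h
  proof (cases "h = 0")
    case False
    have "flat_exp c m h \<le> K * \<bar>h\<bar> * \<bar>h\<bar>"
      using flat_exp_le[OF assms, of m h 2] by (simp add: K_def power2_eq_square mult.assoc)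
    then show ?thesis
      using False flat_exp_nonneg[of c m h] by (simp add: pos_divide_le_eq)
  qed simp
  have "((\<lambda>h. flat_exp c m h / h) \<longlongrightarrow> 0) (at 0)"
    by (rule Lim_null_comparison[where g="\<lambda>h. K * \<bar>h\<bar>"])
       (use K in \<open>auto intro!: tendsto_eq_intros\<close>)
  then show ?thesis
    using True by (simp add: DERIV_def flat_exp_def)
next
  case False
  then consider "t < 0" | "0 < t" by linarith
  then show ?thesis
  proof cases
    case 1
    have "((\<lambda>t. 0) has_real_derivative 0) (at t)" by simp
    then have "(flat_exp c m has_real_derivative 0) (at t)"
      by (rule has_field_derivative_transform_within_open[where S="{..<0}"])
         (use 1 in \<open>auto simp: flat_exp_def\<close>)
    then show ?thesis using 1 by (simp add: flat_exp_def)
  next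
    case 2
    have "((\<lambda>t. (1 / t) ^ m * exp (- c / t)) has_real_derivative
             (c * flat_exp c (m + 2) t - real m * flat_exp c (m + 1) t)) (at t)"
      using 2 apply (auto intro!: derivative_eq_intros simp: flat_exp_def)
      apply (cases m)
      apply (auto simp: field_simps power2_eq_square)
      done
    then show ?thesis
      by (rule has_field_derivative_transform_within_open[where S="{0<..}"])
         (use 2 in \<open>auto simp: flat_exp_def\<close>)
  qed
qed

lemma C_k_flat_exp:
  assumes "0 < c"
  shows "C_k k (\<lambda>x. flat_exp c m (l * (x \<bullet> e) + a))"
proof (induction k arbitrary: m)
  case 0
  have "continuous_on UNIV (flat_exp c m)"
    by (meson assms DERIV_isCont continuous_at_imp_continuous_on flat_exp_deriv)
  then have "continuous_on UNIV (\<lambda>x. flat_exp c m (l * (x \<bullet> e) + a))"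
    by (rule continuous_on_compose2) (auto intro!: continuous_intros)
  then show ?case by simp
next
  case (Suc k)
  show ?case
  proof (rule C_k_SucI)
    fix x :: 'a
    let ?t = "l * (x \<bullet> e) + a"
    show "((\<lambda>x. flat_exp c m (l * (x \<bullet> e) + a)) has_derivative
       (\<lambda>h. (c * flat_exp c (m + 2) ?t + - (real m) * flat_exp c (m + 1) ?t) * (l * (h \<bullet> e)))) (at x)"
      by (rule has_derivative_eq_rhs,
          rule DERIV_compose_FDERIV[OF flat_exp_deriv[OF assms]])
         (auto intro!: derivative_eq_intros simp: fun_eq_iff)
  qed (intro C_k_mult C_k_add C_k_const Suc)
qed

lemma flat_exp_0_bounds:
  assumes "0 < c" shows "flat_exp c 0 t \<le> 1" "c * flat_exp c 2 t \<le> 2 / c"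
proof -
  show "flat_exp c 0 t \<le> 1" using assms by (auto simp: flat_exp_def)
  show "c * flat_exp c 2 t \<le> 2 / c"
    using flat_exp_le[OF assms, of 2 t 0] assms
    by (simp add: field_simps power2_eq_square)
qed

lemma continuous_borel_measurable_lebesgue:
  "continuous_on UNIV f \<Longrightarrow> f \<in> borel_measurable lebesgue"
  by (intro measurable_completion) (simp add: borel_measurable_continuous_onI)

lemma continuous_borel_measurable_lebesgue_on:
  "continuous_on UNIV f \<Longrightarrow> f \<in> borel_measurable (lebesgue_on \<Omega>)"
  by (intro measurable_restrict_space1 continuous_borel_measurable_lebesgue)

text \<open>
  The parameter \<open>c\<close> is the width of the transition layer: as \<open>c\<close> tends to 0 the bump fills the box,
  and for \<open>c\<close> comparable to the side length the bump has slope of order \<open>1 / c\<close> while staying bounded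
  below on the inner half of the box.
\<close>

definition box_bump :: "real \<Rightarrow> real ^ 'n \<Rightarrow> real ^ 'n \<Rightarrow> real ^ 'n \<Rightarrow> real" where
  "box_bump c a b x = (\<Prod>i\<in>UNIV. flat_exp c 0 (x $ i - a $ i) * flat_exp c 0 (b $ i - x $ i))"

lemma C_k_box_bump:
  assumes "0 < c" shows "C_k k (box_bump c a b)"
proof -
  have "C_k k (\<lambda>x. flat_exp c 0 (x $ i - a $ i))" for i
    using C_k_flat_exp[OF assms, of k 0 1 "axis i (1::real)" "- a $ i"] by (simp flip: cart_eq_inner_axis)
  moreover have "C_k k (\<lambda>x. flat_exp c 0 (b $ i - x $ i))" for i
    using C_k_flat_exp[OF assms, of k 0 "-1" "axis i (1::real)" "b $ i"] by (simp add: add.commute flip: cart_eq_inner_axis)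
  ultimately show ?thesis
    unfolding box_bump_def by (intro C_k_prod C_k_mult) auto
qed

lemma box_bump_nonneg: "0 \<le> box_bump c a b x"
  by (auto simp: box_bump_def intro!: prod_nonneg mult_nonneg_nonneg flat_exp_nonneg)

lemma box_bump_le_1: "0 < c \<Longrightarrow> box_bump c a b x \<le> 1"
  by (auto simp: box_bump_def intro!: prod_le_1 mult_le_one mult_nonneg_nonneg flat_exp_nonneg flat_exp_0_bounds)

lemma box_bump_eq_0:
  assumes "x \<notin> box a b" shows "box_bump c a b x = 0"
proof -
  obtain i where "\<not> (a $ i < x $ i \<and> x $ i < b $ i)"
    using assms by (auto simp: mem_box_cart)
  then show ?thesis
    by (auto simp: box_bump_def flat_exp_def intro!: bexI[of _ i])
qed

lemma C_k_of_real:
  "C_k k f \<Longrightarrow> C_k k (\<lambda>x. of_real (f x) :: 'b :: {real_normed_algebra_1})"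
  using C_k_bounded_linear[OF bounded_linear_of_real] by blast

lemma box_bump_test_function:
  assumes "0 < c" "cbox a b \<subseteq> \<Omega>"
  shows "(\<lambda>x. complex_of_real (box_bump c a b x)) \<in> test_functions \<Omega>"
proof -
  have "{x. complex_of_real (box_bump c a b x) \<noteq> 0} \<subseteq> cbox a b"
    using box_bump_eq_0[of _ a b c] box_subset_cbox[of a b] by auto
  then have *: "closure {x. complex_of_real (box_bump c a b x) \<noteq> 0} \<subseteq> cbox a b"
    by (simp add: closure_minimal closed_cbox)
  then have "compact (closure {x. complex_of_real (box_bump c a b x) \<noteq> 0})"
    using bounded_subset[OF bounded_cbox] compact_eq_bounded_closed by blast
  then show ?thesis
    using * assms unfolding test_functions_def by (auto intro!: C_k_of_real C_k_box_bump)
qed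

lemma box_bump_tendsto_indicator:
  "(\<lambda>m. box_bump (1 / real (Suc m)) a b x) \<longlonglongrightarrow> indicator (box a b) x"
proof (cases "x \<in> box a b")
  case True
  have lim: "(\<lambda>m. flat_exp (1 / real (Suc m)) 0 t) \<longlonglongrightarrow> 1" if "0 < t" for t
  proof -
    have "(\<lambda>m. exp (- ((1 / real (Suc m)) / t))) \<longlonglongrightarrow> exp (- (0 / t))"
      by (intro tendsto_intros LIMSEQ_Suc[OF lim_1_over_n]) (use that in auto)
    then show ?thesis using that by (simp add: flat_exp_def)
  qed
  have "(\<lambda>m. box_bump (1 / real (Suc m)) a b x) \<longlonglongrightarrow> (\<Prod>i\<in>(UNIV::'a set). 1 * 1)"
    unfolding box_bump_def by (intro tendsto_intros lim) (use True in \<open>auto simp: mem_box_cart\<close>)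
  then show ?thesis using True by simp
qed (simp add: box_bump_eq_0)

section \<open>Uniqueness of weak gradients\<close>

text \<open>
  The sets over which the integral vanishes form a Dynkin system, and open boxes form an
  intersection-stable generator of the Borel sets.
\<close>

lemma AE_zero_if_box_integrals_zero:
  fixes h :: "'a::euclidean_space \<Rightarrow> 'b::{banach, second_countable_topology}"
  assumes h: "integrable lebesgue h" and box: "\<And>a b. (\<integral>x. indicator (box a b) x *\<^sub>R h x \<partial>lebesgue) = 0"
  shows "AE x in lebesgue. h x = 0"
proof -
  note [measurable] = borel_measurable_integrable[OF h]
  have int: "integrable lebesgue (\<lambda>x. indicator A x *\<^sub>R h x)" if "A \<in> sets lebesgue" for A
    using integrable_mult_indicator[OF that h] .
  let ?I = "\<lambda>A. \<integral>x. indicator A x *\<^sub>R h x \<partial>lebesgue"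
  have UNIV0: "?I UNIV = 0"
  proof -
    have "(\<lambda>m. ?I (box (- (real m) *\<^sub>R One) (real m *\<^sub>R One))) \<longlonglongrightarrow> ?I UNIV"
    proof (rule integral_dominated_convergence[where w="\<lambda>x. norm (h x)"])
      show "AE x in lebesgue. (\<lambda>m. indicator (box (- (real m) *\<^sub>R One) (real m *\<^sub>R One)) x *\<^sub>R h x)
              \<longlonglongrightarrow> indicator UNIV x *\<^sub>R h x"
      proof (rule AE_I2, rule tendsto_eventually)
        fix x :: 'a
        have "norm x < real m \<Longrightarrow> x \<in> box (- (real m) *\<^sub>R One) (real m *\<^sub>R One)" for m
          using Basis_le_norm[of _ x] by (auto simp: box_def abs_le_iff) (smt (verit))+
        moreover have "eventually (\<lambda>m. norm x < real m) sequentially"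
          using filterlim_real_sequentially by (simp add: filterlim_at_top_dense)
        ultimately show "\<forall>\<^sub>F m in sequentially. indicator (box (- (real m) *\<^sub>R One) (real m *\<^sub>R One)) x *\<^sub>R h x
            = indicator UNIV x *\<^sub>R h x"
          by (auto elim!: eventually_mono)
      qed
      show "(\<lambda>x. indicator (box (- (real m) *\<^sub>R One) (real m *\<^sub>R One)) x *\<^sub>R h x)
              \<in> borel_measurable lebesgue" for m
        by (rule borel_measurable_integrable[OF int]) auto
    qed (use h in \<open>auto simp: indicator_def\<close>)
    then show ?thesis by (simp add: box LIMSEQ_const_iff)
  qed
  have borel0: "?I A = 0" if A: "A \<in> sets borel" for A
  proof -
    have "Int_stable (range (\<lambda>(a, b). box a b :: 'a set))"
      by (auto simp: Int_stable_def box_Int_box)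
    moreover have "(range (\<lambda>(a, b). box a b :: 'a set)) \<subseteq> Pow UNIV" by auto
    moreover have "A \<in> sigma_sets UNIV (range (\<lambda>(a, b). box a b))"
      using A unfolding borel_eq_box by simp
    ultimately show ?thesis
    proof (induction rule: sigma_sets_induct_disjoint)
      case (basic A) then show ?case by (auto simp: box)
    next
      case empty then show ?case by simp
    next
      case (compl A)
      then have "A \<in> sets borel" by (simp add: borel_eq_box)
      then have A: "A \<in> sets lebesgue" by auto
      have "?I (UNIV - A) = ?I UNIV - ?I A"
        by (subst Bochner_Integration.integral_diff[symmetric, OF int int[OF A]])
           (auto intro!: Bochner_Integration.integral_cong simp: indicator_def)
      then show ?case using compl UNIV0 by simp
    next
      case (union F)
      then have "\<And>i. F i \<in> sets borel" by (auto simp: borel_eq_box)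
      then have F: "\<And>i. F i \<in> sets lebesgue" by auto
      have "set_lebesgue_integral lebesgue (\<Union>i. F i) h = (\<Sum>i. set_lebesgue_integral lebesgue (F i) h)"
        by (rule lebesgue_integral_countable_add[OF F])
           (use union int F in \<open>auto simp: disjoint_family_on_def set_integrable_def\<close>)
      then show ?case using union by (simp add: set_lebesgue_integral_def)
    qed
  qed
  interpret sigma_finite_measure "lebesgue :: 'a measure"
  proof
    obtain \<A> :: "'a set set" where "countable \<A>" "\<A> \<subseteq> sets lborel" "\<Union>\<A> = space lborel"
        "\<forall>a\<in>\<A>. emeasure lborel a \<noteq> \<infinity>"
      using lborel.sigma_finite_countable by blast
    then show "\<exists>\<A>::'a set set. countable \<A> \<and> \<A> \<subseteq> sets lebesgue \<and> \<Union>\<A> = space lebesgue \<and>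
        (\<forall>a\<in>\<A>. emeasure lebesgue a \<noteq> \<infinity>)"
      by (intro exI[of _ \<A>]) auto
  qed
  show ?thesis
  proof (rule density_zero[OF h])
    fix A :: "'a set" assume A: "A \<in> sets lebesgue"
    have "main_part lborel A \<in> sets borel"
      using main_part_sets[of A lborel] A by simp
    moreover have "AE x in lebesgue. x \<in> A \<longleftrightarrow> x \<in> main_part lborel A"
      using AE_completion[OF AE_notin_null_part[OF A]]
      by eventually_elim (use main_part_null_part_Un[OF A] in auto)
    then have "?I A = ?I (main_part lborel A)"
      using A calculation
      by (intro integral_cong_AE borel_measurable_integrable int) (auto simp: indicator_def)
    ultimately show "set_lebesgue_integral lebesgue A h = 0"
      by (simp add: borel0 set_lebesgue_integral_def)
  qed
qed

text \<open>
  Box bumps with vanishing transition layer are test functions that converge boundedly to indicators of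
  open boxes, so the integral of \<open>h\<close> over every box inside \<open>\<Omega>\<close> vanishes.
\<close>

lemma fundamental_lemma_calculus_of_variations:
  fixes h :: "real ^ 'n \<Rightarrow> complex"
  assumes "open \<Omega>" and h: "integrable (lebesgue_on \<Omega>) h"
    and test: "\<And>\<phi>. \<phi> \<in> test_functions \<Omega> \<Longrightarrow> (\<integral>x. h x * \<phi> x \<partial>lebesgue_on \<Omega>) = 0"
  shows "AE x in lebesgue_on \<Omega>. h x = 0"
proof -
  have \<Omega>: "\<Omega> \<in> sets lebesgue" using \<open>open \<Omega>\<close> by auto
  define h0 where "h0 x = indicator \<Omega> x *\<^sub>R h x" for x
  have h0: "integrable lebesgue h0"
    using h \<Omega> by (simp add: integrable_restrict_space h0_def[abs_def])
  note [measurable] = borel_measurable_integrable[OF h0]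
  have box0: "(\<integral>x. indicator (box a b) x *\<^sub>R h0 x \<partial>lebesgue) = 0" if ab: "cbox a b \<subseteq> \<Omega>" for a b
  proof -
    let ?b = "\<lambda>m x. box_bump (1 / real (Suc m)) a b x"
    have "?b m \<in> borel_measurable lebesgue" for m
      by (intro continuous_borel_measurable_lebesgue C_k_continuous C_k_box_bump) auto
    note [measurable] = this
    have "(\<lambda>m. \<integral>x. ?b m x *\<^sub>R h0 x \<partial>lebesgue) \<longlonglongrightarrow> (\<integral>x. indicator (box a b) x *\<^sub>R h0 x \<partial>lebesgue)"
    proof (rule integral_dominated_convergence[where w="\<lambda>x. norm (h0 x)"])
      show "AE x in lebesgue. norm (?b m x *\<^sub>R h0 x) \<le> norm (h0 x)" for m
        by (auto simp: abs_of_nonneg box_bump_nonneg intro!: mult_left_le_one_le box_bump_le_1)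
      show "AE x in lebesgue. (\<lambda>m. ?b m x *\<^sub>R h0 x) \<longlonglongrightarrow> indicator (box a b) x *\<^sub>R h0 x"
        by (intro AE_I2 tendsto_intros box_bump_tendsto_indicator)
      show "(\<lambda>x. indicator (box a b) x *\<^sub>R h0 x) \<in> borel_measurable lebesgue"
        by (intro borel_measurable_integrable integrable_mult_indicator h0) auto
      show "(\<lambda>x. ?b m x *\<^sub>R h0 x) \<in> borel_measurable lebesgue" for m
        by measurable
    qed (use h0 in auto)
    moreover have "(\<integral>x. ?b m x *\<^sub>R h0 x \<partial>lebesgue) = 0" for m
    proof -
      have "(\<integral>x. ?b m x *\<^sub>R h0 x \<partial>lebesgue)
          = (\<integral>x. indicator \<Omega> x *\<^sub>R (h x * complex_of_real (?b m x)) \<partial>lebesgue)"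
        by (intro Bochner_Integration.integral_cong) (auto simp: h0_def indicator_def scaleR_conv_of_real)
      also have "\<dots> = (\<integral>x. h x * complex_of_real (?b m x) \<partial>lebesgue_on \<Omega>)"
        using \<Omega> by (simp add: integral_restrict_space)
      also have "\<dots> = 0"
        by (intro test box_bump_test_function ab) auto
      finally show ?thesis .
    qed
    ultimately show ?thesis by (simp add: LIMSEQ_const_iff)
  qed
  have local0: "AE x in lebesgue. x \<in> cbox a b \<longrightarrow> h0 x = 0" if ab: "cbox a b \<subseteq> \<Omega>" for a b
  proof -
    have "AE x in lebesgue. indicator (box a b) x *\<^sub>R h0 x = 0"
    proof (rule AE_zero_if_box_integrals_zero)
      show "integrable lebesgue (\<lambda>x. indicator (box a b) x *\<^sub>R h0 x)"
        by (intro integrable_mult_indicator h0) auto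
      fix u v
      obtain p q where pq: "box u v \<inter> box a b = box p q"
        by (auto simp: box_Int_box)
      have "box p q \<noteq> {} \<Longrightarrow> cbox p q \<subseteq> cbox a b"
        using pq by (metis closure_box closure_mono inf_le2 closure_minimal closed_cbox box_subset_cbox order_trans)
      then have "(\<integral>x. indicator (box p q) x *\<^sub>R h0 x \<partial>lebesgue) = 0"
        using box0[of p q] ab by (cases "box p q = {}") auto
      then show "(\<integral>x. indicator (box u v) x *\<^sub>R indicator (box a b) x *\<^sub>R h0 x \<partial>lebesgue) = 0"
        by (simp flip: pq add: indicator_inter_arith)
    qed
    moreover have "AE x in lebesgue. x \<notin> cbox a b - box a b"
    proof -
      have "negligible (cbox a b - box a b)"
        by (rule negligible_frontier_interval)
      then show ?thesis
        by (metis AE_not_in negligible_iff_null_sets)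
    qed
    ultimately show ?thesis
      by eventually_elim (auto simp: indicator_def)
  qed
  obtain \<D> where D: "countable \<D>" "\<D> \<subseteq> Pow \<Omega>" "\<And>X. X \<in> \<D> \<Longrightarrow> \<exists>a b. X = cbox a b" "\<Union>\<D> = \<Omega>"
    using open_countable_Union_open_cbox[OF \<open>open \<Omega>\<close>] by metis
  have "AE x in lebesgue. x \<in> X \<longrightarrow> h0 x = 0" if "X \<in> \<D>" for X
    using local0 D that by (metis PowD subsetD)
  then have "AE x in lebesgue. \<forall>X\<in>\<D>. x \<in> X \<longrightarrow> h0 x = 0"
    by (subst AE_ball_countable[OF D(1)]) blast
  then have "AE x in lebesgue. x \<in> \<Omega> \<longrightarrow> h x = 0"
    by eventually_elim (metis D(4) UnionE h0_def indicator_simps(1) scaleR_one)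
  then show ?thesis
    using \<Omega> by (simp add: AE_restrict_space_iff)
qed

section \<open>Integration by parts against test functions\<close>

lemma integrable_continuous_compact_support:
  fixes f :: "'a::euclidean_space \<Rightarrow> 'b::euclidean_space"
  assumes "continuous_on UNIV f" "compact K" "\<And>x. x \<notin> K \<Longrightarrow> f x = 0"
  shows "integrable lborel f" "integrable lebesgue f"
proof -
  have "integrable lborel (\<lambda>x. indicator K x *\<^sub>R f x)"
    using assms by (intro borel_integrable_compact) (auto intro: continuous_on_subset)
  moreover have "(\<lambda>x. indicator K x *\<^sub>R f x) = f"
    using assms(3) by (auto simp: indicator_def fun_eq_iff)
  ultimately show "integrable lborel f" by simp
  then show "integrable lebesgue f"
    by (subst integrable_completion) (auto intro: borel_measurable_continuous_onI assms)
qed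

lemma frechet_derivative_zero_outside_closed:
  assumes "closed K" "\<And>x. x \<notin> K \<Longrightarrow> f x = 0" "x \<notin> K"
  shows "frechet_derivative f (at x) = (\<lambda>h. 0)"
proof -
  have "(f has_derivative (\<lambda>h. 0)) (at x)"
    by (rule has_derivative_transform_within_open[where f="\<lambda>x. 0" and s="-K"])
       (use assms in auto)
  then show ?thesis by (rule frechet_derivative_at[symmetric])
qed

text \<open>
  Translation invariance makes the integral of every difference quotient vanish; the quotients are
  bounded by the maximal slope, live on a common bounded set and converge to the derivative.
\<close>

lemma integral_partial_derivative_zero:
  fixes f :: "'a::euclidean_space \<Rightarrow> 'b::euclidean_space"
  assumes f: "C_k 1 f" and K: "compact K" "\<And>x. x \<notin> K \<Longrightarrow> f x = 0" and e: "e \<in> Basis"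
  shows "(\<integral>x. frechet_derivative f (at x) e \<partial>lebesgue) = 0"
proof -
  define D where "D x = frechet_derivative f (at x) e" for x
  have der: "(f has_derivative frechet_derivative f (at x)) (at x)" for x
    using f by (intro C_k_Suc_has_derivative[of 0]) simp
  have lin: "frechet_derivative f (at x) (t *\<^sub>R e) = t *\<^sub>R D x" for t x
    using linear_scale[OF has_derivative_linear[OF der]] by (simp add: D_def)
  have contf: "continuous_on UNIV f" using f by (rule C_k_continuous)
  have contD: "continuous_on UNIV D" using f e by (simp add: D_def[abs_def])
  have D0: "D x = 0" if "x \<notin> K" for x
    using frechet_derivative_zero_outside_closed[of K f x] K that
    by (simp add: D_def compact_imp_closed)
  obtain B0 where "\<And>x. x \<in> K \<Longrightarrow> norm (D x) \<le> B0"
    using compact_imp_bounded[OF compact_continuous_image[OF continuous_on_subset[OF contD subset_UNIV] K(1)]]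
    by (auto simp: bounded_iff)
  then have B: "norm (D x) \<le> max B0 0" for x
    using D0 by (cases "x \<in> K") (auto intro: max.coboundedI1)
  define B where "B = max B0 0"
  obtain R where R: "\<And>x. x \<in> K \<Longrightarrow> norm x \<le> R"
    using compact_imp_bounded[OF K(1)] by (auto simp: bounded_iff)
  have lip: "norm (f (x + t *\<^sub>R e) - f x) \<le> B * \<bar>t\<bar>" for x t
  proof -
    have "norm (f (x + t *\<^sub>R e) - f (x + 0 *\<^sub>R e)) \<le> B * norm (t - 0)"
    proof (rule differentiable_bound[of UNIV "\<lambda>t. f (x + t *\<^sub>R e)" "\<lambda>t h. h *\<^sub>R D (x + t *\<^sub>R e)"])
      fix s :: real
      have "((\<lambda>t. f (x + t *\<^sub>R e)) has_derivative (\<lambda>h. frechet_derivative f (at (x + s *\<^sub>R e)) (h *\<^sub>R e))) (at s)"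
        by (rule has_derivative_compose[where f="\<lambda>t. x + t *\<^sub>R e", OF _ der]) (auto intro!: derivative_eq_intros)
      then show "((\<lambda>t. f (x + t *\<^sub>R e)) has_derivative (\<lambda>h. h *\<^sub>R D (x + s *\<^sub>R e))) (at s within UNIV)"
        by (simp add: lin)
      show "onorm (\<lambda>h. h *\<^sub>R D (x + s *\<^sub>R e)) \<le> B"
        by (rule onorm_le) (use B[of "x + s *\<^sub>R e"] in \<open>simp add: B_def mult.commute mult_left_mono\<close>)
    qed auto
    then show ?thesis by simp
  qed
  define h where "h m = 1 / real (Suc m)" for m
  have h: "0 < h m" "h m \<le> 1" for m by (auto simp: h_def)
  define s where "s m x = (f (x + h m *\<^sub>R e) - f x) /\<^sub>R h m" for m x
  have intf: "integrable lborel f"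
    using integrable_continuous_compact_support contf K by blast
  have distr: "distr lborel borel (\<lambda>x. x + c) = lborel" for c :: 'a
  proof -
    have "(\<lambda>x. x + c) = (+) c" by (rule ext) (rule add.commute)
    then show ?thesis using lborel_distr_plus[of c] by (simp only:)
  qed
  have intfh: "integrable lborel (\<lambda>x. f (x + c))" "(\<integral>x. f (x + c) \<partial>lborel) = (\<integral>x. f x \<partial>lborel)" for c
  proof -
    have [measurable]: "f \<in> borel_measurable borel"
      using contf by (rule borel_measurable_continuous_onI)
    show "integrable lborel (\<lambda>x. f (x + c))"
      using integrable_distr_eq[of "\<lambda>x. x + c" lborel borel f] intf by (simp add: distr)
    show "(\<integral>x. f (x + c) \<partial>lborel) = (\<integral>x. f x \<partial>lborel)"
      using integral_distr[of "\<lambda>x. x + c" lborel borel f] by (simp add: distr)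
  qed
  have s0: "(\<integral>x. s m x \<partial>lborel) = 0" for m
    unfolding s_def by (simp add: intfh intf)
  have "(\<lambda>m. \<integral>x. s m x \<partial>lborel) \<longlonglongrightarrow> (\<integral>x. D x \<partial>lborel)"
  proof (rule integral_dominated_convergence[where w="\<lambda>x. indicator (cball 0 (R + 1)) x *\<^sub>R B"])
    show "integrable lborel (\<lambda>x. indicator (cball (0::'a) (R + 1)) x *\<^sub>R B)"
      by (intro borel_integrable_compact) auto
    show "D \<in> borel_measurable lborel"
      using contD by (simp add: borel_measurable_continuous_onI)
    show "s m \<in> borel_measurable lborel" for m
      unfolding s_def[abs_def] using borel_measurable_integrable[OF intf] borel_measurable_integrable[OF intfh(1)]
      by (intro borel_measurable_scaleR borel_measurable_diff) auto
    show "AE x in lborel. (\<lambda>m. s m x) \<longlonglongrightarrow> D x"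
    proof (rule AE_I2)
      fix x
      have "((\<lambda>t. f (x + t *\<^sub>R e)) has_derivative (\<lambda>h. frechet_derivative f (at (x + 0 *\<^sub>R e)) (h *\<^sub>R e))) (at 0)"
        by (rule has_derivative_compose[where f="\<lambda>t. x + t *\<^sub>R e", OF _ der]) (auto intro!: derivative_eq_intros)
      then have "((\<lambda>t. norm (f (x + t *\<^sub>R e) - f x - t *\<^sub>R D x) / norm t) \<longlongrightarrow> 0) (at 0)"
        by (simp add: has_derivative_at lin)
      moreover have eq: "norm (f (x + t *\<^sub>R e) - f x - t *\<^sub>R D x) / norm t
          = norm ((f (x + t *\<^sub>R e) - f x) /\<^sub>R t - D x)" if "t \<noteq> 0" for t
      proof -
        have "(f (x + t *\<^sub>R e) - f x) /\<^sub>R t - D x = (f (x + t *\<^sub>R e) - f x - t *\<^sub>R D x) /\<^sub>R t"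
          using that by (simp add: scaleR_diff_right)
        then show ?thesis by (simp add: divide_inverse mult.commute)
      qed
      ultimately have "((\<lambda>t. norm ((f (x + t *\<^sub>R e) - f x) /\<^sub>R t - D x)) \<longlongrightarrow> 0) (at 0)"
        by (elim Lim_transform_eventually) (use eq in \<open>auto simp: eventually_at intro!: exI[of _ 1]\<close>)
      then have lim: "((\<lambda>t. (f (x + t *\<^sub>R e) - f x) /\<^sub>R t) \<longlongrightarrow> D x) (at 0)"
        by (rule LIM_zero_cancel[OF tendsto_norm_zero_cancel])
      have "filterlim h (at 0) sequentially"
        unfolding filterlim_at h_def[abs_def] using LIMSEQ_Suc[OF lim_1_over_n] by auto
      from filterlim_compose[OF lim this] show "(\<lambda>m. s m x) \<longlonglongrightarrow> D x"
        by (simp add: s_def)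
    qed
    show "AE x in lborel. norm (s m x) \<le> indicator (cball 0 (R + 1)) x *\<^sub>R B" for m
    proof (rule AE_I2)
      fix x
      show "norm (s m x) \<le> indicator (cball 0 (R + 1)) x *\<^sub>R B"
      proof (cases "norm x \<le> R + 1")
        case True
        have "norm (s m x) \<le> B"
        proof -
          have "norm (s m x) = norm (f (x + h m *\<^sub>R e) - f x) / h m"
            using h(1)[of m] unfolding s_def by (simp add: divide_inverse mult.commute del: scaleR_right_diff_distrib)
          then show ?thesis
            using lip[of x "h m"] h(1)[of m] by (simp add: pos_divide_le_eq)
        qed
        then show ?thesis using True by simp
      next
        case False
        have "norm x \<le> norm (x + h m *\<^sub>R e) + norm (h m *\<^sub>R e)"
          by (metis add_diff_cancel_right' norm_triangle_ineq4)
        then have "\<not> norm (x + h m *\<^sub>R e) \<le> R"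
          using False h[of m] e by auto
        then have "f (x + h m *\<^sub>R e) = 0" "f x = 0"
          using K(2) R False by force+
        then show ?thesis using False by (simp add: s_def)
      qed
    qed
  qed
  then have "(\<integral>x. D x \<partial>lborel) = 0"
    by (simp add: s0 LIMSEQ_const_iff)
  moreover have "(\<integral>x. D x \<partial>lebesgue) = (\<integral>x. D x \<partial>lborel)"
    by (rule integral_completion) (simp add: contD borel_measurable_continuous_onI)
  ultimately show ?thesis by (simp add: D_def)
qed

definition grad :: "(real ^ 'n \<Rightarrow> 'b::real_normed_vector) \<Rightarrow> real ^ 'n \<Rightarrow> 'b ^ 'n" where
  "grad f x = (\<chi> i. frechet_derivative f (at x) (axis i 1))"

lemma axis_in_Basis: "axis i (1::real) \<in> Basis"
  by (auto simp: Basis_vec_def)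

lemma test_functionE:
  assumes "\<phi> \<in> test_functions \<Omega>"
  obtains K where "compact K" "K \<subseteq> \<Omega>" "\<And>x. x \<notin> K \<Longrightarrow> \<phi> x = 0" "\<And>x. x \<notin> K \<Longrightarrow> frechet_derivative \<phi> (at x) = (\<lambda>h. 0)"
proof -
  let ?K = "closure {x. \<phi> x \<noteq> 0}"
  have 0: "\<phi> x = 0" if "x \<notin> ?K" for x
    using that closure_subset[of "{x. \<phi> x \<noteq> 0}"] by auto
  show ?thesis
  proof (rule that[of ?K])
    show "compact ?K" "?K \<subseteq> \<Omega>" using assms by (simp_all add: test_functions_def)
    show "\<phi> x = 0" if "x \<notin> ?K" for x using 0 that .
    show "frechet_derivative \<phi> (at x) = (\<lambda>h. 0)" if "x \<notin> ?K" for x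
      by (rule frechet_derivative_zero_outside_closed[OF closed_closure 0 that])
  qed
qed

lemma test_function_C_k: "\<phi> \<in> test_functions \<Omega> \<Longrightarrow> C_k k \<phi>"
  by (simp add: test_functions_def)

lemma C_k_mult_test_function:
  assumes "\<phi> \<in> test_functions \<Omega>" "\<And>k. C_k k \<rho>"
  shows "(\<lambda>x. \<rho> x * \<phi> x) \<in> test_functions \<Omega>"
proof -
  have sub: "closure {x. \<rho> x * \<phi> x \<noteq> 0} \<subseteq> closure {x. \<phi> x \<noteq> 0}"
    by (rule closure_mono) auto
  then have "compact (closure {x. \<rho> x * \<phi> x \<noteq> 0})"
    using assms(1) compact_imp_bounded bounded_subset[OF _ sub]
    unfolding test_functions_def compact_eq_bounded_closed by blast
  then show ?thesis
    using assms order_trans[OF sub] unfolding test_functions_def mem_Collect_eq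
    by (blast intro: C_k_mult)
qed

lemma C_k_grad_continuous: 
  assumes "\<And>k. C_k k f" 
  shows "continuous_on UNIV (\<lambda>x. frechet_derivative f (at x) (axis i 1))"
        "continuous_on UNIV (grad f)"
proof -
  have *: "continuous_on UNIV (\<lambda>x. frechet_derivative f (at x) (axis i 1))" for i
    using assms[of "Suc 0"] axis_in_Basis[of i] by simp
  then show "continuous_on UNIV (\<lambda>x. frechet_derivative f (at x) (axis i 1))" .
  show "continuous_on UNIV (grad f)"
    unfolding grad_def[abs_def] by (intro continuous_on_vec_lambda *)
qed

lemma frechet_derivative_mult:
  fixes f g :: "_ \<Rightarrow> 'b::real_normed_algebra"
  assumes "C_k 1 f" "C_k 1 g"
  shows "frechet_derivative (\<lambda>x. f x * g x) (at x) e
       = f x * frechet_derivative g (at x) e + frechet_derivative f (at x) e * g x"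
proof -
  have "((\<lambda>x. f x * g x) has_derivative 
     (\<lambda>h. f x * frechet_derivative g (at x) h + frechet_derivative f (at x) h * g x)) (at x)"
    using assms by (intro has_derivative_mult C_k_Suc_has_derivative[of 0]) simp_all
  from fun_cong[OF frechet_derivative_at[OF this, symmetric]] show ?thesis .
qed

lemma frechet_derivative_of_real:
  assumes "C_k 1 f"
  shows "frechet_derivative (\<lambda>x. complex_of_real (f x)) (at x) e = of_real (frechet_derivative f (at x) e)"
proof -
  have "((\<lambda>x. complex_of_real (f x)) has_derivative (\<lambda>h. of_real (frechet_derivative f (at x) h))) (at x)"
    using assms by (intro has_derivative_of_real C_k_Suc_has_derivative[of 0]) simp
  from fun_cong[OF frechet_derivative_at[OF this, symmetric]] show ?thesis .
qed

section \<open>The spaces H1 and H1_0 on a bounded domain\<close>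

lemma L2_norm_sq: "(L2_norm S f)\<^sup>2 = (\<integral>x. (norm (f x))\<^sup>2 \<partial>lebesgue_on S)"
  by (simp add: L2_norm_def integral_nonneg)

lemma norm_sq_add_le: "(norm (a + b :: 'a::real_normed_vector))\<^sup>2 \<le> 2 * (norm a)\<^sup>2 + 2 * (norm b)\<^sup>2"
proof -
  have "(norm (a + b))\<^sup>2 \<le> (norm a + norm b)\<^sup>2"
    by (simp add: norm_triangle_ineq power_mono)
  also have "\<dots> \<le> 2 * (norm a)\<^sup>2 + 2 * (norm b)\<^sup>2"
    using sum_squares_bound[of "norm a" "norm b"] by (simp add: power2_sum)
  finally show ?thesis .
qed

lemma borel_measurable_vec:
  fixes f :: "'a \<Rightarrow> 'b::euclidean_space ^ 'n"
  shows "f \<in> borel_measurable M \<longleftrightarrow> (\<forall>i. (\<lambda>x. f x $ i) \<in> borel_measurable M)"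
proof
  assume f: "f \<in> borel_measurable M"
  show "\<forall>i. (\<lambda>x. f x $ i) \<in> borel_measurable M"
    by (intro allI borel_measurable_continuous_on[OF _ f] continuous_intros)
next
  assume comp: "\<forall>i. (\<lambda>x. f x $ i) \<in> borel_measurable M"
  then have "(\<lambda>x. f x \<bullet> b) \<in> borel_measurable M" if "b \<in> Basis" for b
  proof -
    obtain i c where "b = axis i c" using \<open>b \<in> Basis\<close> by (auto simp: Basis_vec_def)
    then have "(\<lambda>x. f x \<bullet> b) = (\<lambda>x. f x $ i \<bullet> c)" by (simp add: inner_axis)
    then show ?thesis
      using comp by (simp only:) (intro borel_measurable_inner borel_measurable_const, blast)
  qed
  then show "f \<in> borel_measurable M"
    unfolding borel_measurable_euclidean_space[of f M] by blast
qed

lemma vec_norm_sq: "(norm (v :: 'b::real_normed_vector ^ 'n))\<^sup>2 = (\<Sum>i\<in>UNIV. (norm (v $ i))\<^sup>2)"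
  by (simp add: norm_vec_def L2_set_def sum_nonneg)

definition cvec :: "complex \<Rightarrow> real ^ 'n \<Rightarrow> complex ^ 'n" where
  "cvec z v = (\<chi> i. z * of_real (v $ i))"

lemma cvec_nth [simp]: "cvec z v $ i = z * of_real (v $ i)"
  by (simp add: cvec_def)

lemma norm_cvec: "norm (cvec z v) = norm z * norm v"
proof -
  have "(norm (cvec z v))\<^sup>2 = (norm z * norm v)\<^sup>2"
    by (simp add: vec_norm_sq norm_mult power_mult_distrib sum_distrib_left)
  then show ?thesis by (simp add: power2_eq_iff_nonneg)
qed

text \<open>
  On a bounded set square-integrable functions are integrable and continuous functions are bounded;
  this settles the integrability of every pairing with a test function.
\<close>

locale bounded_domain =
  fixes \<Omega> :: "(real ^ 'n) set"
  assumes open_domain: "open \<Omega>" and bounded_domain: "bounded \<Omega>"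
begin

lemma domain_lmeasurable: "\<Omega> \<in> lmeasurable"
  using bounded_domain open_domain lmeasurable_open by blast

lemma domain_sets [simp]: "\<Omega> \<in> sets lebesgue"
  using open_domain by auto

lemma integrable_mult_bounded:
  fixes f :: "real ^ 'n \<Rightarrow> 'b::{real_normed_algebra, banach, second_countable_topology}"
  assumes f: "integrable (lebesgue_on \<Omega>) f" and g: "continuous_on UNIV g"
  shows "integrable (lebesgue_on \<Omega>) (\<lambda>x. f x * g x)" "integrable (lebesgue_on \<Omega>) (\<lambda>x. g x * f x)"
proof -
  have "bounded (g ` closure \<Omega>)"
    using bounded_domain g by (intro compact_imp_bounded compact_continuous_image)
      (auto intro: continuous_on_subset)
  then obtain B where "\<forall>y\<in>g ` closure \<Omega>. norm y \<le> B"
    unfolding bounded_iff by blast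
  then have B: "norm (g x) \<le> B" if "x \<in> \<Omega>" for x
    using that closure_subset by blast
  have m: "f \<in> borel_measurable (lebesgue_on \<Omega>)" "g \<in> borel_measurable (lebesgue_on \<Omega>)"
    using f g by (auto intro: continuous_borel_measurable_lebesgue_on)
  have "norm (f x * g x) \<le> norm (B * norm (f x))" "norm (g x * f x) \<le> norm (B * norm (f x))"
    if "x \<in> \<Omega>" for x
  proof -
    have "norm (f x) * norm (g x) \<le> \<bar>B\<bar> * norm (f x)"
      using mult_left_mono[OF order_trans[OF B[OF that] abs_ge_self[of B]], of "norm (f x)"]
      by (simp add: mult.commute)
    then show "norm (f x * g x) \<le> norm (B * norm (f x))" "norm (g x * f x) \<le> norm (B * norm (f x))"
      using norm_mult_ineq[of "f x" "g x"] norm_mult_ineq[of "g x" "f x"]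
      by (simp_all add: abs_mult mult.commute[of "norm (g x)"])
  qed
  moreover have i: "integrable (lebesgue_on \<Omega>) (\<lambda>x. B * norm (f x))" using f by simp
  ultimately show "integrable (lebesgue_on \<Omega>) (\<lambda>x. f x * g x)" "integrable (lebesgue_on \<Omega>) (\<lambda>x. g x * f x)"
    using m by (intro Bochner_Integration.integrable_bound[OF i] borel_measurable_times AE_I2; simp)+
qed

lemma L2D:
  assumes "f \<in> L2_space \<Omega>"
  shows "f \<in> borel_measurable (lebesgue_on \<Omega>)" "integrable (lebesgue_on \<Omega>) (\<lambda>x. (norm (f x))\<^sup>2)"
  using assms by (auto simp: L2_space_def)

lemma integrable_one: "integrable (lebesgue_on \<Omega>) (\<lambda>x. 1::real)"
  using domain_lmeasurable by (simp add: lmeasurable_iff_integrable integrable_restrict_space)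

lemma L2_integrable:
  fixes f :: "real ^ 'n \<Rightarrow> 'b::euclidean_space"
  assumes "f \<in> L2_space \<Omega>" shows "integrable (lebesgue_on \<Omega>) f"
proof (rule Bochner_Integration.integrable_bound)
  note integrable_one
  then show "integrable (lebesgue_on \<Omega>) (\<lambda>x. 1 + (norm (f x))\<^sup>2)"
    using L2D[OF assms] by simp
  have "y \<le> 1 + y\<^sup>2" for y :: real
    using sum_squares_bound[of y 1] by (smt (verit) zero_le_power2 power_one mult_1_right)
  then show "AE x in lebesgue_on \<Omega>. norm (f x) \<le> norm (1 + (norm (f x))\<^sup>2)"
    by (auto simp: abs_of_nonneg intro!: AE_I2)
qed (use L2D[OF assms] in auto)

lemma L2_add:
  fixes f g :: "real ^ 'n \<Rightarrow> 'b::euclidean_space"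
  assumes "f \<in> L2_space \<Omega>" "g \<in> L2_space \<Omega>"
  shows "(\<lambda>x. f x + g x) \<in> L2_space \<Omega>"
proof -
  have "integrable (lebesgue_on \<Omega>) (\<lambda>x. (norm (f x + g x))\<^sup>2)"
  proof (rule Bochner_Integration.integrable_bound)
    show "integrable (lebesgue_on \<Omega>) (\<lambda>x. 2 * (norm (f x))\<^sup>2 + 2 * (norm (g x))\<^sup>2)"
      using L2D(2)[OF assms(1)] L2D(2)[OF assms(2)] by simp
    show "(\<lambda>x. (norm (f x + g x))\<^sup>2) \<in> borel_measurable (lebesgue_on \<Omega>)"
      using L2D(1)[OF assms(1)] L2D(1)[OF assms(2)] by simp
    show "AE x in lebesgue_on \<Omega>. norm ((norm (f x + g x))\<^sup>2) \<le> norm (2 * (norm (f x))\<^sup>2 + 2 * (norm (g x))\<^sup>2)"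
      by (simp add: norm_sq_add_le)
  qed
  then show ?thesis
    using L2D(1)[OF assms(1)] L2D(1)[OF assms(2)] by (simp add: L2_space_def)
qed

lemma L2_bounded_mult:
  fixes f :: "real ^ 'n \<Rightarrow> 'b::euclidean_space" and g :: "real ^ 'n \<Rightarrow> 'c::euclidean_space"
  assumes f: "f \<in> L2_space \<Omega>" and g: "g \<in> borel_measurable (lebesgue_on \<Omega>)"
    and \<rho>: "continuous_on UNIV \<rho>" and le: "\<And>x. norm (g x) \<le> norm (f x) * \<rho> x"
  shows "g \<in> L2_space \<Omega>"
proof -
  have "integrable (lebesgue_on \<Omega>) (\<lambda>x. (norm (g x))\<^sup>2)"
  proof (rule Bochner_Integration.integrable_bound)
    show "integrable (lebesgue_on \<Omega>) (\<lambda>x. (norm (f x))\<^sup>2 * (\<rho> x)\<^sup>2)"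
      by (intro integrable_mult_bounded L2D f continuous_intros \<rho>)
    have "(norm (g x))\<^sup>2 \<le> (norm (f x))\<^sup>2 * (\<rho> x)\<^sup>2" for x
      using power_mono[OF le[of x], of 2] by (simp add: power_mult_distrib)
    then show "AE x in lebesgue_on \<Omega>. norm ((norm (g x))\<^sup>2) \<le> norm ((norm (f x))\<^sup>2 * (\<rho> x)\<^sup>2)"
      by (auto intro!: AE_I2)
  qed (use g in auto)
  then show ?thesis using g by (simp add: L2_space_def)
qed

lemma L2_minus: "f \<in> L2_space \<Omega> \<Longrightarrow> (\<lambda>x. - f x) \<in> L2_space \<Omega>"
  by (auto simp: L2_space_def)

lemma L2_diff:
  fixes f g :: "real ^ 'n \<Rightarrow> 'b::euclidean_space"
  shows "f \<in> L2_space \<Omega> \<Longrightarrow> g \<in> L2_space \<Omega> \<Longrightarrow> (\<lambda>x. f x - g x) \<in> L2_space \<Omega>"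
  using L2_add[OF _ L2_minus] by fastforce

lemma L2_nth:
  fixes f :: "real ^ 'n \<Rightarrow> complex ^ 'n"
  assumes "f \<in> L2_space \<Omega>" shows "(\<lambda>x. f x $ i) \<in> L2_space \<Omega>"
  by (rule L2_bounded_mult[OF assms, where \<rho>="\<lambda>_. 1"])
     (use L2D(1)[OF assms] in \<open>simp_all add: borel_measurable_vec Finite_Cartesian_Product.norm_nth_le\<close>)

lemma continuous_L2:
  fixes f :: "real ^ 'n \<Rightarrow> 'b::euclidean_space"
  assumes "continuous_on UNIV f" shows "f \<in> L2_space \<Omega>"
proof (rule L2_bounded_mult[where f="\<lambda>_. 1::real" and \<rho>="\<lambda>x. norm (f x)"])
  show "(\<lambda>_. 1::real) \<in> L2_space \<Omega>" using integrable_one by (simp add: L2_space_def)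
  show "continuous_on UNIV (\<lambda>x. norm (f x))" using assms by (rule continuous_on_norm)
  show "f \<in> borel_measurable (lebesgue_on \<Omega>)"
    using assms by (rule continuous_borel_measurable_lebesgue_on)
qed simp

lemma weak_grad_spec:
  assumes "u \<in> H1 \<Omega>"
  shows "weak_grad \<Omega> u \<in> L2_space \<Omega>" "is_weak_grad \<Omega> u (weak_grad \<Omega> u)"
proof -
  have "\<exists>g. g \<in> L2_space \<Omega> \<and> is_weak_grad \<Omega> u g" using assms by (auto simp: H1_def)
  from someI_ex[OF this] show "weak_grad \<Omega> u \<in> L2_space \<Omega>" "is_weak_grad \<Omega> u (weak_grad \<Omega> u)"
    by (simp_all add: weak_grad_def)
qed

lemma H1_L2: "u \<in> H1 \<Omega> \<Longrightarrow> u \<in> L2_space \<Omega>"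
  by (simp add: H1_def)

lemma weak_grad_unique:
  assumes "g \<in> L2_space \<Omega>" "is_weak_grad \<Omega> u g" "g' \<in> L2_space \<Omega>" "is_weak_grad \<Omega> u g'"
  shows "AE x in lebesgue_on \<Omega>. g x = g' x"
proof -
  have "AE x in lebesgue_on \<Omega>. g x $ i - g' x $ i = 0" for i
  proof (rule fundamental_lemma_calculus_of_variations[OF open_domain])
    note int = L2_integrable[OF L2_nth[OF assms(1), of i]] L2_integrable[OF L2_nth[OF assms(3), of i]]
    show "integrable (lebesgue_on \<Omega>) (\<lambda>x. g x $ i - g' x $ i)"
      using int by simp
    fix \<phi> assume \<phi>: "\<phi> \<in> test_functions \<Omega>"
    have "continuous_on UNIV \<phi>" using \<phi> C_k_continuous[OF test_function_C_k] by blast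
    then have "integrable (lebesgue_on \<Omega>) (\<lambda>x. g x $ i * \<phi> x)" "integrable (lebesgue_on \<Omega>) (\<lambda>x. g' x $ i * \<phi> x)"
      by (intro integrable_mult_bounded int; simp)+
    moreover have "(\<integral>x. g x $ i * \<phi> x \<partial>lebesgue_on \<Omega>) = (\<integral>x. g' x $ i * \<phi> x \<partial>lebesgue_on \<Omega>)"
      using assms(2,4)[unfolded is_weak_grad_def, rule_format, OF \<phi>, of i] by simp
    ultimately show "(\<integral>x. (g x $ i - g' x $ i) * \<phi> x \<partial>lebesgue_on \<Omega>) = 0"
      by (simp add: left_diff_distrib)
  qed
  then have "AE x in lebesgue_on \<Omega>. \<forall>i\<in>UNIV. g x $ i - g' x $ i = 0"
    by (intro AE_finite_allI) simp_all
  then show ?thesis by eventually_elim (simp add: vec_eq_iff)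
qed

lemma H1I:
  assumes "u \<in> L2_space \<Omega>" "g \<in> L2_space \<Omega>" "is_weak_grad \<Omega> u g"
  shows "u \<in> H1 \<Omega>" "AE x in lebesgue_on \<Omega>. weak_grad \<Omega> u x = g x"
proof -
  show u: "u \<in> H1 \<Omega>" using assms by (auto simp: H1_def)
  show "AE x in lebesgue_on \<Omega>. weak_grad \<Omega> u x = g x"
    by (rule weak_grad_unique[OF weak_grad_spec[OF u] assms(2,3)])
qed

lemma test_function_H1:
  assumes \<phi>: "\<phi> \<in> test_functions \<Omega>"
  shows "\<phi> \<in> H1 \<Omega>" "AE x in lebesgue_on \<Omega>. weak_grad \<Omega> \<phi> x = grad \<phi> x"
proof -
  note C\<phi> = test_function_C_k[OF \<phi>]
  note c\<phi> = C_k_continuous[OF C\<phi>] C_k_grad_continuous[OF C\<phi>]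
  have "is_weak_grad \<Omega> \<phi> (grad \<phi>)"
    unfolding is_weak_grad_def
  proof (intro ballI allI)
    fix \<eta> and i :: 'n assume \<eta>: "\<eta> \<in> test_functions \<Omega>"
    note C\<eta> = test_function_C_k[OF \<eta>]
    note c\<eta> = C_k_continuous[OF C\<eta>] C_k_grad_continuous[OF C\<eta>]
    let ?e = "axis i 1 :: real ^ 'n"
    obtain K where K: "compact K" "K \<subseteq> \<Omega>" "\<And>x. x \<notin> K \<Longrightarrow> \<eta> x = 0"
        "\<And>x. x \<notin> K \<Longrightarrow> frechet_derivative \<eta> (at x) = (\<lambda>h. 0)"
      using test_functionE[OF \<eta>] by metis
    have "(\<integral>x. frechet_derivative (\<lambda>x. \<phi> x * \<eta> x) (at x) ?e \<partial>lebesgue) = 0"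
      by (rule integral_partial_derivative_zero[of _ K]) (use K C_k_mult[OF C\<phi> C\<eta>] axis_in_Basis in auto)
    also have "(\<lambda>x. frechet_derivative (\<lambda>x. \<phi> x * \<eta> x) (at x) ?e)
        = (\<lambda>x. \<phi> x * frechet_derivative \<eta> (at x) ?e + frechet_derivative \<phi> (at x) ?e * \<eta> x)"
      using frechet_derivative_mult[OF C\<phi> C\<eta>] by blast
    also have "\<dots> = (\<lambda>x. indicator \<Omega> x *\<^sub>R
          (\<phi> x * frechet_derivative \<eta> (at x) ?e + frechet_derivative \<phi> (at x) ?e * \<eta> x))"
    proof
      fix x
      show "\<phi> x * frechet_derivative \<eta> (at x) ?e + frechet_derivative \<phi> (at x) ?e * \<eta> x
        = indicator \<Omega> x *\<^sub>R (\<phi> x * frechet_derivative \<eta> (at x) ?e + frechet_derivative \<phi> (at x) ?e * \<eta> x)"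
      proof (cases "x \<in> \<Omega>")
        case False
        then have "x \<notin> K" using K(2) by blast
        then show ?thesis using K(3,4) by simp
      qed simp
    qed
    finally have "(\<integral>x. \<phi> x * frechet_derivative \<eta> (at x) ?e + frechet_derivative \<phi> (at x) ?e * \<eta> x \<partial>lebesgue_on \<Omega>) = 0"
      by (simp add: integral_restrict_space)
    moreover have "integrable (lebesgue_on \<Omega>) (\<lambda>x. \<phi> x * frechet_derivative \<eta> (at x) ?e)"
      "integrable (lebesgue_on \<Omega>) (\<lambda>x. frechet_derivative \<phi> (at x) ?e * \<eta> x)"
      by (intro L2_integrable continuous_L2 continuous_on_mult c\<phi> c\<eta>)+
    ultimately show "(\<integral>x. \<phi> x * frechet_derivative \<eta> (at x) ?e \<partial>lebesgue_on \<Omega>)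
       = - (\<integral>x. grad \<phi> x $ i * \<eta> x \<partial>lebesgue_on \<Omega>)"
      by (simp add: grad_def eq_neg_iff_add_eq_0)
  qed
  then show "\<phi> \<in> H1 \<Omega>" "AE x in lebesgue_on \<Omega>. weak_grad \<Omega> \<phi> x = grad \<phi> x"
    by (rule H1I[OF continuous_L2[OF c\<phi>(1)] continuous_L2[OF c\<phi>(3)]])+
qed

lemma H1_diff:
  assumes u: "u \<in> H1 \<Omega>" and w: "w \<in> H1 \<Omega>"
  shows "(\<lambda>x. u x - w x) \<in> H1 \<Omega>"
    "AE x in lebesgue_on \<Omega>. weak_grad \<Omega> (\<lambda>x. u x - w x) x = weak_grad \<Omega> u x - weak_grad \<Omega> w x"
proof -
  note gu = weak_grad_spec[OF u] and gw = weak_grad_spec[OF w]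
  have "is_weak_grad \<Omega> (\<lambda>x. u x - w x) (\<lambda>x. weak_grad \<Omega> u x - weak_grad \<Omega> w x)"
    unfolding is_weak_grad_def
  proof (intro ballI allI)
    fix \<eta> and i :: 'n assume \<eta>: "\<eta> \<in> test_functions \<Omega>"
    note C\<eta> = test_function_C_k[OF \<eta>]
    note c\<eta> = C_k_continuous[OF C\<eta>] C_k_grad_continuous[OF C\<eta>]
    have "integrable (lebesgue_on \<Omega>) (\<lambda>x. u x * frechet_derivative \<eta> (at x) (axis i 1))"
      "integrable (lebesgue_on \<Omega>) (\<lambda>x. w x * frechet_derivative \<eta> (at x) (axis i 1))"
      "integrable (lebesgue_on \<Omega>) (\<lambda>x. weak_grad \<Omega> u x $ i * \<eta> x)"
      "integrable (lebesgue_on \<Omega>) (\<lambda>x. weak_grad \<Omega> w x $ i * \<eta> x)"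
      by (intro integrable_mult_bounded L2_integrable L2_nth H1_L2 u w gu gw c\<eta>)+
    then show "(\<integral>x. (u x - w x) * frechet_derivative \<eta> (at x) (axis i 1) \<partial>lebesgue_on \<Omega>)
       = - (\<integral>x. (weak_grad \<Omega> u x - weak_grad \<Omega> w x) $ i * \<eta> x \<partial>lebesgue_on \<Omega>)"
      using gu(2)[unfolded is_weak_grad_def, rule_format, OF \<eta>, of i]
        gw(2)[unfolded is_weak_grad_def, rule_format, OF \<eta>, of i]
      by (simp add: left_diff_distrib)
  qed
  then show "(\<lambda>x. u x - w x) \<in> H1 \<Omega>"
    "AE x in lebesgue_on \<Omega>. weak_grad \<Omega> (\<lambda>x. u x - w x) x = weak_grad \<Omega> u x - weak_grad \<Omega> w x"
    by (rule H1I[OF L2_diff[OF H1_L2[OF u] H1_L2[OF w]] L2_diff[OF gu(1) gw(1)]])+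
qed

text \<open>
  The product rule for a smooth factor: \<open>\<rho>\<close> is moved onto the test function, and the error made there is
  the term with \<open>grad \<rho>\<close>.
\<close>

lemma H1_mult:
  assumes u: "u \<in> H1 \<Omega>" and \<rho>: "\<And>k. C_k k (\<rho> :: real ^ 'n \<Rightarrow> real)"
  shows "(\<lambda>x. of_real (\<rho> x) * u x) \<in> H1 \<Omega>"
    "AE x in lebesgue_on \<Omega>. weak_grad \<Omega> (\<lambda>x. of_real (\<rho> x) * u x) x
        = \<rho> x *\<^sub>R weak_grad \<Omega> u x + cvec (u x) (grad \<rho> x)"
proof -
  note gu = weak_grad_spec[OF u]
  let ?g = "\<lambda>x. \<rho> x *\<^sub>R weak_grad \<Omega> u x + cvec (u x) (grad \<rho> x)"
  note c\<rho> = C_k_continuous[OF \<rho>] C_k_grad_continuous[OF \<rho>]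
  have c1: "continuous_on UNIV (\<lambda>x. frechet_derivative (\<lambda>x. complex_of_real (\<rho> x)) (at x) (axis i 1))" for i
    using C_k_grad_continuous[OF C_k_of_real[OF \<rho>]] by blast
  have m: "u \<in> borel_measurable (lebesgue_on \<Omega>)" "weak_grad \<Omega> u \<in> borel_measurable (lebesgue_on \<Omega>)"
      "\<rho> \<in> borel_measurable (lebesgue_on \<Omega>)" "\<And>i. (\<lambda>x. grad \<rho> x $ i) \<in> borel_measurable (lebesgue_on \<Omega>)"
    by (intro L2D(1) H1_L2 u gu continuous_borel_measurable_lebesgue_on c\<rho>
        borel_measurable_vec[THEN iffD1, rule_format])+
  have L2: "(\<lambda>x. of_real (\<rho> x) * u x) \<in> L2_space \<Omega>"
    by (rule L2_bounded_mult[OF H1_L2[OF u], where \<rho>="\<lambda>x. \<bar>\<rho> x\<bar>"])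
       (use m c\<rho> in \<open>auto simp: norm_mult intro!: continuous_intros\<close>)
  have "(\<lambda>x. \<rho> x *\<^sub>R weak_grad \<Omega> u x) \<in> L2_space \<Omega>"
    by (rule L2_bounded_mult[OF gu(1), where \<rho>="\<lambda>x. \<bar>\<rho> x\<bar>"])
       (use m c\<rho> in \<open>auto intro!: continuous_intros\<close>)
  moreover have "(\<lambda>x. cvec (u x) (grad \<rho> x)) \<in> L2_space \<Omega>"
  proof (rule L2_bounded_mult[OF H1_L2[OF u], where \<rho>="\<lambda>x. norm (grad \<rho> x)"])
    show "(\<lambda>x. cvec (u x) (grad \<rho> x)) \<in> borel_measurable (lebesgue_on \<Omega>)"
      unfolding borel_measurable_vec using m by simp
  qed (use c\<rho> in \<open>auto simp: norm_cvec intro!: continuous_intros\<close>)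
  ultimately have gL2: "?g \<in> L2_space \<Omega>" by (rule L2_add)
  have "is_weak_grad \<Omega> (\<lambda>x. of_real (\<rho> x) * u x) ?g"
    unfolding is_weak_grad_def
  proof (intro ballI allI)
    fix \<eta> and i :: 'n assume \<eta>: "\<eta> \<in> test_functions \<Omega>"
    note C\<eta> = test_function_C_k[OF \<eta>]
    note c\<eta> = C_k_continuous[OF C\<eta>] C_k_grad_continuous[OF C\<eta>]
    let ?e = "axis i 1 :: real ^ 'n"
    let ?r = "\<lambda>x. complex_of_real (\<rho> x)"
    let ?dr = "\<lambda>x. complex_of_real (grad \<rho> x $ i)"
    let ?d\<eta> = "\<lambda>x. frechet_derivative \<eta> (at x) ?e"
    have dr: "frechet_derivative ?r (at x) ?e = ?dr x" for x
      using frechet_derivative_of_real[OF \<rho>] by (simp add: grad_def)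
    have cdr: "continuous_on UNIV ?dr" 
      using c1[of i] by (simp add: dr)
    have cr: "continuous_on UNIV ?r" using c\<rho> by (intro continuous_intros)
    let ?f1 = "\<lambda>x. of_real (\<rho> x) * u x * ?d\<eta> x" and ?f2 = "\<lambda>x. u x * (?dr x * \<eta> x)"
      and ?f3 = "\<lambda>x. weak_grad \<Omega> u x $ i * (?r x * \<eta> x)"
    have int: "integrable (lebesgue_on \<Omega>) ?f1" "integrable (lebesgue_on \<Omega>) ?f2" "integrable (lebesgue_on \<Omega>) ?f3"
      by (intro integrable_mult_bounded L2_integrable L2_nth H1_L2 u gu L2 c\<eta> cdr cr continuous_intros)+
    have "(\<lambda>x. u x * frechet_derivative (\<lambda>x. ?r x * \<eta> x) (at x) ?e) = (\<lambda>x. ?f1 x + ?f2 x)"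
      using frechet_derivative_mult[OF C_k_of_real[OF \<rho>] C\<eta>]
      by (simp add: dr algebra_simps)
    then have "integral\<^sup>L (lebesgue_on \<Omega>) ?f1 + integral\<^sup>L (lebesgue_on \<Omega>) ?f2
        = - integral\<^sup>L (lebesgue_on \<Omega>) ?f3"
      using gu(2)[unfolded is_weak_grad_def, rule_format, OF C_k_mult_test_function[OF \<eta> C_k_of_real[OF \<rho>]], of i]
        Bochner_Integration.integral_add[OF int(1,2)] by (simp only:)
    moreover have "(\<lambda>x. ?g x $ i * \<eta> x) = (\<lambda>x. ?f3 x + ?f2 x)"
      by (simp add: fun_eq_iff scaleR_conv_of_real[where 'a=complex] algebra_simps)
    ultimately show "integral\<^sup>L (lebesgue_on \<Omega>) ?f1 = - (\<integral>x. ?g x $ i * \<eta> x \<partial>lebesgue_on \<Omega>)"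
      by (simp only: Bochner_Integration.integral_add[OF int(3,2)]) (simp add: eq_diff_eq)
  qed
  then show "(\<lambda>x. of_real (\<rho> x) * u x) \<in> H1 \<Omega>"
    "AE x in lebesgue_on \<Omega>. weak_grad \<Omega> (\<lambda>x. of_real (\<rho> x) * u x) x = ?g x"
    by (rule H1I[OF L2 gL2])+
qed

lemma H1_norm_sq: "(H1_norm \<Omega> u)\<^sup>2 = (\<integral>x. (norm (u x))\<^sup>2 \<partial>lebesgue_on \<Omega>) + (\<integral>x. (norm (weak_grad \<Omega> u x))\<^sup>2 \<partial>lebesgue_on \<Omega>)"
  by (simp add: H1_norm_def flip: L2_norm_sq)

lemma H1_mult_norm_le:
  assumes \<rho>: "\<And>k. C_k k (\<rho> :: real ^ 'n \<Rightarrow> real)"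
  shows "\<exists>B\<ge>0. \<forall>w\<in>H1 \<Omega>. H1_norm \<Omega> (\<lambda>x. of_real (\<rho> x) * w x) \<le> B * H1_norm \<Omega> w"
proof -
  note c\<rho> = C_k_continuous[OF \<rho>] C_k_grad_continuous[OF \<rho>]
  have "bounded ((\<lambda>x. (\<rho> x)\<^sup>2 + (norm (grad \<rho> x))\<^sup>2) ` closure \<Omega>)"
    using bounded_domain by (intro compact_imp_bounded compact_continuous_image continuous_intros continuous_on_subset[OF c\<rho>(3)] c\<rho>(1)) auto
  then obtain B0 where "\<forall>y\<in>(\<lambda>x. (\<rho> x)\<^sup>2 + (norm (grad \<rho> x))\<^sup>2) ` closure \<Omega>. norm y \<le> B0"
    unfolding bounded_iff by blast
  then have B0: "(\<rho> x)\<^sup>2 + (norm (grad \<rho> x))\<^sup>2 \<le> B0" if "x \<in> \<Omega>" for x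
    using that closure_subset by fastforce
  define B where "B = max B0 0"
  have B: "(\<rho> x)\<^sup>2 \<le> B" "(norm (grad \<rho> x))\<^sup>2 \<le> B" if "x \<in> \<Omega>" for x
    using B0[OF that] zero_le_power2[of "\<rho> x"] zero_le_power2[of "norm (grad \<rho> x)"]
    unfolding B_def by (intro max.coboundedI1; linarith)+
  have "0 \<le> B" by (simp add: B_def)
  have "H1_norm \<Omega> (\<lambda>x. of_real (\<rho> x) * w x) \<le> sqrt (3 * B) * H1_norm \<Omega> w" if w: "w \<in> H1 \<Omega>" for w
  proof -
    note gw = weak_grad_spec[OF w]
    have int: "integrable (lebesgue_on \<Omega>) (\<lambda>x. (norm (w x))\<^sup>2)"
      "integrable (lebesgue_on \<Omega>) (\<lambda>x. (norm (weak_grad \<Omega> w x))\<^sup>2)"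
      by (intro L2D(2) H1_L2 w gw)+
    have "(H1_norm \<Omega> (\<lambda>x. of_real (\<rho> x) * w x))\<^sup>2
        \<le> (\<integral>x. B * (norm (w x))\<^sup>2 \<partial>lebesgue_on \<Omega>)
         + (\<integral>x. 2 * B * (norm (weak_grad \<Omega> w x))\<^sup>2 + 2 * B * (norm (w x))\<^sup>2 \<partial>lebesgue_on \<Omega>)"
      unfolding H1_norm_sq
    proof (intro add_mono integral_mono_AE')
      show "AE x in lebesgue_on \<Omega>. (norm (of_real (\<rho> x) * w x))\<^sup>2 \<le> B * (norm (w x))\<^sup>2"
        by (intro AE_I2) (auto simp: norm_mult power_mult_distrib intro!: mult_right_mono B)
      have AE: "AE x in lebesgue_on \<Omega>. x \<in> \<Omega>" by (rule AE_I2) simp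
      show "AE x in lebesgue_on \<Omega>. (norm (weak_grad \<Omega> (\<lambda>x. of_real (\<rho> x) * w x) x))\<^sup>2
          \<le> 2 * B * (norm (weak_grad \<Omega> w x))\<^sup>2 + 2 * B * (norm (w x))\<^sup>2"
        using H1_mult(2)[OF w \<rho>] AE
      proof eventually_elim
        case (elim x)
        have "(norm (\<rho> x *\<^sub>R weak_grad \<Omega> w x))\<^sup>2 \<le> B * (norm (weak_grad \<Omega> w x))\<^sup>2"
          using B[OF elim(2)] by (auto simp: power_mult_distrib intro!: mult_right_mono)
        moreover have "(norm (cvec (w x) (grad \<rho> x)))\<^sup>2 \<le> B * (norm (w x))\<^sup>2"
          using mult_left_mono[OF B(2)[OF elim(2)], of "(cmod (w x))\<^sup>2"]
          by (simp add: norm_cvec power_mult_distrib mult.commute)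
        ultimately show ?case
          using norm_sq_add_le[of "\<rho> x *\<^sub>R weak_grad \<Omega> w x" "cvec (w x) (grad \<rho> x)"] elim(1) by simp
      qed
    qed (use \<open>0 \<le> B\<close> int in auto)
    also have "\<dots> \<le> 3 * B * (H1_norm \<Omega> w)\<^sup>2"
      unfolding H1_norm_sq using int \<open>0 \<le> B\<close> by (simp add: algebra_simps mult_left_mono)
    also have "\<dots> = (sqrt (3 * B) * H1_norm \<Omega> w)\<^sup>2"
      using \<open>0 \<le> B\<close> by (simp add: power_mult_distrib)
    finally show ?thesis
      by (rule power2_le_imp_le) (simp add: H1_norm_def \<open>0 \<le> B\<close>)
  qed
  then show ?thesis using \<open>0 \<le> B\<close> by (intro exI[of _ "sqrt (3 * B)"]) auto
qed

text \<open>
  Multiplying an approximating sequence of test functions by \<open>\<rho>\<close> gives an approximating sequence for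
  the product, since multiplication by \<open>\<rho>\<close> is bounded in the norm of \<^const>\<open>H1\<close>.
\<close>

lemma H1_0_mult:
  assumes u: "u \<in> H1_0 \<Omega>" and \<rho>: "\<And>k. C_k k (\<rho> :: real ^ 'n \<Rightarrow> real)"
  shows "(\<lambda>x. of_real (\<rho> x) * u x) \<in> H1_0 \<Omega>"
proof -
  have uH1: "u \<in> H1 \<Omega>" using u by (simp add: H1_0_def)
  obtain B where B: "B \<ge> 0" "\<And>w. w \<in> H1 \<Omega> \<Longrightarrow> H1_norm \<Omega> (\<lambda>x. of_real (\<rho> x) * w x) \<le> B * H1_norm \<Omega> w"
    using H1_mult_norm_le[OF \<rho>] by blast
  have "\<exists>\<eta>\<in>test_functions \<Omega>. H1_norm \<Omega> (\<lambda>x. of_real (\<rho> x) * u x - \<eta> x) < \<epsilon>" if "0 < \<epsilon>" for \<epsilon>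
  proof -
    obtain \<phi> where \<phi>: "\<phi> \<in> test_functions \<Omega>" "H1_norm \<Omega> (\<lambda>x. u x - \<phi> x) < \<epsilon> / (B + 1)"
    proof -
      have "0 < \<epsilon> / (B + 1)" using \<open>0 < \<epsilon>\<close> B(1) by simp
      then show ?thesis using u that unfolding H1_0_def by blast
    qed
    let ?w = "\<lambda>x. u x - \<phi> x"
    have "H1_norm \<Omega> (\<lambda>x. of_real (\<rho> x) * ?w x) \<le> B * H1_norm \<Omega> ?w"
      by (intro B H1_diff uH1 test_function_H1 \<phi>)
    also have "\<dots> \<le> (B + 1) * H1_norm \<Omega> ?w"
      by (intro mult_right_mono) (simp_all add: H1_norm_def)
    also have "\<dots> < \<epsilon>" using \<phi>(2) B(1) by (simp add: pos_less_divide_eq mult.commute)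
    finally show ?thesis
      using C_k_mult_test_function[OF \<phi>(1) C_k_of_real[OF \<rho>]]
      by (intro bexI[of _ "\<lambda>x. of_real (\<rho> x) * \<phi> x"]) (simp_all add: right_diff_distrib)
  qed
  then show ?thesis
    using H1_mult(1)[OF uH1 \<rho>] by (simp add: H1_0_def)
qed

end

section \<open>Energy estimates for eigenfunctions\<close>

definition Re_vec :: "complex ^ 'n \<Rightarrow> real ^ 'n" where "Re_vec v = (\<chi> i. Re (v $ i))"
definition Im_vec :: "complex ^ 'n \<Rightarrow> real ^ 'n" where "Im_vec v = (\<chi> i. Im (v $ i))"

lemma norm_sq_Re_Im_vec: "(norm v)\<^sup>2 = (norm (Re_vec v))\<^sup>2 + (norm (Im_vec v))\<^sup>2"
  by (simp add: vec_norm_sq Re_vec_def Im_vec_def cmod_power2 sum.distrib)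

text \<open>
  The integrand of \<^const>\<open>elliptic_form\<close>. Its real part splits into two real quadratic expressions, so that
  all estimates reduce to real vectors.
\<close>

definition sesq :: "real ^ 'n ^ 'n \<Rightarrow> complex ^ 'n \<Rightarrow> complex ^ 'n \<Rightarrow> complex" where
  "sesq a v w = (\<Sum>i\<in>UNIV. cnj (v $ i) * (\<Sum>j\<in>UNIV. complex_of_real (a $ i $ j) * w $ j))"

lemma Re_sesq: "Re (sesq a v w) = Re_vec v \<bullet> (a *v Re_vec w) + Im_vec v \<bullet> (a *v Im_vec w)"
  by (simp add: sesq_def inner_vec_def matrix_vector_mult_def Re_vec_def Im_vec_def sum.distrib)

lemma inner_matrix_symmetric:
  fixes a :: "real ^ 'n ^ 'n"
  assumes "transpose a = a" shows "v \<bullet> (a *v w) = w \<bullet> (a *v v)"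
  using dot_lmul_matrix[of v a w] assms
  by (metis inner_commute transpose_matrix_vector)

text \<open>
  Expansion of the nonnegative value of the quadratic form at \<open>\<tau> v - w\<close>.
\<close>

lemma psd_am_gm:
  fixes a :: "real ^ 'n ^ 'n"
  assumes "transpose a = a" "\<And>\<xi>. 0 \<le> \<xi> \<bullet> (a *v \<xi>)" "0 < \<tau>"
  shows "2 * (v \<bullet> (a *v w)) \<le> \<tau> * (v \<bullet> (a *v v)) + (w \<bullet> (a *v w)) / \<tau>"
proof -
  have "0 \<le> (\<tau> *\<^sub>R v - w) \<bullet> (a *v (\<tau> *\<^sub>R v - w))" by (rule assms)
  also have "\<dots> = \<tau> * (\<tau> * (v \<bullet> (a *v v)) - 2 * (v \<bullet> (a *v w))) + w \<bullet> (a *v w)"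
    using inner_matrix_symmetric[OF assms(1), of v w]
    by (simp add: matrix_vector_mult_diff_distrib matrix_vector_mult_scaleR inner_diff algebra_simps)
  finally show ?thesis using assms(3) by (simp add: field_simps)
qed

text \<open>
  This makes the integrand of the form integrable for merely measurable coefficients.
\<close>

lemma psd_entry_bound:
  fixes a :: "real ^ 'n ^ 'n"
  assumes sym: "transpose a = a" and psd: "\<And>\<xi>. 0 \<le> \<xi> \<bullet> (a *v \<xi>)"
    and le: "\<And>\<xi>. \<xi> \<bullet> (a *v \<xi>) \<le> \<theta> * (norm \<xi>)\<^sup>2"
  shows "\<bar>a $ i $ j\<bar> \<le> \<theta>"
proof -
  let ?e = "\<lambda>i. axis i 1 :: real ^ 'n"
  have ij: "?e i \<bullet> (a *v ?e j) = a $ i $ j" for i j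
    by (simp add: inner_axis' matrix_vector_mult_basis column_def)
  have "a $ k $ k \<le> \<theta>" for k
    using le[of "?e k"] by (simp add: ij)
  moreover have "2 * (a $ i $ j) \<le> a $ i $ i + a $ j $ j"
    using psd_am_gm[OF sym psd, of 1 "?e i" "?e j"] by (simp add: ij)
  moreover have "- 2 * (a $ i $ j) \<le> a $ i $ i + a $ j $ j"
    using psd_am_gm[OF sym psd, of 1 "- ?e i" "?e j"]
    by (simp add: ij linear_neg[OF matrix_vector_mul_linear])
  ultimately show ?thesis by (smt (verit))
qed

locale elliptic_problem = bounded_domain \<Omega> for \<Omega> :: "(real ^ 'n) set" +
  fixes A :: "real ^ 'n \<Rightarrow> real ^ 'n ^ 'n" and \<theta>m \<theta>p :: real
  assumes theta_pos: "0 < \<theta>m" "0 < \<theta>p"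
    and A_measurable: "A \<in> borel_measurable (lebesgue_on \<Omega>)"
    and A_sym: "\<And>x. x \<in> \<Omega> \<Longrightarrow> transpose (A x) = A x"
    and A_lower: "\<And>x \<xi>. x \<in> \<Omega> \<Longrightarrow> \<theta>m * (norm \<xi>)\<^sup>2 \<le> \<xi> \<bullet> (A x *v \<xi>)"
    and A_upper: "\<And>x \<xi>. x \<in> \<Omega> \<Longrightarrow> \<xi> \<bullet> (A x *v \<xi>) \<le> \<theta>p * (norm \<xi>)\<^sup>2"
begin

lemma A_psd: "x \<in> \<Omega> \<Longrightarrow> 0 \<le> \<xi> \<bullet> (A x *v \<xi>)"
  using A_lower[of x \<xi>] theta_pos(1) by (meson mult_nonneg_nonneg less_imp_le order_trans zero_le_power2)

lemma elliptic_form_sesq: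
  "elliptic_form \<Omega> A u v = (\<integral>x. sesq (A x) (weak_grad \<Omega> u x) (weak_grad \<Omega> v x) \<partial>lebesgue_on \<Omega>)"
  by (simp add: elliptic_form_def sesq_def)

lemma norm_sesq_le:
  assumes "x \<in> \<Omega>"
  shows "norm (sesq (A x) v w) \<le> real CARD('n) * real CARD('n) * \<theta>p * ((norm v)\<^sup>2 + (norm w)\<^sup>2)"
proof -
  have "norm (sesq (A x) v w) \<le> (\<Sum>i\<in>UNIV. \<Sum>j\<in>UNIV. norm (v $ i) * (\<bar>A x $ i $ j\<bar> * norm (w $ j)))"
    unfolding sesq_def sum_distrib_left
    by (intro order_trans[OF norm_sum] sum_mono) (simp add: norm_mult)
  also have "\<dots> \<le> (\<Sum>i\<in>(UNIV::'n set). \<Sum>j\<in>(UNIV::'n set). \<theta>p * ((norm v)\<^sup>2 + (norm w)\<^sup>2))"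
  proof (intro sum_mono)
    fix i j
    have "norm (v $ i) * (\<bar>A x $ i $ j\<bar> * norm (w $ j)) \<le> norm v * (\<theta>p * norm w)"
      by (intro mult_mono psd_entry_bound A_sym A_psd A_upper assms Finite_Cartesian_Product.norm_nth_le)
         (use theta_pos in auto)
    also have "\<dots> \<le> \<theta>p * ((norm v)\<^sup>2 + (norm w)\<^sup>2)"
    proof -
      have "0 \<le> norm v * norm w" by simp
      then have "norm v * norm w \<le> (norm v)\<^sup>2 + (norm w)\<^sup>2"
        using sum_squares_bound[of "norm v" "norm w"] by linarith
      then show ?thesis
        using mult_left_mono[of _ _ \<theta>p] theta_pos(2) by (simp add: mult.left_commute[of _ \<theta>p])
    qed
    finally show "norm (v $ i) * (\<bar>A x $ i $ j\<bar> * norm (w $ j)) \<le> \<theta>p * ((norm v)\<^sup>2 + (norm w)\<^sup>2)" .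
  qed
  also have "\<dots> = real CARD('n) * real CARD('n) * \<theta>p * ((norm v)\<^sup>2 + (norm w)\<^sup>2)" by simp
  finally show ?thesis .
qed

lemma integrable_sesq:
  assumes v: "v \<in> L2_space \<Omega>" and w: "w \<in> L2_space \<Omega>"
  shows "integrable (lebesgue_on \<Omega>) (\<lambda>x. sesq (A x) (v x) (w x))"
proof (rule Bochner_Integration.integrable_bound)
  show "integrable (lebesgue_on \<Omega>)
      (\<lambda>x. real CARD('n) * real CARD('n) * \<theta>p * ((norm (v x))\<^sup>2 + (norm (w x))\<^sup>2))"
    using L2D(2)[OF v] L2D(2)[OF w] by simp
  have comp: "(\<lambda>x. A x $ i $ j) \<in> borel_measurable (lebesgue_on \<Omega>)"       "(\<lambda>x. v x $ i) \<in> borel_measurable (lebesgue_on \<Omega>)"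
      "(\<lambda>x. w x $ i) \<in> borel_measurable (lebesgue_on \<Omega>)" for i j
    using A_measurable L2D(1)[OF v] L2D(1)[OF w] by (simp_all add: borel_measurable_vec)
  show "(\<lambda>x. sesq (A x) (v x) (w x)) \<in> borel_measurable (lebesgue_on \<Omega>)"
    unfolding sesq_def
    by (intro borel_measurable_sum borel_measurable_times
        borel_measurable_continuous_on[OF continuous_on_cnj[OF continuous_on_id]] 
        borel_measurable_continuous_on[OF continuous_on_of_real[OF continuous_on_id]] comp)
  show "AE x in lebesgue_on \<Omega>. norm (sesq (A x) (v x) (w x))
      \<le> norm (real CARD('n) * real CARD('n) * \<theta>p * ((norm (v x))\<^sup>2 + (norm (w x))\<^sup>2))"
    by (intro AE_I2 order_trans[OF norm_sesq_le]) auto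
qed

lemma eigenfunctionD:
  assumes "(\<psi>, \<lambda>x. complex_of_real E * \<psi> x) \<in> dirichlet_operator \<Omega> A"
  shows "\<psi> \<in> H1_0 \<Omega>" "\<psi> \<in> H1 \<Omega>"
    "\<And>v. v \<in> H1_0 \<Omega> \<Longrightarrow> (\<integral>x. Re (sesq (A x) (weak_grad \<Omega> v x) (weak_grad \<Omega> \<psi> x)) \<partial>lebesgue_on \<Omega>)
        = Re (\<integral>x. cnj (v x) * (of_real E * \<psi> x) \<partial>lebesgue_on \<Omega>)"
proof -
  show \<psi>: "\<psi> \<in> H1_0 \<Omega>" "\<psi> \<in> H1 \<Omega>"
    using assms by (auto simp: dirichlet_operator_def H1_0_def)
  fix v assume v: "v \<in> H1_0 \<Omega>"
  then have "v \<in> H1 \<Omega>" by (simp add: H1_0_def)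
  then have "integrable (lebesgue_on \<Omega>) (\<lambda>x. sesq (A x) (weak_grad \<Omega> v x) (weak_grad \<Omega> \<psi> x))"
    by (intro integrable_sesq weak_grad_spec \<psi>)
  moreover have "elliptic_form \<Omega> A v \<psi> = L2_inner \<Omega> v (\<lambda>x. of_real E * \<psi> x)"
    using assms v by (simp add: dirichlet_operator_def)
  ultimately show "(\<integral>x. Re (sesq (A x) (weak_grad \<Omega> v x) (weak_grad \<Omega> \<psi> x)) \<partial>lebesgue_on \<Omega>)
        = Re (\<integral>x. cnj (v x) * (of_real E * \<psi> x) \<partial>lebesgue_on \<Omega>)"
    by (simp add: elliptic_form_sesq L2_inner_def)
qed

lemma Re_inner_weighted:
  "Re (\<integral>x. cnj (of_real (\<rho> x) * \<psi> x) * (of_real E * \<psi> x) \<partial>lebesgue_on \<Omega>)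
     = E * (\<integral>x. \<rho> x * (norm (\<psi> x))\<^sup>2 \<partial>lebesgue_on \<Omega>)"
proof -
  have "(\<lambda>x. cnj (of_real (\<rho> x) * \<psi> x) * (of_real E * \<psi> x))
      = (\<lambda>x. complex_of_real (E * (\<rho> x * (norm (\<psi> x))\<^sup>2)))"
  proof
    fix x
    have "cnj (\<psi> x) * \<psi> x = of_real ((norm (\<psi> x))\<^sup>2)"
      by (metis complex_norm_square mult.commute)
    then show "cnj (of_real (\<rho> x) * \<psi> x) * (of_real E * \<psi> x) = complex_of_real (E * (\<rho> x * (norm (\<psi> x))\<^sup>2))"
      by (simp add: mult_ac)
  qed
  then show ?thesis by (simp only: integral_complex_of_real) simp
qed

lemma eigenfunction_energy:
  assumes "(\<psi>, \<lambda>x. complex_of_real E * \<psi> x) \<in> dirichlet_operator \<Omega> A"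
  shows "\<theta>m * (\<integral>x. (norm (weak_grad \<Omega> \<psi> x))\<^sup>2 \<partial>lebesgue_on \<Omega>)
       \<le> E * (\<integral>x. (norm (\<psi> x))\<^sup>2 \<partial>lebesgue_on \<Omega>)"
proof -
  note \<psi> = eigenfunctionD[OF assms]
  note g = weak_grad_spec[OF \<psi>(2)]
  have "(\<integral>x. \<theta>m * (norm (weak_grad \<Omega> \<psi> x))\<^sup>2 \<partial>lebesgue_on \<Omega>)
     \<le> (\<integral>x. Re (sesq (A x) (weak_grad \<Omega> \<psi> x) (weak_grad \<Omega> \<psi> x)) \<partial>lebesgue_on \<Omega>)"
  proof (rule integral_mono)
    show "integrable (lebesgue_on \<Omega>) (\<lambda>x. \<theta>m * (norm (weak_grad \<Omega> \<psi> x))\<^sup>2)"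
      using L2D(2)[OF g(1)] by simp
    show "integrable (lebesgue_on \<Omega>) (\<lambda>x. Re (sesq (A x) (weak_grad \<Omega> \<psi> x) (weak_grad \<Omega> \<psi> x)))"
      by (intro integrable_Re integrable_sesq g)
    fix x assume "x \<in> space (lebesgue_on \<Omega>)"
    then have "x \<in> \<Omega>" by simp
    then show "\<theta>m * (norm (weak_grad \<Omega> \<psi> x))\<^sup>2 \<le> Re (sesq (A x) (weak_grad \<Omega> \<psi> x) (weak_grad \<Omega> \<psi> x))"
      unfolding Re_sesq norm_sq_Re_Im_vec[of "weak_grad \<Omega> \<psi> x"] distrib_left
      by (intro add_mono A_lower)
  qed
  also have "\<dots> = E * (\<integral>x. (norm (\<psi> x))\<^sup>2 \<partial>lebesgue_on \<Omega>)"
    using \<psi>(3)[OF \<psi>(1)] Re_inner_weighted[of "\<lambda>_. 1" \<psi> E] by simp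
  finally show ?thesis by simp
qed

text \<open>
  A reversed Caccioppoli inequality: the gradient controls the function, because the energy is
  bounded away from 0. The equation is tested with \<open>\<eta>\<^sup>2 \<psi>\<close>. Its gradient consists of
  \<open>\<eta>\<^sup>2\<close> times that of \<open>\<psi>\<close>, which is supported in \<open>B\<close>, and of \<open>2 \<eta> \<psi> grad \<eta>\<close>; the latter is
  paired with \<open>A\<close> and the gradient of \<open>\<psi>\<close> and split by the inequality of arithmetic and geometric means.
\<close>

lemma caccioppoli:
  assumes eig: "(\<psi>, \<lambda>x. complex_of_real E * \<psi> x) \<in> dirichlet_operator \<Omega> A" and E: "0 < E"
    and \<eta>: "\<And>k. C_k k (\<eta> :: real ^ 'n \<Rightarrow> real)" "\<And>x. 0 \<le> \<eta> x" "\<And>x. \<eta> x \<le> 1"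
    and N: "0 < N" "\<And>x. norm (grad \<eta> x) \<le> N"
    and B: "B \<in> sets lebesgue" "\<And>x. x \<notin> B \<Longrightarrow> \<eta> x = 0"
  shows "E\<^sup>2 * (\<integral>x. (\<eta> x)\<^sup>2 * (norm (\<psi> x))\<^sup>2 \<partial>lebesgue_on \<Omega>)
     \<le> 2 * \<theta>p * (E + 2 * \<theta>p * N\<^sup>2) * (\<integral>x. indicator B x * (norm (weak_grad \<Omega> \<psi> x))\<^sup>2 \<partial>lebesgue_on \<Omega>)"
proof -
  note \<psi> = eigenfunctionD[OF eig]
  let ?g = "weak_grad \<Omega> \<psi>"
  note g = weak_grad_spec[OF \<psi>(2)]
  define \<rho> where "\<rho> x = \<eta> x * \<eta> x" for x
  have \<rho>: "C_k k \<rho>" for k unfolding \<rho>_def[abs_def] by (intro C_k_mult \<eta>)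
  have grad_\<rho>: "grad \<rho> x = (2 * \<eta> x) *\<^sub>R grad \<eta> x" for x
    unfolding grad_def \<rho>_def[abs_def] using frechet_derivative_mult[OF \<eta>(1) \<eta>(1)]
    by (simp add: vec_eq_iff)
  define v where "v x = of_real (\<rho> x) * \<psi> x" for x
  have v: "v \<in> H1_0 \<Omega>" unfolding v_def[abs_def] by (rule H1_0_mult[OF \<psi>(1) \<rho>])
  have gv: "AE x in lebesgue_on \<Omega>. weak_grad \<Omega> v x = \<rho> x *\<^sub>R ?g x + cvec (\<psi> x) (grad \<rho> x)"
    unfolding v_def[abs_def] by (rule H1_mult(2)[OF \<psi>(2) \<rho>])
  \<comment> \<open>This weight makes the term with \<open>\<psi>\<close> on the right equal to half of the left-hand side.\<close>
  define \<tau> where "\<tau> = E / (2 * N\<^sup>2 * \<theta>p)"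
  have \<tau>: "0 < \<tau>" using E N(1) theta_pos by (simp add: \<tau>_def)
  define X where "X = (\<integral>x. (\<eta> x)\<^sup>2 * (norm (\<psi> x))\<^sup>2 \<partial>lebesgue_on \<Omega>)"
  define G where "G = (\<integral>x. indicator B x * (norm (?g x))\<^sup>2 \<partial>lebesgue_on \<Omega>)"
  have ptw: "Re (sesq (A x) (\<rho> x *\<^sub>R ?g x + cvec (\<psi> x) (grad \<rho> x)) (?g x))
      \<le> \<theta>p * (1 + 1 / \<tau>) * (indicator B x * (norm (?g x))\<^sup>2) + \<tau> * (N\<^sup>2 * \<theta>p) * ((\<eta> x)\<^sup>2 * (norm (\<psi> x))\<^sup>2)"
    if "x \<in> \<Omega>" for x
  proof (cases "x \<in> B")
    case False
    then show ?thesis using B(2)[OF False]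
      by (simp add: Re_sesq \<rho>_def grad_\<rho>) (simp add: cvec_def Re_vec_def Im_vec_def inner_vec_def)
  next
    case True
    let ?h = "grad \<eta> x"
    have part: "(\<rho> x *\<^sub>R a + (2 * (\<eta> x * p)) *\<^sub>R ?h) \<bullet> (A x *v a)
        \<le> \<theta>p * (1 + 1 / \<tau>) * (norm a)\<^sup>2 + \<tau> * (N\<^sup>2 * \<theta>p) * ((\<eta> x)\<^sup>2 * p\<^sup>2)" for a p
    proof -
      let ?k = "(\<eta> x * p) *\<^sub>R ?h"
      have aa: "0 \<le> a \<bullet> (A x *v a)" "a \<bullet> (A x *v a) \<le> \<theta>p * (norm a)\<^sup>2"
        using A_psd A_upper that by auto
      have "?k \<bullet> (A x *v ?k) \<le> \<theta>p * (norm ?k)\<^sup>2" by (rule A_upper[OF that])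
      also have "\<dots> = \<theta>p * (((\<eta> x)\<^sup>2 * p\<^sup>2) * (norm ?h)\<^sup>2)"
        by (simp add: power_mult_distrib)
      also have "\<dots> \<le> \<theta>p * (((\<eta> x)\<^sup>2 * p\<^sup>2) * N\<^sup>2)"
        using N(2)[of x] theta_pos by (intro mult_left_mono power_mono) auto
      finally have kk: "\<tau> * (?k \<bullet> (A x *v ?k)) \<le> \<tau> * (N\<^sup>2 * \<theta>p) * ((\<eta> x)\<^sup>2 * p\<^sup>2)"
        using \<tau> by (simp add: mult_ac)
      have "\<rho> x \<le> 1" unfolding \<rho>_def using \<eta>(2,3)[of x] by (simp add: mult_le_one)
      then have "\<rho> x * (a \<bullet> (A x *v a)) \<le> \<theta>p * (norm a)\<^sup>2"
        using order_trans[OF mult_left_le_one_le[OF aa(1)] aa(2)] \<eta>(2)[of x] by (simp add: \<rho>_def)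
      moreover have "(a \<bullet> (A x *v a)) / \<tau> \<le> \<theta>p * (norm a)\<^sup>2 / \<tau>"
        using aa \<tau> by (simp add: divide_right_mono)
      moreover have "2 * (?k \<bullet> (A x *v a)) \<le> \<tau> * (?k \<bullet> (A x *v ?k)) + (a \<bullet> (A x *v a)) / \<tau>"
        by (rule psd_am_gm[OF A_sym[OF that] A_psd[OF that] \<tau>])
      ultimately show ?thesis using kk
        by (simp add: inner_add_left distrib_left distrib_right)
    qed
    have "Re_vec (\<rho> x *\<^sub>R ?g x + cvec (\<psi> x) (grad \<rho> x)) = \<rho> x *\<^sub>R Re_vec (?g x) + (2 * (\<eta> x * Re (\<psi> x))) *\<^sub>R ?h"
      "Im_vec (\<rho> x *\<^sub>R ?g x + cvec (\<psi> x) (grad \<rho> x)) = \<rho> x *\<^sub>R Im_vec (?g x) + (2 * (\<eta> x * Im (\<psi> x))) *\<^sub>R ?h"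
      by (simp_all add: vec_eq_iff Re_vec_def Im_vec_def grad_\<rho>)
    then show ?thesis
      using True part[of "Re_vec (?g x)" "Re (\<psi> x)"] part[of "Im_vec (?g x)" "Im (\<psi> x)"]
      unfolding Re_sesq norm_sq_Re_Im_vec[of "?g x"] cmod_power2
      by (simp add: distrib_left)
  qed
  have intX: "integrable (lebesgue_on \<Omega>) (\<lambda>x. (\<eta> x)\<^sup>2 * (norm (\<psi> x))\<^sup>2)"
    by (intro integrable_mult_bounded L2D H1_L2 \<psi> continuous_intros C_k_continuous[OF \<eta>(1)])
  have intG: "integrable (lebesgue_on \<Omega>) (\<lambda>x. indicator B x * (norm (?g x))\<^sup>2)"
  proof (rule Bochner_Integration.integrable_bound[OF L2D(2)[OF g(1)]])
    have "indicator B \<in> borel_measurable (lebesgue_on \<Omega>)"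
      using B(1) by (intro measurable_restrict_space1) simp
    then show "(\<lambda>x. indicator B x * (norm (?g x))\<^sup>2) \<in> borel_measurable (lebesgue_on \<Omega>)"
      using L2D(1)[OF g(1)] by (intro borel_measurable_times) simp_all
  qed (auto simp: indicator_def)
  have "E * X = (\<integral>x. Re (sesq (A x) (weak_grad \<Omega> v x) (?g x)) \<partial>lebesgue_on \<Omega>)"
    using \<psi>(3)[OF v] Re_inner_weighted[of \<rho> \<psi> E]
    by (simp add: v_def X_def \<rho>_def power2_eq_square)
  also have "\<dots> \<le> (\<integral>x. \<theta>p * (1 + 1 / \<tau>) * (indicator B x * (norm (?g x))\<^sup>2)
         + \<tau> * (N\<^sup>2 * \<theta>p) * ((\<eta> x)\<^sup>2 * (norm (\<psi> x))\<^sup>2) \<partial>lebesgue_on \<Omega>)"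
  proof (rule integral_mono_AE')
    have "AE x in lebesgue_on \<Omega>. x \<in> \<Omega>" by (rule AE_I2) simp
    with gv show "AE x in lebesgue_on \<Omega>. Re (sesq (A x) (weak_grad \<Omega> v x) (?g x))
       \<le> \<theta>p * (1 + 1 / \<tau>) * (indicator B x * (norm (?g x))\<^sup>2)
         + \<tau> * (N\<^sup>2 * \<theta>p) * ((\<eta> x)\<^sup>2 * (norm (\<psi> x))\<^sup>2)"
      by eventually_elim (simp only: ptw)
    show "integrable (lebesgue_on \<Omega>) (\<lambda>x. \<theta>p * (1 + 1 / \<tau>) * (indicator B x * (norm (?g x))\<^sup>2)
         + \<tau> * (N\<^sup>2 * \<theta>p) * ((\<eta> x)\<^sup>2 * (norm (\<psi> x))\<^sup>2))"
      using intX intG by simp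
  qed (use theta_pos \<tau> in auto)
  also have "\<dots> = \<theta>p * (1 + 1 / \<tau>) * G + \<tau> * (N\<^sup>2 * \<theta>p) * X"
    using intX intG by (simp add: X_def G_def)
  also have "\<tau> * (N\<^sup>2 * \<theta>p) = E / 2"
    using N(1) theta_pos by (simp add: \<tau>_def)
  finally have "E * X \<le> 2 * (\<theta>p * (1 + 1 / \<tau>) * G)" by simp
  then have "E * (E * X) \<le> E * (2 * (\<theta>p * (1 + 1 / \<tau>) * G))"
    using E by (intro mult_left_mono) auto
  also have "\<dots> = 2 * \<theta>p * (E * (1 + 1 / \<tau>)) * G" by (simp add: mult_ac)
  also have "E * (1 + 1 / \<tau>) = E + 2 * \<theta>p * N\<^sup>2"
    using E by (simp add: \<tau>_def distrib_left)
  finally show ?thesis by (simp add: X_def G_def power2_eq_square mult.assoc)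
qed

end

section \<open>Poincare inequalities\<close>

lemma norm_frechet_derivative_le_grad:
  fixes f :: "real ^ 'n \<Rightarrow> complex"
  assumes "C_k 1 f"
  shows "norm (frechet_derivative f (at x) v) \<le> norm (grad f x) * norm v"
proof -
  have lin: "linear (frechet_derivative f (at x))"
    using has_derivative_linear[OF C_k_Suc_has_derivative[of 0 f x]] assms by simp
  have "frechet_derivative f (at x) v = frechet_derivative f (at x) (\<Sum>i\<in>UNIV. (v $ i) *\<^sub>R axis i 1)"
    by (simp add: basis_expansion flip: scalar_mult_eq_scaleR)
  also have "\<dots> = (\<Sum>i\<in>UNIV. (v $ i) *\<^sub>R (grad f x $ i))"
    by (simp add: linear_sum[OF lin] linear_scale[OF lin] grad_def)
  also have "norm \<dots> \<le> (\<Sum>i\<in>UNIV. \<bar>norm (grad f x $ i)\<bar> * \<bar>norm (v $ i)\<bar>)"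
    by (rule order_trans[OF norm_sum]) (simp add: mult.commute)
  also have "\<dots> \<le> norm (grad f x) * norm v"
    unfolding norm_vec_def by (rule L2_set_mult_ineq)
  finally show ?thesis .
qed

lemma integral_cbox_affine:
  fixes f :: "'a::euclidean_space \<Rightarrow> real"
  assumes "continuous_on UNIV f" "0 < t"
  shows "integral (cbox a b) (\<lambda>x. f (t *\<^sub>R x + c)) = integral (cbox (t *\<^sub>R a + c) (t *\<^sub>R b + c)) f / t ^ DIM('a)"
proof -
  have "f integrable_on cbox (t *\<^sub>R a + c) (t *\<^sub>R b + c)"
    using assms(1) by (intro integrable_continuous) (rule continuous_on_subset, auto)
  from has_integral_affinity'[OF integrable_integral[OF this] assms(2), of c]
  show ?thesis using assms(2) by (intro integral_unique) (simp add: divide_inverse mult.commute)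
qed

text \<open>
  The fundamental theorem of calculus along the segment, followed by the Cauchy-Schwarz inequality on an
  interval of length at most 1.
\<close>

lemma increment_sq_le_integral:
  fixes f :: "real ^ 'n \<Rightarrow> complex"
  assumes f: "C_k 1 f" and s: "0 \<le> s" "s \<le> 1"
  shows "(norm (f x - f (s *\<^sub>R x + (1 - s) *\<^sub>R p)))\<^sup>2
      \<le> (norm (x - p))\<^sup>2 * integral {s..1} (\<lambda>t. (norm (grad f (t *\<^sub>R x + (1 - t) *\<^sub>R p)))\<^sup>2)"
proof -
  let ?y = "\<lambda>t. t *\<^sub>R x + (1 - t) *\<^sub>R p"
  let ?D = "\<lambda>t. frechet_derivative f (at (?y t)) (x - p)"
  let ?h = "\<lambda>t. norm (grad f (?y t)) * norm (x - p)"
  have contg: "continuous_on UNIV (grad f)"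
    unfolding grad_def[abs_def] using f axis_in_Basis by (intro continuous_on_vec_lambda) simp
  have conth: "continuous_on S ?h" for S
    by (intro continuous_intros continuous_on_compose2[OF contg]) auto
  have "(?D has_integral (f (?y 1) - f (?y s))) {s..1}"
  proof (rule fundamental_theorem_of_calculus[OF s(2)])
    fix t
    have "((\<lambda>t. f (?y t)) has_derivative (\<lambda>h. frechet_derivative f (at (?y t)) (h *\<^sub>R (x - p)))) (at t within {s..1})"
      by (rule has_derivative_compose[where f="?y"])
         (use f C_k_Suc_has_derivative[of 0 f] in \<open>auto intro!: derivative_eq_intros simp: algebra_simps\<close>)
    moreover have "linear (frechet_derivative f (at (?y t)))"
      using has_derivative_linear[OF C_k_Suc_has_derivative[of 0 f]] f by simp
    ultimately show "((\<lambda>t. f (?y t)) has_vector_derivative ?D t) (at t within {s..1})"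
      by (simp add: has_vector_derivative_def linear_scale)
  qed
  then have D: "?D integrable_on {s..1}" "integral {s..1} ?D = f x - f (?y s)"
    by (auto simp: has_integral_integrable integral_unique)
  define m where "m = norm (f x - f (?y s))"
  have m: "m \<le> integral {s..1} ?h"
    unfolding m_def D(2)[symmetric]
    by (rule integral_norm_bound_integral[OF D(1)])
       (auto intro!: integrable_continuous_real conth norm_frechet_derivative_le_grad f)
  have m0: "0 \<le> m" by (simp add: m_def)
  \<comment> \<open>Cauchy-Schwarz: integrate \<open>(h - m)\<^sup>2 \<ge> 0\<close>, where \<open>m\<close> is at most the integral of \<open>h\<close>.\<close>
  have "m\<^sup>2 \<le> 2 * m * integral {s..1} ?h - m\<^sup>2 * (1 - s)"
  proof -
    have "m * m \<le> m * integral {s..1} ?h" using m m0 by (rule mult_left_mono)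
    moreover have "m\<^sup>2 * (1 - s) \<le> m\<^sup>2 * 1" using s by (intro mult_left_mono) auto
    ultimately show ?thesis by (simp add: power2_eq_square)
  qed
  also have "\<dots> = integral {s..1} (\<lambda>t. 2 * m * ?h t - m\<^sup>2)"
    using s by (subst Henstock_Kurzweil_Integration.integral_diff)
      (auto intro!: integrable_continuous_real continuous_intros conth)
  also have "\<dots> \<le> integral {s..1} (\<lambda>t. (?h t)\<^sup>2)"
  proof (rule integral_le)
    show "2 * m * ?h t - m\<^sup>2 \<le> (?h t)\<^sup>2" for t
      using sum_squares_bound[of m "?h t"] by simp
  qed (intro integrable_continuous_real continuous_intros conth)+
  also have "\<dots> = (norm (x - p))\<^sup>2 * integral {s..1} (\<lambda>t. (norm (grad f (?y t)))\<^sup>2)"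
    by (simp add: power_mult_distrib mult.commute)
  finally show ?thesis by (simp add: m_def)
qed

text \<open>
  The contraction \<open>x \<mapsto> s x + (1 - s) p\<close> with a suitable centre \<open>p\<close> maps the unit cube onto the
  subcube. Pairing each point \<open>x\<close> with its image, rather than with all points of the subcube, keeps the
  argument to a single change of variables: for every \<open>t\<close> between \<open>s\<close> and 1 the intermediate
  contraction \<open>x \<mapsto> t x + (1 - t) p\<close> maps the cube into itself and costs a Jacobian of at most
  \<open>s powr (- d)\<close>.
\<close>

lemma poincare_subcube:
  fixes f :: "real ^ 'n \<Rightarrow> complex"
  assumes f: "C_k 1 f" and s: "0 < s" "s < 1"
    and sub: "cbox a' (a' + vec s) \<subseteq> cbox a (a + vec 1)"
  shows "integral (cbox a (a + vec 1)) (\<lambda>x. (norm (f x))\<^sup>2)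
     \<le> 2 / s ^ CARD('n) * integral (cbox a' (a' + vec s)) (\<lambda>x. (norm (f x))\<^sup>2)
       + 2 * real CARD('n) / s ^ CARD('n) * integral (cbox a (a + vec 1)) (\<lambda>x. (norm (grad f x))\<^sup>2)"
proof -
  let ?Q = "cbox a (a + vec 1)" and ?d = "real CARD('n)"
  \<comment> \<open>The fixed point of the contraction that maps the large cube onto the small one.\<close>
  define p where "p = a + (1 / (1 - s)) *\<^sub>R (a' - a)"
  let ?y = "\<lambda>t x. t *\<^sub>R x + (1 - t) *\<^sub>R p"
  have ai: "a $ i \<le> a' $ i" "a' $ i + s \<le> a $ i + 1" for i
    using sub s by (auto simp: subset_interval_cart)
  have "(1 - s) *\<^sub>R p = (1 - s) *\<^sub>R a + (a' - a)"
    using s by (simp add: p_def scaleR_add_right)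
  then have a': "s *\<^sub>R a + (1 - s) *\<^sub>R p = a'" "s *\<^sub>R (a + vec 1) + (1 - s) *\<^sub>R p = a' + vec s"
    by (simp_all add: algebra_simps vec_eq_iff)
  have p: "a $ i \<le> p $ i" "p $ i \<le> a $ i + 1" for i
  proof -
    have "p $ i = a $ i + (a' $ i - a $ i) / (1 - s)" by (simp add: p_def)
    moreover have "0 \<le> (a' $ i - a $ i) / (1 - s)" "(a' $ i - a $ i) / (1 - s) \<le> 1"
      using ai[of i] s by (simp_all add: pos_divide_le_eq)
    ultimately show "a $ i \<le> p $ i" "p $ i \<le> a $ i + 1" by simp_all
  qed
  have xp: "(norm (x - p))\<^sup>2 \<le> ?d" if "x \<in> ?Q" for x
  proof -
    have "(norm (x $ i - p $ i))\<^sup>2 \<le> 1" for i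
      using that p[of i] by (auto simp: mem_box_cart power2_le_iff_abs_le abs_le_square_iff[of _ 1, simplified, symmetric] abs_if) (smt (verit))+
    then have "(\<Sum>i\<in>UNIV. (norm ((x - p) $ i))\<^sup>2) \<le> (\<Sum>i\<in>(UNIV::'n set). 1)"
      by (intro sum_mono) simp
    then show ?thesis by (simp add: vec_norm_sq)
  qed
  have contf: "continuous_on S f" for S using f by (rule C_k_continuous)
  have contg: "continuous_on UNIV (grad f)"
    unfolding grad_def[abs_def] using f axis_in_Basis by (intro continuous_on_vec_lambda) simp
  have contf2: "continuous_on UNIV (\<lambda>x. (norm (f x))\<^sup>2)" by (intro continuous_intros contf)
  have contg2: "continuous_on UNIV (\<lambda>x. (norm (grad f x))\<^sup>2)" by (intro continuous_intros contg)
  let ?H = "\<lambda>x t. (norm (grad f (?y t x)))\<^sup>2"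
  have contH: "continuous_on S (\<lambda>(x, t). ?H x t)" for S
    unfolding case_prod_beta
    by (rule continuous_on_compose2[OF contg2]) (auto intro!: continuous_intros)
  have int1: "(\<lambda>x. (norm (f (?y s x)))\<^sup>2) integrable_on ?Q"
    by (intro integrable_continuous continuous_on_compose2[OF contf2]) (auto intro!: continuous_intros)
  have int2: "(\<lambda>x. integral {s..1} (?H x)) integrable_on ?Q"
    using integral_integrable_2dim[OF contH, where a=a and b="a + vec 1" and c=s and d=1] by simp
  have "integral ?Q (\<lambda>x. (norm (f x))\<^sup>2)
     \<le> integral ?Q (\<lambda>x. 2 * (norm (f (?y s x)))\<^sup>2 + 2 * ?d * integral {s..1} (?H x))"
  proof (rule integral_le)
    show "(\<lambda>x. (norm (f x))\<^sup>2) integrable_on ?Q"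
      by (intro integrable_continuous continuous_intros contf)
    show "(\<lambda>x. 2 * (norm (f (?y s x)))\<^sup>2 + 2 * ?d * integral {s..1} (?H x)) integrable_on ?Q"
      using int1 int2 by (intro integrable_add integrable_on_mult_right)
    fix x assume x: "x \<in> ?Q"
    have I: "0 \<le> integral {s..1} (?H x)" 
      by (intro Henstock_Kurzweil_Integration.integral_nonneg integrable_continuous_real
            continuous_on_compose2[OF contg2]) (auto intro!: continuous_intros)
    have "(norm (f x))\<^sup>2 \<le> 2 * (norm (f (?y s x)))\<^sup>2 + 2 * (norm (f x - f (?y s x)))\<^sup>2"
      using norm_sq_add_le[of "f (?y s x)" "f x - f (?y s x)"] by simp
    also have "(norm (f x - f (?y s x)))\<^sup>2 \<le> (norm (x - p))\<^sup>2 * integral {s..1} (?H x)"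
      using s by (intro increment_sq_le_integral f) auto
    also have "\<dots> \<le> ?d * integral {s..1} (?H x)"
      using xp[OF x] I by (intro mult_right_mono)
    finally show "(norm (f x))\<^sup>2 \<le> 2 * (norm (f (?y s x)))\<^sup>2 + 2 * ?d * integral {s..1} (?H x)" by simp
  qed
  also have "\<dots> = 2 * integral ?Q (\<lambda>x. (norm (f (?y s x)))\<^sup>2) + 2 * ?d * integral ?Q (\<lambda>x. integral {s..1} (?H x))"
    using int1 int2 by (simp add: Henstock_Kurzweil_Integration.integral_add integrable_on_mult_right)
  also have "integral ?Q (\<lambda>x. (norm (f (?y s x)))\<^sup>2)
      = integral (cbox a' (a' + vec s)) (\<lambda>x. (norm (f x))\<^sup>2) / s ^ CARD('n)"
    using integral_cbox_affine[OF contf2 s(1), of a "a + vec 1" "(1 - s) *\<^sub>R p", unfolded a'] by simp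
  also have "integral ?Q (\<lambda>x. integral {s..1} (?H x)) = integral {s..1} (\<lambda>t. integral ?Q (\<lambda>x. ?H x t))"
    using integral_swap_continuous[OF contH, where a=a and b="a + vec 1" and c=s and d=1] by simp
  also have "\<dots> \<le> integral {s..1} (\<lambda>t. integral ?Q (\<lambda>x. (norm (grad f x))\<^sup>2) / s ^ CARD('n))"
  proof (rule integral_le)
    have "continuous_on S (\<lambda>(t, x). ?H x t)" for S
      unfolding case_prod_beta
      by (rule continuous_on_compose2[OF contg2]) (auto intro!: continuous_intros)
    from integral_integrable_2dim[OF this, where a=s and b=1 and c=a and d="a + vec 1"]
    show "(\<lambda>t. integral ?Q (\<lambda>x. ?H x t)) integrable_on {s..1}" by simp
    fix t assume t: "t \<in> {s..1}"
    then have t0: "0 < t" "t \<le> 1" "s \<le> t" using s by auto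
    let ?Qt = "cbox (?y t a) (?y t (a + vec 1))"
    have Qt: "?Qt \<subseteq> ?Q"
    proof -
      have "a $ i \<le> t * a $ i + (1 - t) * p $ i" "t * (a $ i + 1) + (1 - t) * p $ i \<le> a $ i + 1" for i
        using mult_left_mono[OF p(1)[of i], of "1 - t"] mult_left_mono[OF p(2)[of i], of "1 - t"] t0
        by (auto simp: algebra_simps)
      then show ?thesis by (auto simp: subset_interval_cart)
    qed
    have "integral ?Q (\<lambda>x. ?H x t) = integral ?Qt (\<lambda>x. (norm (grad f x))\<^sup>2) / t ^ CARD('n)"
      using integral_cbox_affine[OF contg2 t0(1), of a "a + vec 1" "(1 - t) *\<^sub>R p"] by simp
    also have "\<dots> \<le> integral ?Q (\<lambda>x. (norm (grad f x))\<^sup>2) / s ^ CARD('n)"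
    proof (rule frac_le)
      show "integral ?Qt (\<lambda>x. (norm (grad f x))\<^sup>2) \<le> integral ?Q (\<lambda>x. (norm (grad f x))\<^sup>2)"
        by (intro integral_subset_le Qt integrable_continuous continuous_on_subset[OF contg2]) auto
      show "0 \<le> integral ?Q (\<lambda>x. (norm (grad f x))\<^sup>2)"
        by (intro Henstock_Kurzweil_Integration.integral_nonneg integrable_continuous continuous_on_subset[OF contg2]) auto
      show "s ^ CARD('n) \<le> t ^ CARD('n)" using t0 s by (intro power_mono) auto
    qed (use s in auto)
    finally show "integral ?Q (\<lambda>x. ?H x t) \<le> integral ?Q (\<lambda>x. (norm (grad f x))\<^sup>2) / s ^ CARD('n)" .
  qed auto
  also have "\<dots> \<le> 1 * (integral ?Q (\<lambda>x. (norm (grad f x))\<^sup>2) / s ^ CARD('n))"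
  proof -
    have "0 \<le> integral ?Q (\<lambda>x. (norm (grad f x))\<^sup>2)"
      by (intro Henstock_Kurzweil_Integration.integral_nonneg integrable_continuous continuous_on_subset[OF contg2]) auto
    then have "(1 - s) * (integral ?Q (\<lambda>x. (norm (grad f x))\<^sup>2) / s ^ CARD('n))
        \<le> 1 * (integral ?Q (\<lambda>x. (norm (grad f x))\<^sup>2) / s ^ CARD('n))"
      using s by (intro mult_right_mono) auto
    then show ?thesis using s by simp
  qed
  finally show ?thesis by simp
qed

lemma integral_cbox_continuous:
  fixes F :: "real ^ 'n \<Rightarrow> real"
  assumes "continuous_on UNIV F"
  shows "integrable lebesgue (\<lambda>x. indicator (cbox a b) x * F x)"
    "integral (cbox a b) F = (\<integral>x. indicator (cbox a b) x * F x \<partial>lebesgue)"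
proof -
  have "integrable lborel (\<lambda>x. indicator (cbox a b) x *\<^sub>R F x)"
    using assms by (intro borel_integrable_compact) (auto intro: continuous_on_subset)
  then have *: "integrable lebesgue (\<lambda>x. indicator (cbox a b) x *\<^sub>R F x)"
    using borel_measurable_integrable by (subst integrable_completion) auto
  then show "integrable lebesgue (\<lambda>x. indicator (cbox a b) x * F x)" by simp
  show "integral (cbox a b) F = (\<integral>x. indicator (cbox a b) x * F x \<partial>lebesgue)"
    using set_lebesgue_integral_eq_integral(2)[of "cbox a b" F] *
    by (simp add: set_integrable_def set_lebesgue_integral_def)
qed

context bounded_domain begin

text \<open>
  A test function is extended by 0, so unit cubes that stick out of \<open>\<Omega>\<close> do no harm. The closed cubes
  cover \<open>\<Omega>\<close>, which serves the left-hand side; their interiors are disjoint, which serves the gradient term.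
\<close>

lemma poincare_tiling:
  fixes \<phi> :: "real ^ 'n \<Rightarrow> complex" and a a' :: "'j \<Rightarrow> real ^ 'n"
  assumes \<phi>: "\<phi> \<in> test_functions \<Omega>" and s: "0 < s" "s < 1" and J: "finite J"
    and sub: "\<And>j. j \<in> J \<Longrightarrow> cbox (a' j) (a' j + vec s) \<subseteq> cbox (a j) (a j + vec 1)"
    and cover: "\<Omega> \<subseteq> (\<Union>j\<in>J. cbox (a j) (a j + vec 1))"
    and disj: "disjoint_family_on (\<lambda>j. box (a j) (a j + vec 1)) J"
  shows "(\<integral>x. (norm (\<phi> x))\<^sup>2 \<partial>lebesgue_on \<Omega>)
    \<le> 2 / s ^ CARD('n) * (\<integral>x. (\<Sum>j\<in>J. indicator (cbox (a' j) (a' j + vec s)) x) * (norm (\<phi> x))\<^sup>2 \<partial>lebesgue_on \<Omega>)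
     + 2 * real CARD('n) / s ^ CARD('n) * (\<integral>x. (norm (grad \<phi> x))\<^sup>2 \<partial>lebesgue_on \<Omega>)"
proof -
  let ?Q = "\<lambda>j. cbox (a j) (a j + vec 1)" and ?B = "\<lambda>j. box (a j) (a j + vec 1)"
    and ?Q' = "\<lambda>j. cbox (a' j) (a' j + vec s)"
  obtain K where K: "compact K" "K \<subseteq> \<Omega>" "\<And>x. x \<notin> K \<Longrightarrow> \<phi> x = 0"
        "\<And>x. x \<notin> K \<Longrightarrow> frechet_derivative \<phi> (at x) = (\<lambda>h. 0)"
    using test_functionE[OF \<phi>] by metis
  have cont: "continuous_on UNIV (\<lambda>x. (norm (\<phi> x))\<^sup>2)" "continuous_on UNIV (\<lambda>x. (norm (grad \<phi> x))\<^sup>2)"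
    by (intro continuous_intros C_k_continuous[OF test_function_C_k[OF \<phi>]] C_k_grad_continuous(2)[OF test_function_C_k[OF \<phi>]])+
  have zero: "(norm (\<phi> x))\<^sup>2 = 0" "(norm (grad \<phi> x))\<^sup>2 = 0" if "x \<notin> \<Omega>" for x
    using K that by (auto simp: grad_def vec_eq_iff subset_eq)
  have on_\<Omega>: "(\<integral>x. F x \<partial>lebesgue_on \<Omega>) = (\<integral>x. F x \<partial>lebesgue)" if "\<And>x. x \<notin> \<Omega> \<Longrightarrow> F x = 0" for F :: "_ \<Rightarrow> real"
    using that by (simp add: integral_restrict_space) (intro Bochner_Integration.integral_cong, auto simp: indicator_def)
  have intK: "integrable lebesgue (\<lambda>x. (norm (grad \<phi> x))\<^sup>2)"
    by (rule integrable_continuous_compact_support(2)[OF cont(2) K(1)]) (use K(4) in \<open>simp add: grad_def vec_eq_iff\<close>)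
  have int\<phi>: "integrable lebesgue (\<lambda>x. (norm (\<phi> x))\<^sup>2)"
    by (rule integrable_continuous_compact_support(2)[OF cont(1) K(1)]) (use K(3) in simp)
  have "(\<integral>x. (norm (\<phi> x))\<^sup>2 \<partial>lebesgue_on \<Omega>) = (\<integral>x. (norm (\<phi> x))\<^sup>2 \<partial>lebesgue)"
    by (rule on_\<Omega>) (rule zero)
  also have "\<dots> \<le> (\<integral>x. (\<Sum>j\<in>J. indicator (?Q j) x * (norm (\<phi> x))\<^sup>2) \<partial>lebesgue)"
  proof (rule integral_mono[OF int\<phi>])
    show "integrable lebesgue (\<lambda>x. \<Sum>j\<in>J. indicator (?Q j) x * (norm (\<phi> x))\<^sup>2)"
      by (intro Bochner_Integration.integrable_sum integral_cbox_continuous cont)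
    fix x
    show "(norm (\<phi> x))\<^sup>2 \<le> (\<Sum>j\<in>J. indicator (?Q j) x * (norm (\<phi> x))\<^sup>2)"
    proof (cases "x \<in> \<Omega>")
      case True
      then obtain j where j: "j \<in> J" "x \<in> ?Q j" using cover by blast
      then show ?thesis
        using member_le_sum[OF j(1) _ J, of "\<lambda>j. indicator (?Q j) x * (norm (\<phi> x))\<^sup>2"] by simp
    next
      case False
      then have "\<phi> x = 0" using zero(1) by simp
      then show ?thesis by simp
    qed
  qed
  also have "\<dots> = (\<Sum>j\<in>J. integral (?Q j) (\<lambda>x. (norm (\<phi> x))\<^sup>2))"
    unfolding integral_cbox_continuous(2)[OF cont(1)]
    by (intro Bochner_Integration.integral_sum integral_cbox_continuous cont)
  also have "\<dots> \<le> (\<Sum>j\<in>J. 2 / s ^ CARD('n) * integral (?Q' j) (\<lambda>x. (norm (\<phi> x))\<^sup>2)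
       + 2 * real CARD('n) / s ^ CARD('n) * integral (?Q j) (\<lambda>x. (norm (grad \<phi> x))\<^sup>2))"
    by (intro sum_mono poincare_subcube test_function_C_k[OF \<phi>] s sub)
  also have "\<dots> = 2 / s ^ CARD('n) * (\<Sum>j\<in>J. integral (?Q' j) (\<lambda>x. (norm (\<phi> x))\<^sup>2))
       + 2 * real CARD('n) / s ^ CARD('n) * (\<Sum>j\<in>J. integral (?Q j) (\<lambda>x. (norm (grad \<phi> x))\<^sup>2))"
    by (simp add: sum.distrib sum_distrib_left)
  also have "(\<Sum>j\<in>J. integral (?Q' j) (\<lambda>x. (norm (\<phi> x))\<^sup>2))
      = (\<integral>x. (\<Sum>j\<in>J. indicator (?Q' j) x) * (norm (\<phi> x))\<^sup>2 \<partial>lebesgue_on \<Omega>)"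
  proof -
    have "(\<Sum>j\<in>J. integral (?Q' j) (\<lambda>x. (norm (\<phi> x))\<^sup>2))
       = (\<integral>x. (\<Sum>j\<in>J. indicator (?Q' j) x * (norm (\<phi> x))\<^sup>2) \<partial>lebesgue)"
      unfolding integral_cbox_continuous(2)[OF cont(1)]
      by (intro Bochner_Integration.integral_sum[symmetric] integral_cbox_continuous cont)
    also have "\<dots> = (\<integral>x. (\<Sum>j\<in>J. indicator (?Q' j) x) * (norm (\<phi> x))\<^sup>2 \<partial>lebesgue)"
      by (simp add: sum_distrib_right)
    also have "\<dots> = (\<integral>x. (\<Sum>j\<in>J. indicator (?Q' j) x) * (norm (\<phi> x))\<^sup>2 \<partial>lebesgue_on \<Omega>)"
      by (rule on_\<Omega>[symmetric]) (use zero(1) in simp)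
    finally show ?thesis .
  qed
  finally have L: "(\<integral>x. (norm (\<phi> x))\<^sup>2 \<partial>lebesgue_on \<Omega>)
    \<le> 2 / s ^ CARD('n) * (\<integral>x. (\<Sum>j\<in>J. indicator (?Q' j) x) * (norm (\<phi> x))\<^sup>2 \<partial>lebesgue_on \<Omega>)
     + 2 * real CARD('n) / s ^ CARD('n) * (\<Sum>j\<in>J. integral (?Q j) (\<lambda>x. (norm (grad \<phi> x))\<^sup>2))" .
  have "(\<Sum>j\<in>J. integral (?Q j) (\<lambda>x. (norm (grad \<phi> x))\<^sup>2)) \<le> (\<integral>x. (norm (grad \<phi> x))\<^sup>2 \<partial>lebesgue_on \<Omega>)"
  proof -
    have set: "set_integrable lebesgue (?B j) (\<lambda>x. (norm (grad \<phi> x))\<^sup>2)" for j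
      unfolding set_integrable_def by (intro integrable_mult_indicator intK) auto
    have "(\<Sum>j\<in>J. integral (?Q j) (\<lambda>x. (norm (grad \<phi> x))\<^sup>2))
        = (\<Sum>j\<in>J. (\<integral>x. indicator (?B j) x * (norm (grad \<phi> x))\<^sup>2 \<partial>lebesgue))"
      using set_lebesgue_integral_eq_integral(2)[OF set]
      by (intro sum.cong) (simp_all add: integral_open_interval set_lebesgue_integral_def)
    also have "\<dots> = (\<integral>x. (\<Sum>j\<in>J. indicator (?B j) x * (norm (grad \<phi> x))\<^sup>2) \<partial>lebesgue)"
      using set by (intro Bochner_Integration.integral_sum[symmetric]) (simp add: set_integrable_def)
    also have "\<dots> \<le> (\<integral>x. (norm (grad \<phi> x))\<^sup>2 \<partial>lebesgue)"
    proof (rule integral_mono[OF _ intK])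
      show "integrable lebesgue (\<lambda>x. \<Sum>j\<in>J. indicator (?B j) x * (norm (grad \<phi> x))\<^sup>2)"
        using set by (intro Bochner_Integration.integrable_sum) (simp add: set_integrable_def)
      fix x
      have "(\<Sum>j\<in>J. indicator (?B j) x :: real) = indicator (\<Union>j\<in>J. ?B j) x"
        by (rule indicator_UN_disjoint[OF J disj, symmetric])
      then show "(\<Sum>j\<in>J. indicator (?B j) x * (norm (grad \<phi> x))\<^sup>2) \<le> (norm (grad \<phi> x))\<^sup>2"
        by (simp add: sum_distrib_right[symmetric] indicator_def)
    qed
    also have "\<dots> = (\<integral>x. (norm (grad \<phi> x))\<^sup>2 \<partial>lebesgue_on \<Omega>)"
      by (rule on_\<Omega>[symmetric]) (rule zero)
    finally show ?thesis .
  qed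
  then show ?thesis
    by (intro order_trans[OF L] add_left_mono mult_left_mono) (use s in auto)
qed

text \<open>
  Approximation by test functions. The factor 4 is two applications of
  \<open>(a + b)\<^sup>2 \<le> 2 a\<^sup>2 + 2 b\<^sup>2\<close>, one on each side.
\<close>

lemma H1_0_inequality_from_test_functions:
  assumes u: "u \<in> H1_0 \<Omega>" and C: "0 \<le> C1" "0 \<le> C2"
    and w: "w \<in> borel_measurable lebesgue" "\<And>x. 0 \<le> w x" "\<And>x. w x \<le> K"
    and test: "\<And>\<phi>. \<phi> \<in> test_functions \<Omega> \<Longrightarrow> (\<integral>x. (norm (\<phi> x))\<^sup>2 \<partial>lebesgue_on \<Omega>)
      \<le> C1 * (\<integral>x. w x * (norm (\<phi> x))\<^sup>2 \<partial>lebesgue_on \<Omega>) + C2 * (\<integral>x. (norm (grad \<phi> x))\<^sup>2 \<partial>lebesgue_on \<Omega>)"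
  shows "(\<integral>x. (norm (u x))\<^sup>2 \<partial>lebesgue_on \<Omega>)
      \<le> 4 * C1 * (\<integral>x. w x * (norm (u x))\<^sup>2 \<partial>lebesgue_on \<Omega>)
       + 4 * C2 * (\<integral>x. (norm (weak_grad \<Omega> u x))\<^sup>2 \<partial>lebesgue_on \<Omega>)"
proof (rule field_le_epsilon)
  fix e :: real assume "0 < e"
  have uH1: "u \<in> H1 \<Omega>" using u by (simp add: H1_0_def)
  have K: "0 \<le> K" using w(2,3) order_trans by blast
  let ?M = "2 + 4 * C1 * K + 4 * C2"
  have M: "0 < ?M" using C K by (simp add: add_pos_nonneg)
  obtain \<phi> where \<phi>: "\<phi> \<in> test_functions \<Omega>" "H1_norm \<Omega> (\<lambda>x. u x - \<phi> x) < sqrt (e / ?M)"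
  proof -
    have "0 < sqrt (e / ?M)" using M \<open>0 < e\<close> by simp
    then show ?thesis using u that unfolding H1_0_def by blast
  qed
  let ?z = "\<lambda>x. u x - \<phi> x"
  note \<phi>H1 = test_function_H1[OF \<phi>(1)]
  note z = H1_diff[OF uH1 \<phi>H1(1)]
  let ?I = "\<lambda>f. \<integral>x. (norm (f x))\<^sup>2 \<partial>lebesgue_on \<Omega>" and ?W = "\<lambda>f. \<integral>x. w x * (norm (f x))\<^sup>2 \<partial>lebesgue_on \<Omega>"
  have int: "integrable (lebesgue_on \<Omega>) (\<lambda>x. (norm (f x))\<^sup>2)" "integrable (lebesgue_on \<Omega>) (\<lambda>x. w x * (norm (f x))\<^sup>2)"
    if "f \<in> H1 \<Omega>" for f :: "real ^ 'n \<Rightarrow> complex"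
  proof -
    note f = L2D[OF H1_L2[OF that]]
    show "integrable (lebesgue_on \<Omega>) (\<lambda>x. (norm (f x))\<^sup>2)" by (rule f)
    show "integrable (lebesgue_on \<Omega>) (\<lambda>x. w x * (norm (f x))\<^sup>2)"
    proof (rule Bochner_Integration.integrable_bound)
      show "integrable (lebesgue_on \<Omega>) (\<lambda>x. K * (norm (f x))\<^sup>2)" using f(2) by simp
      show "(\<lambda>x. w x * (norm (f x))\<^sup>2) \<in> borel_measurable (lebesgue_on \<Omega>)"
        using f(1) w(1) by (intro borel_measurable_times measurable_restrict_space1[OF w(1)]) simp
      show "AE x in lebesgue_on \<Omega>. norm (w x * (norm (f x))\<^sup>2) \<le> norm (K * (norm (f x))\<^sup>2)"
        using w(2,3) K by (intro AE_I2) (simp add: abs_mult mult_right_mono)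
    qed
  qed
  have intg: "integrable (lebesgue_on \<Omega>) (\<lambda>x. (norm (weak_grad \<Omega> f x))\<^sup>2)" if "f \<in> H1 \<Omega>" for f
    using L2D(2)[OF weak_grad_spec(1)[OF that]] .
  have nz: "?I ?z + ?I (weak_grad \<Omega> ?z) < e / ?M"
  proof -
    have "(H1_norm \<Omega> ?z)\<^sup>2 < (sqrt (e / ?M))\<^sup>2"
      using \<phi>(2) by (intro power_strict_mono) (auto simp: H1_norm_def)
    then show ?thesis using M \<open>0 < e\<close> by (simp add: H1_norm_sq)
  qed
  have nn: "0 \<le> ?I ?z" "0 \<le> ?I (weak_grad \<Omega> ?z)" by (simp_all add: integral_nonneg)
  have "?I u \<le> (\<integral>x. 2 * (norm (\<phi> x))\<^sup>2 + 2 * (norm (?z x))\<^sup>2 \<partial>lebesgue_on \<Omega>)"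
    using norm_sq_add_le[of "\<phi> x" "?z x" for x] int[OF uH1] int[OF z(1)] int[OF \<phi>H1(1)]
    by (intro integral_mono) simp_all
  also have "\<dots> = 2 * ?I \<phi> + 2 * ?I ?z" using int[OF z(1)] int[OF \<phi>H1(1)] by simp
  finally have 1: "?I u \<le> 2 * ?I \<phi> + 2 * ?I ?z" .
  have "?W \<phi> \<le> (\<integral>x. 2 * (w x * (norm (u x))\<^sup>2) + 2 * K * (norm (?z x))\<^sup>2 \<partial>lebesgue_on \<Omega>)"
  proof (rule integral_mono)
    fix x
    have "w x * (norm (\<phi> x))\<^sup>2 \<le> w x * (2 * (norm (u x))\<^sup>2 + 2 * (norm (?z x))\<^sup>2)"
      using norm_sq_add_le[of "u x" "- ?z x"] w(2) by (intro mult_left_mono) (simp_all add: norm_minus_commute)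
    also have "\<dots> \<le> 2 * (w x * (norm (u x))\<^sup>2) + 2 * K * (norm (?z x))\<^sup>2"
      using mult_right_mono[OF w(3)[of x], of "2 * (norm (?z x))\<^sup>2"] by (simp add: algebra_simps)
    finally show "w x * (norm (\<phi> x))\<^sup>2 \<le> 2 * (w x * (norm (u x))\<^sup>2) + 2 * K * (norm (?z x))\<^sup>2" .
  qed (use int[OF uH1] int[OF z(1)] int[OF \<phi>H1(1)] in simp_all)
  also have "\<dots> = 2 * ?W u + 2 * K * ?I ?z" using int[OF z(1)] int[OF uH1] by simp
  finally have 2: "?W \<phi> \<le> 2 * ?W u + 2 * K * ?I ?z" .
  have "?I (grad \<phi>) \<le> (\<integral>x. 2 * (norm (weak_grad \<Omega> u x))\<^sup>2 + 2 * (norm (weak_grad \<Omega> ?z x))\<^sup>2 \<partial>lebesgue_on \<Omega>)"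
  proof (rule integral_mono_AE')
    show "AE x in lebesgue_on \<Omega>. (norm (grad \<phi> x))\<^sup>2 \<le> 2 * (norm (weak_grad \<Omega> u x))\<^sup>2 + 2 * (norm (weak_grad \<Omega> ?z x))\<^sup>2"
      using z(2) \<phi>H1(2)
    proof eventually_elim
      case (elim x)
      then have "grad \<phi> x = weak_grad \<Omega> u x + - weak_grad \<Omega> ?z x" by simp
      then show ?case using norm_sq_add_le[of "weak_grad \<Omega> u x" "- weak_grad \<Omega> ?z x"] by simp
    qed
  qed (use intg[OF uH1] intg[OF z(1)] in auto)
  also have "\<dots> = 2 * ?I (weak_grad \<Omega> u) + 2 * ?I (weak_grad \<Omega> ?z)"
    using intg[OF uH1] intg[OF z(1)] by simp
  finally have 3: "?I (grad \<phi>) \<le> 2 * ?I (weak_grad \<Omega> u) + 2 * ?I (weak_grad \<Omega> ?z)" .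
  have "?I \<phi> \<le> C1 * (2 * ?W u + 2 * K * ?I ?z) + C2 * (2 * ?I (weak_grad \<Omega> u) + 2 * ?I (weak_grad \<Omega> ?z))"
    using order_trans[OF test[OF \<phi>(1)] add_mono[OF mult_left_mono[OF 2 C(1)] mult_left_mono[OF 3 C(2)]]] .
  with 1 have "?I u \<le> 4 * C1 * ?W u + 4 * C2 * ?I (weak_grad \<Omega> u)
      + ((2 + 4 * C1 * K) * ?I ?z + 4 * C2 * ?I (weak_grad \<Omega> ?z))"
    by (simp add: algebra_simps)
  also have "(2 + 4 * C1 * K) * ?I ?z + 4 * C2 * ?I (weak_grad \<Omega> ?z) \<le> ?M * ?I ?z + ?M * ?I (weak_grad \<Omega> ?z)"
    using nn C K by (intro add_mono[OF mult_right_mono mult_right_mono]) auto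
  also have "\<dots> \<le> ?M * (e / ?M)"
    using nz M by (simp only: distrib_left[symmetric]) (intro mult_left_mono, auto)
  also have "\<dots> = e" using M by simp
  finally show "?I u \<le> 4 * C1 * ?W u + 4 * C2 * ?I (weak_grad \<Omega> u) + e" by simp
qed

end

section \<open>Cutoffs, lattice cubes and constants\<close>

lemma flat_exp_0_deriv:
  "0 < c \<Longrightarrow> (flat_exp c 0 has_real_derivative c * flat_exp c 2 t) (at t)"
  using flat_exp_deriv[of c 0 t] by (simp add: numeral_2_eq_2)

lemma norm_grad_box_bump_le:
  fixes a b x :: "real ^ 'n"
  assumes c: "0 < c"
  shows "norm (grad (box_bump c a b) x) \<le> 4 * real CARD('n) / c"
proof -
  let ?w = "\<lambda>k x. flat_exp c 0 (x $ k - a $ k) * flat_exp c 0 (b $ k - x $ k)"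
  define D where "D k = flat_exp c 0 (x $ k - a $ k) * - (c * flat_exp c 2 (b $ k - x $ k))
      + c * flat_exp c 2 (x $ k - a $ k) * flat_exp c 0 (b $ k - x $ k)" for k
  have w01: "0 \<le> ?w k x" "?w k x \<le> 1" for k
    by (auto intro!: mult_nonneg_nonneg mult_le_one flat_exp_nonneg flat_exp_0_bounds c)
  have D: "\<bar>D k\<bar> \<le> 4 / c" for k
  proof -
    have *: "0 \<le> flat_exp c 0 s * (c * flat_exp c 2 t)" "flat_exp c 0 s * (c * flat_exp c 2 t) \<le> 1 * (2 / c)" for s t
    proof -
      show "0 \<le> flat_exp c 0 s * (c * flat_exp c 2 t)"
        using c by (simp add: flat_exp_nonneg)
      show "flat_exp c 0 s * (c * flat_exp c 2 t) \<le> 1 * (2 / c)"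
        by (rule mult_mono) (use c in \<open>simp_all add: flat_exp_0_bounds flat_exp_nonneg\<close>)
    qed
    show ?thesis
      using *[of "x $ k - a $ k" "b $ k - x $ k"] *[of "b $ k - x $ k" "x $ k - a $ k"] c
      by (simp add: D_def mult_ac)
  qed
  have w': "(?w k has_derivative (\<lambda>h. D k * h $ k)) (at x)" for k
  proof -
    have nth: "((\<lambda>x. x $ k - a $ k) has_derivative (\<lambda>h. h $ k)) (at x)"
      "((\<lambda>x. b $ k - x $ k) has_derivative (\<lambda>h. - h $ k)) (at x)"
      by (auto intro!: derivative_eq_intros bounded_linear.has_derivative[OF bounded_linear_vec_nth])
    show ?thesis
      by (rule has_derivative_eq_rhs, rule has_derivative_mult[OF
            DERIV_compose_FDERIV[OF flat_exp_0_deriv[OF c] nth(1)]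
            DERIV_compose_FDERIV[OF flat_exp_0_deriv[OF c] nth(2)]])
         (simp add: D_def fun_eq_iff algebra_simps)
  qed
  have "(box_bump c a b has_derivative (\<lambda>h. \<Sum>k\<in>UNIV. D k * h $ k * (\<Prod>l\<in>UNIV - {k}. ?w l x))) (at x)"
    unfolding box_bump_def[abs_def] by (rule has_derivative_prod) (rule w')
  from fun_cong[OF frechet_derivative_at[OF this, symmetric]]
  have "grad (box_bump c a b) x $ i = (\<Sum>k\<in>UNIV. D k * axis i 1 $ k * (\<Prod>l\<in>UNIV - {k}. ?w l x))" for i
    unfolding grad_def by simp
  also have "(\<Sum>k\<in>UNIV. D k * axis i 1 $ k * (\<Prod>l\<in>UNIV - {k}. ?w l x))
      = (\<Sum>k\<in>UNIV. if k = i then D k * (\<Prod>l\<in>UNIV - {k}. ?w l x) else 0)" for i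
    by (intro sum.cong) (auto simp: axis_def)
  finally have grad: "grad (box_bump c a b) x $ i = D i * (\<Prod>l\<in>UNIV - {i}. ?w l x)" for i
    by simp
  have "\<bar>grad (box_bump c a b) x $ i\<bar> \<le> 4 / c" for i
  proof -
    have "0 \<le> (\<Prod>l\<in>UNIV - {i}. ?w l x)" "(\<Prod>l\<in>UNIV - {i}. ?w l x) \<le> 1"
      using w01 by (auto intro!: prod_nonneg prod_le_1)
    then show ?thesis
      using mult_mono[OF D[of i], of "\<Prod>l\<in>UNIV - {i}. ?w l x" 1] c by (simp add: grad abs_mult)
  qed
  then have "(\<Sum>i\<in>UNIV. \<bar>grad (box_bump c a b) x $ i\<bar>) \<le> (\<Sum>i\<in>(UNIV::'n set). 4 / c)"
    by (rule sum_mono)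
  then show ?thesis
    using order_trans[OF norm_le_l1_cart[of "grad (box_bump c a b) x"]] by (simp add: mult.commute)
qed

lemma box_bump_ge_on_half_box:
  fixes z x :: "real ^ 'n"
  assumes r: "0 < r" and x: "x \<in> cbox (z - vec (r / 2)) (z + vec (r / 2))"
  shows "exp (- 4 * real CARD('n)) \<le> box_bump r (z - vec r) (z + vec r) x"
proof -
  have half: "exp (- 2) \<le> flat_exp r 0 t" if "r / 2 \<le> t" for t
    using that r by (simp add: flat_exp_def pos_divide_le_eq)
  have "exp (- 4) \<le> flat_exp r 0 (x $ i - (z - vec r) $ i) * flat_exp r 0 ((z + vec r) $ i - x $ i)" for i
  proof -
    have "z $ i - r / 2 \<le> x $ i" "x $ i \<le> z $ i + r / 2"
      using x by (simp_all add: mem_box_cart)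
    then have "exp (- 2) * exp (- 2) \<le> flat_exp r 0 (x $ i - (z - vec r) $ i) * flat_exp r 0 ((z + vec r) $ i - x $ i)"
      by (intro mult_mono half) (auto simp: flat_exp_nonneg)
    then show ?thesis by (simp flip: exp_add)
  qed
  then have "(\<Prod>i\<in>(UNIV::'n set). exp (- 4)) \<le> box_bump r (z - vec r) (z + vec r) x"
    unfolding box_bump_def by (intro prod_mono) auto
  moreover have "exp (- 4 * real CARD('n)) = exp (- 4) ^ CARD('n)"
    by (simp flip: exp_of_nat_mult add: mult.commute)
  ultimately show ?thesis by simp
qed

text \<open>
  With \<open>y = \<theta> powr (- 2 / 3)\<close> the claim is \<open>y powr (3 / 2) \<le> exp (2 * y)\<close>.
\<close>

lemma powr_neg_two_thirds_absorbs:
  fixes \<theta> :: real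
  assumes "0 < \<theta>"
  shows "exp (- 2 * \<theta> powr (- (2 / 3))) \<le> \<theta>"
proof -
  define y where "y = \<theta> powr (- (2 / 3))"
  have y: "0 < y" using assms by (simp add: y_def)
  have "y \<le> exp y" using exp_ge_add_one_self[of y] by linarith
  then have "y powr (3 / 2) \<le> exp y powr (3 / 2)"
    using y by (intro powr_mono2) auto
  also have "\<dots> = exp (3 / 2 * y)" by (simp add: exp_powr_real mult.commute)
  also have "\<dots> \<le> exp (2 * y)" using y by simp
  finally have "1 / exp (2 * y) \<le> 1 / y powr (3 / 2)"
    using y by (intro divide_left_mono) auto
  moreover have "y powr (3 / 2) = 1 / \<theta>"
    using assms powr_minus_divide[of \<theta> 1] unfolding y_def powr_powr by simp
  ultimately have "1 / exp (2 * y) \<le> \<theta>" by simp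
  then show ?thesis unfolding y_def[symmetric] by (simp add: exp_minus inverse_eq_divide)
qed

text \<open>
  Of the exponent \<open>(d + D) * (1 + y)\<close> the summand \<open>d\<close> provides the power of \<open>\<delta>\<close> lost to the volume of
  the small cubes, \<open>D\<close> beats every constant that depends on the dimension, and the multiple of \<open>y\<close>
  beats \<open>1 / \<theta>\<close>.
\<close>

lemma powr_constant_bound:
  fixes \<delta> \<theta> D :: real and d :: nat
  assumes \<delta>: "0 < \<delta>" "\<delta> < 1 / 4" and D: "2 \<le> D" and \<theta>: "0 < \<theta>"
  defines "P \<equiv> (\<delta> / 2) powr ((real d + D) * (1 + \<theta> powr (- (2 / 3))))"
  shows "P \<le> (\<delta> / 2) ^ d / D" "P \<le> (\<delta> / 2) ^ d / D * \<theta>"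
proof -
  let ?h = "\<delta> / 2" and ?y = "\<theta> powr (- (2 / 3))"
  have h: "0 < ?h" using \<delta> by simp
  have he: "?h \<le> exp (- 1)"
  proof -
    have "?h \<le> 1 / 3" using \<delta> by simp
    also have "\<dots> \<le> inverse (exp 1)" using le_imp_inverse_le[OF exp_le] by simp
    finally show ?thesis by (simp add: exp_minus)
  qed
  have small: "?h powr t \<le> exp (- t)" if "0 \<le> t" for t
  proof -
    have "?h powr t \<le> exp (- 1) powr t" using that h he by (intro powr_mono2) auto
    then show ?thesis by (simp add: exp_powr_real)
  qed
  have P: "P = ?h ^ d * (?h powr D * ?h powr ((real d + D) * ?y))"
    using h unfolding P_def by (simp add: distrib_left powr_add powr_realpow[symmetric])
  have "?h powr D \<le> exp (- D)" using D by (intro small) auto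
  also have "\<dots> \<le> 1 / D"
    using le_imp_inverse_le[of D "exp D"] exp_ge_add_one_self[of D] D
    by (simp add: exp_minus inverse_eq_divide)
  finally have hD: "?h powr D \<le> 1 / D" .
  have "?h powr ((real d + D) * ?y) \<le> exp (- ((real d + D) * ?y))"
    using D by (intro small) auto
  also have "\<dots> \<le> exp (- 2 * ?y)"
    using D mult_right_mono[of 2 "real d + D" ?y] by simp
  finally have hy: "?h powr ((real d + D) * ?y) \<le> exp (- 2 * ?y)" .
  then have "?h powr ((real d + D) * ?y) \<le> \<theta>" "?h powr ((real d + D) * ?y) \<le> 1"
    using order_trans[OF _ powr_neg_two_thirds_absorbs[OF \<theta>]] 
      order_trans[OF hy, of 1] by auto
  then have "?h powr D * ?h powr ((real d + D) * ?y) \<le> 1 / D * \<theta>"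
    "?h powr D * ?h powr ((real d + D) * ?y) \<le> 1 / D * 1"
    using hD D by (intro mult_mono; simp)+
  then have "P \<le> ?h ^ d * (1 / D * \<theta>)" "P \<le> ?h ^ d * (1 / D * 1)"
    unfolding P using h by (intro mult_left_mono; simp)+
  then show "P \<le> ?h ^ d / D" "P \<le> ?h ^ d / D * \<theta>" by simp_all
qed

lemma cube_eq_box: "cube L = box (- vec (L / 2)) (vec (L / 2))"
  by (auto simp: cube_def mem_box_cart)

lemma bounded_domain_cube: "bounded_domain (cube L)"
  by unfold_locales (simp_all add: cube_eq_box open_box bounded_box)

definition lattice_corner :: "int ^ 'n \<Rightarrow> real ^ 'n" where
  "lattice_corner j = (\<chi> i. real_of_int (j $ i) - 1 / 2)"

text \<open>
  Indices of the unit cubes that can meet the cube of side \<open>L\<close>. For even \<open>L\<close> the outermost unit cubes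
  are cut by its boundary.
\<close>

definition lattice_window :: "nat \<Rightarrow> (int ^ 'n) set" where
  "lattice_window L = {j. \<forall>i. \<bar>j $ i\<bar> \<le> int L}"

lemma finite_lattice_window: "finite (lattice_window L :: (int ^ 'n) set)"
proof (rule finite_subset)
  show "(lattice_window L :: (int ^ 'n) set) \<subseteq> vec_lambda ` (PiE UNIV (\<lambda>_. {- int L..int L}))"
  proof
    fix j :: "int ^ 'n" assume "j \<in> lattice_window L"
    then show "j \<in> vec_lambda ` (PiE UNIV (\<lambda>_. {- int L..int L}))"
      by (intro image_eqI[of _ _ "vec_nth j"]) (auto simp: lattice_window_def abs_le_iff minus_le_iff)
  qed
qed (intro finite_imageI finite_PiE, auto)

lemma cube_covered_by_lattice_window:
  assumes "1 \<le> L"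
  shows "cube (real L) \<subseteq> (\<Union>j\<in>lattice_window L. cbox (lattice_corner j) (lattice_corner j + vec 1))"
proof
  fix x :: "real ^ 'n" assume x: "x \<in> cube (real L)"
  define j :: "int ^ 'n" where "j = (\<chi> i. round (x $ i))"
  have r: "\<bar>real_of_int (j $ i) - x $ i\<bar> \<le> 1 / 2" for i
    using of_int_round_abs_le[of "x $ i"] by (simp add: j_def)
  have "\<bar>j $ i\<bar> \<le> int L" for i
  proof -
    have "- real L / 2 < x $ i" "x $ i < real L / 2" using x by (auto simp: cube_def)
    moreover have "1 \<le> real L" using assms by simp
    ultimately have "\<bar>real_of_int (j $ i)\<bar> \<le> real L"
      using r[of i, unfolded abs_le_iff] by (intro abs_leI) linarith+
    then show ?thesis by linarith
  qed
  then have "j \<in> lattice_window L" by (simp add: lattice_window_def)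
  moreover have "x \<in> cbox (lattice_corner j) (lattice_corner j + vec 1)"
    using r by (auto simp: mem_box_cart lattice_corner_def abs_le_iff) (smt (verit) field_sum_of_halves)+
  ultimately show "x \<in> (\<Union>j\<in>lattice_window L. cbox (lattice_corner j) (lattice_corner j + vec 1))" by blast
qed

lemma disjoint_lattice_boxes:
  assumes "x \<in> box (lattice_corner j) (lattice_corner j + vec 1)"
    and "x \<in> box (lattice_corner k) (lattice_corner k + vec 1)"
  shows "j = k"
proof -
  have "j $ i = k $ i" for i
  proof -
    have "real_of_int (j $ i) - 1 / 2 < x $ i" "x $ i < real_of_int (j $ i) - 1 / 2 + 1"
      "real_of_int (k $ i) - 1 / 2 < x $ i" "x $ i < real_of_int (k $ i) - 1 / 2 + 1"
      using assms by (auto simp: mem_box_cart lattice_corner_def)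
    then show ?thesis by linarith
  qed
  then show ?thesis by (simp add: vec_eq_iff)
qed

lemma equidistributed_ball_subset:
  assumes "equidistributed \<delta> Z"
  shows "ball (Z j) \<delta> \<subseteq> box (lattice_corner j) (lattice_corner j + vec 1)"
proof
  fix x assume "x \<in> ball (Z j) \<delta>"
  then obtain y where "y \<in> cube 1" "x = (\<chi> i. real_of_int (j $ i)) + y"
    using assms by (force simp: equidistributed_def)
  then show "x \<in> box (lattice_corner j) (lattice_corner j + vec 1)"
    by (auto simp: cube_def mem_box_cart lattice_corner_def)
qed

lemma cbox_subset_ball:
  fixes z :: "real ^ 'n"
  assumes "real CARD('n) * r < \<delta>"
  shows "cbox (z - vec r) (z + vec r) \<subseteq> ball z \<delta>"
proof
  fix x assume x: "x \<in> cbox (z - vec r) (z + vec r)"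
  have "norm (z - x) \<le> (\<Sum>i\<in>UNIV. \<bar>(z - x) $ i\<bar>)" by (rule norm_le_l1_cart)
  also have "\<dots> \<le> (\<Sum>i\<in>(UNIV::'n set). r)"
    using x by (intro sum_mono) (auto simp: mem_box_cart abs_le_iff algebra_simps)
  finally show "x \<in> ball z \<delta>" using assms by (simp add: dist_norm)
qed

section \<open>The lower bound for the gradient\<close>

text \<open>
  The two halves of the argument combined. Smallness of \<open>E\<close> absorbs the gradient term of the Poincare
  inequality into half of the left-hand side; the remaining values of \<open>\<psi>\<close> on the small cubes are below
  the weighted norms with the cutoffs, to which the reversed Caccioppoli inequality applies.
\<close>

lemma (in elliptic_problem) gradient_on_balls_lower_bound:
  fixes Z :: "int ^ 'n \<Rightarrow> real ^ 'n"
  assumes \<Omega>: "\<Omega> = cube (real L)" "1 \<le> L"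
    and eig: "(\<psi>, \<lambda>x. complex_of_real E * \<psi> x) \<in> dirichlet_operator \<Omega> A" and E: "0 < E"
    and Z: "equidistributed \<delta> Z" and \<delta>: "0 < \<delta>" "\<delta> < 1"
    and small: "16 * real CARD('n) * E \<le> \<theta>m * (\<delta> / (2 * real CARD('n))) ^ CARD('n)"
  shows "\<delta>\<^sup>2 * E\<^sup>2 * (L2_norm \<Omega> \<psi>)\<^sup>2
     \<le> 16 * exp (8 * real CARD('n)) / (\<delta> / (2 * real CARD('n))) ^ CARD('n)
        * (2 * \<theta>p * (\<delta>\<^sup>2 * E + 128 * \<theta>p * real CARD('n) ^ 4))
        * (L2_norm (S_set Z \<delta> (real L)) (weak_grad \<Omega> \<psi>))\<^sup>2"
proof -
  let ?d = "real CARD('n)" and ?g = "weak_grad \<Omega> \<psi>" and ?J = "lattice_window L :: (int ^ 'n) set"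
  have d1: "1 \<le> ?d" by (simp add: Suc_le_eq)
  \<comment> \<open>The box of half-width \<open>r\<close> around \<open>z\<^sub>j\<close> carries the cutoff and lies in the ball; its inner half, a cube
    of side \<open>r\<close>, is the small cube of the Poincare inequality.\<close>
  define r where "r = \<delta> / (2 * ?d)"
  have "\<delta> < 2 * ?d" using \<delta> d1 by linarith
  then have r: "0 < r" "r < 1" using \<delta> by (simp_all add: r_def pos_divide_less_eq)
  define sd where "sd = r ^ CARD('n)"
  have sd: "0 < sd" using r by (simp add: sd_def)
  note \<psi> = eigenfunctionD[OF eig] 
  let ?I = "\<integral>x. (norm (\<psi> x))\<^sup>2 \<partial>lebesgue_on \<Omega>"
  let ?G = "\<integral>x. (norm (?g x))\<^sup>2 \<partial>lebesgue_on \<Omega>"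
  let ?B = "\<lambda>j. ball (Z j) \<delta>"
  let ?q = "\<lambda>j. cbox (Z j - vec (r / 2)) (Z j + vec (r / 2))"
  let ?\<eta> = "\<lambda>j. box_bump r (Z j - vec r) (Z j + vec r)"
  let ?X = "\<lambda>j. \<integral>x. (?\<eta> j x)\<^sup>2 * (norm (\<psi> x))\<^sup>2 \<partial>lebesgue_on \<Omega>"
  let ?GB = "\<lambda>j. \<integral>x. indicator (?B j) x * (norm (?g x))\<^sup>2 \<partial>lebesgue_on \<Omega>"
  let ?w = "\<lambda>x. \<Sum>j\<in>?J. indicator (?q j) x :: real"
  have dr: "?d * r = \<delta> / 2" using d1 by (simp add: r_def)
  have dr2: "?d * (r / 2) < \<delta>" using dr \<delta>(1) by simp
  have qB: "?q j \<subseteq> ?B j" for j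
    by (rule cbox_subset_ball[OF dr2])
  have BQ: "?B j \<subseteq> box (lattice_corner j) (lattice_corner j + vec 1)" for j
    by (rule equidistributed_ball_subset[OF Z])
  have corner: "Z j + vec (r / 2) = (Z j - vec (r / 2)) + vec r" for j
    by (simp add: vec_eq_iff)

  have "?I \<le> 4 * (2 / sd) * (\<integral>x. ?w x * (norm (\<psi> x))\<^sup>2 \<partial>lebesgue_on \<Omega>) + 4 * (2 * ?d / sd) * ?G"
  proof (rule H1_0_inequality_from_test_functions[OF \<psi>(1)])
    show "?w \<in> borel_measurable lebesgue"
      by (intro borel_measurable_sum borel_measurable_indicator) auto
    show "0 \<le> ?w x" for x by (simp add: sum_nonneg)
    show "?w x \<le> real (card ?J)" for x
      using sum_bounded_above[of ?J "\<lambda>j. indicator (?q j) x :: real" 1] by simp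
    fix \<phi> assume \<phi>: "\<phi> \<in> test_functions \<Omega>"
    have sub: "cbox (Z j - vec (r / 2)) ((Z j - vec (r / 2)) + vec r)
        \<subseteq> cbox (lattice_corner j) (lattice_corner j + vec 1)" for j
      using qB[of j] BQ[of j] box_subset_cbox unfolding corner by blast
    show "(\<integral>x. (norm (\<phi> x))\<^sup>2 \<partial>lebesgue_on \<Omega>) \<le> 2 / sd * (\<integral>x. ?w x * (norm (\<phi> x))\<^sup>2 \<partial>lebesgue_on \<Omega>)
        + 2 * ?d / sd * (\<integral>x. (norm (grad \<phi> x))\<^sup>2 \<partial>lebesgue_on \<Omega>)"
      unfolding corner sd_def
    proof (rule poincare_tiling[OF \<phi> r finite_lattice_window sub])
      show "\<Omega> \<subseteq> (\<Union>j\<in>?J. cbox (lattice_corner j) (lattice_corner j + vec 1))"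
        unfolding \<Omega>(1) by (rule cube_covered_by_lattice_window[OF \<Omega>(2)])
      show "disjoint_family_on (\<lambda>j. box (lattice_corner j) (lattice_corner j + vec 1)) ?J"
        unfolding disjoint_family_on_def using disjoint_lattice_boxes by blast
    qed
  qed (use sd in auto)
  also have "4 * (2 * ?d / sd) * ?G \<le> ?I / 2"
  proof -
    have "16 * ?d * (\<theta>m * ?G) \<le> 16 * ?d * (E * ?I)"
      using eigenfunction_energy[OF eig] by (intro mult_left_mono) auto
    also have "\<dots> = (16 * ?d * E) * ?I" by simp
    also have "\<dots> \<le> (\<theta>m * sd) * ?I"
      using small by (intro mult_right_mono) (auto simp: sd_def r_def integral_nonneg)
    finally have "\<theta>m * (16 * ?d * ?G) \<le> \<theta>m * (sd * ?I)" by (simp add: mult_ac)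
    then have "16 * ?d * ?G \<le> sd * ?I" using theta_pos by simp
    then show ?thesis using sd by (simp add: field_simps)
  qed
  finally have "?I \<le> 16 / sd * (\<integral>x. ?w x * (norm (\<psi> x))\<^sup>2 \<partial>lebesgue_on \<Omega>)" by simp
  also have "\<dots> \<le> 16 / sd * (exp (8 * ?d) * (\<Sum>j\<in>?J. ?X j))"
  proof (rule mult_left_mono)
    have intX: "integrable (lebesgue_on \<Omega>) (\<lambda>x. (?\<eta> j x)\<^sup>2 * (norm (\<psi> x))\<^sup>2)" for j
      by (intro integrable_mult_bounded L2D H1_L2 \<psi> continuous_intros C_k_continuous[OF C_k_box_bump] r)
    have "(\<integral>x. ?w x * (norm (\<psi> x))\<^sup>2 \<partial>lebesgue_on \<Omega>)
        \<le> (\<integral>x. exp (8 * ?d) * (\<Sum>j\<in>?J. (?\<eta> j x)\<^sup>2 * (norm (\<psi> x))\<^sup>2) \<partial>lebesgue_on \<Omega>)"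
    proof (rule integral_mono')
      show "integrable (lebesgue_on \<Omega>) (\<lambda>x. exp (8 * ?d) * (\<Sum>j\<in>?J. (?\<eta> j x)\<^sup>2 * (norm (\<psi> x))\<^sup>2))"
        by (intro integrable_mult_right Bochner_Integration.integrable_sum intX)
      fix x
      show "0 \<le> exp (8 * ?d) * (\<Sum>j\<in>?J. (?\<eta> j x)\<^sup>2 * (norm (\<psi> x))\<^sup>2)"
        by (intro mult_nonneg_nonneg sum_nonneg) auto
      have "indicator (?q j) x \<le> exp (8 * ?d) * (?\<eta> j x)\<^sup>2" for j
      proof (cases "x \<in> ?q j")
        case True
        have "(exp (- 4 * ?d))\<^sup>2 \<le> (?\<eta> j x)\<^sup>2"
          by (intro power_mono box_bump_ge_on_half_box r True) simp
        then have "exp (8 * ?d) * (exp (- 4 * ?d))\<^sup>2 \<le> exp (8 * ?d) * (?\<eta> j x)\<^sup>2"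
          by (intro mult_left_mono) auto
        also have "exp (8 * ?d) * (exp (- 4 * ?d))\<^sup>2 = 1"
          by (simp flip: exp_add add: power2_eq_square)
        finally show ?thesis using True by simp
      qed simp
      then have "?w x * (norm (\<psi> x))\<^sup>2 \<le> (\<Sum>j\<in>?J. exp (8 * ?d) * (?\<eta> j x)\<^sup>2) * (norm (\<psi> x))\<^sup>2"
        by (intro mult_right_mono sum_mono) auto
      then show "?w x * (norm (\<psi> x))\<^sup>2 \<le> exp (8 * ?d) * (\<Sum>j\<in>?J. (?\<eta> j x)\<^sup>2 * (norm (\<psi> x))\<^sup>2)"
        by (simp add: sum_distrib_left sum_distrib_right mult.assoc)
    qed
    also have "\<dots> = exp (8 * ?d) * (\<Sum>j\<in>?J. ?X j)"
      using intX by (simp add: Bochner_Integration.integral_sum)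
    finally show "(\<integral>x. ?w x * (norm (\<psi> x))\<^sup>2 \<partial>lebesgue_on \<Omega>) \<le> exp (8 * ?d) * (\<Sum>j\<in>?J. ?X j)" .
  qed (use sd in simp)
  finally have I: "?I \<le> 16 * exp (8 * ?d) / sd * (\<Sum>j\<in>?J. ?X j)" by simp

  define N where "N = 8 * ?d\<^sup>2 / \<delta>"
  have N: "0 < N" "norm (grad (?\<eta> j) x) \<le> N" for j x
  proof -
    show "0 < N" using d1 \<delta> by (simp add: N_def)
    have "4 * ?d / r = N" by (simp add: N_def r_def power2_eq_square)
    then show "norm (grad (?\<eta> j) x) \<le> N"
      using norm_grad_box_bump_le[OF r(1), of "Z j - vec r" "Z j + vec r" x] by simp
  qed
  define Q where "Q = 2 * \<theta>p * (E + 2 * \<theta>p * N\<^sup>2)"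
  have Q0: "0 \<le> Q" using E theta_pos by (simp add: Q_def)
  have X: "E\<^sup>2 * ?X j \<le> Q * ?GB j" for j
    unfolding Q_def
  proof (rule caccioppoli[OF eig E])
    show "?\<eta> j x = 0" if "x \<notin> ?B j" for x
    proof (rule box_bump_eq_0)
      have "cbox (Z j - vec r) (Z j + vec r) \<subseteq> ?B j"
        by (rule cbox_subset_ball) (use dr \<delta>(1) in simp)
      then show "x \<notin> box (Z j - vec r) (Z j + vec r)" using that box_subset_cbox by blast
    qed
  qed (use N r in \<open>auto intro: C_k_box_bump box_bump_nonneg box_bump_le_1\<close>)
  have intg: "integrable (lebesgue_on \<Omega>) (\<lambda>x. indicator U x * (norm (?g x))\<^sup>2)" if "open U" for U
  proof -
    have "U \<in> sets lebesgue" using that by auto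
    moreover have "integrable lebesgue (\<lambda>x. indicator \<Omega> x *\<^sub>R (norm (?g x))\<^sup>2)"
      using L2D(2)[OF weak_grad_spec(1)[OF \<psi>(2)]] by (simp add: integrable_restrict_space)
    ultimately have "integrable lebesgue (\<lambda>x. indicator U x *\<^sub>R (indicator \<Omega> x *\<^sub>R (norm (?g x))\<^sup>2))"
      by (rule integrable_mult_indicator)
    then show ?thesis by (simp add: integrable_restrict_space mult.left_commute)
  qed
  have "(\<Sum>j\<in>?J. ?GB j) = (\<integral>x. (\<Sum>j\<in>?J. indicator (?B j) x * (norm (?g x))\<^sup>2) \<partial>lebesgue_on \<Omega>)"
    by (intro Bochner_Integration.integral_sum[symmetric] intg) simp
  also have "\<dots> \<le> (\<integral>x. indicator (\<Union>j. ?B j) x * (norm (?g x))\<^sup>2 \<partial>lebesgue_on \<Omega>)"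
  proof (rule integral_mono)
    show "integrable (lebesgue_on \<Omega>) (\<lambda>x. \<Sum>j\<in>?J. indicator (?B j) x * (norm (?g x))\<^sup>2)"
      by (intro Bochner_Integration.integrable_sum intg) simp
    show "integrable (lebesgue_on \<Omega>) (\<lambda>x. indicator (\<Union>j. ?B j) x * (norm (?g x))\<^sup>2)"
      by (intro intg) auto
    fix x
    have "disjoint_family_on ?B ?J"
      unfolding disjoint_family_on_def using disjoint_lattice_boxes BQ by blast
    then have "(\<Sum>j\<in>?J. indicator (?B j) x :: real) = indicator (\<Union>j\<in>?J. ?B j) x"
      by (rule indicator_UN_disjoint[OF finite_lattice_window, symmetric])
    also have "\<dots> \<le> indicator (\<Union>j. ?B j) x" by (auto simp: indicator_def)
    finally show "(\<Sum>j\<in>?J. indicator (?B j) x * (norm (?g x))\<^sup>2) \<le> indicator (\<Union>j. ?B j) x * (norm (?g x))\<^sup>2"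
      by (simp add: sum_distrib_right[symmetric] mult_right_mono)
  qed
  also have "\<dots> = (L2_norm (S_set Z \<delta> (real L)) ?g)\<^sup>2"
  proof -
    have "open (S_set Z \<delta> (real L))"
      unfolding S_set_def using open_domain \<Omega>(1) by (intro open_Int open_UN) auto
    then have "S_set Z \<delta> (real L) \<in> sets lebesgue" by auto
    then show ?thesis
      unfolding L2_norm_sq
      by (simp add: integral_restrict_space)
         (intro Bochner_Integration.integral_cong, auto simp: S_set_def \<Omega>(1) indicator_def)
  qed
  finally have GS: "(\<Sum>j\<in>?J. ?GB j) \<le> (L2_norm (S_set Z \<delta> (real L)) ?g)\<^sup>2" (is "_ \<le> ?GS") .

  have "E\<^sup>2 * ?I \<le> E\<^sup>2 * (16 * exp (8 * ?d) / sd * (\<Sum>j\<in>?J. ?X j))"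
    by (intro mult_left_mono I) simp
  also have "\<dots> = 16 * exp (8 * ?d) / sd * (\<Sum>j\<in>?J. E\<^sup>2 * ?X j)"
    by (simp add: sum_distrib_left mult_ac)
  also have "\<dots> \<le> 16 * exp (8 * ?d) / sd * (\<Sum>j\<in>?J. Q * ?GB j)"
    by (intro mult_left_mono sum_mono X) (use sd in auto)
  also have "\<dots> = 16 * exp (8 * ?d) / sd * (Q * (\<Sum>j\<in>?J. ?GB j))"
    by (simp add: sum_distrib_left)
  also have "\<dots> \<le> 16 * exp (8 * ?d) / sd * (Q * ?GS)"
    by (intro mult_left_mono GS Q0) (use sd in auto)
  finally have "\<delta>\<^sup>2 * (E\<^sup>2 * ?I) \<le> \<delta>\<^sup>2 * (16 * exp (8 * ?d) / sd * (Q * ?GS))"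
    by (intro mult_left_mono) auto
  also have "\<dots> = 16 * exp (8 * ?d) / sd * (\<delta>\<^sup>2 * Q) * ?GS" by simp
  also have "\<delta>\<^sup>2 * Q = 2 * \<theta>p * (\<delta>\<^sup>2 * E + 128 * \<theta>p * ?d ^ 4)"
  proof -
    have "\<delta>\<^sup>2 * N\<^sup>2 = 64 * ?d ^ 4"
      using \<delta>(1) by (simp add: N_def power_divide power_mult_distrib)
    moreover have "\<delta>\<^sup>2 * Q = 2 * \<theta>p * (\<delta>\<^sup>2 * E + 2 * \<theta>p * (\<delta>\<^sup>2 * N\<^sup>2))"
      by (simp add: Q_def algebra_simps)
    ultimately show ?thesis by simp
  qed
  finally show ?thesis by (simp add: L2_norm_sq[of \<Omega>] sd_def r_def mult.assoc)
qed

text \<open>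
  \<open>\<delta>0\<close> is the constant \<open>1 / 4\<close>. The constant \<open>D\<close> collects the dimensional factors of the lower bound; the
  quotient of \<open>\<delta>\<^sup>2 * E\<^sup>2\<close> by \<open>2 * \<theta>p * (8 * \<theta>p + \<delta>\<^sup>2 * E)\<close> increases with \<open>E\<close>, so \<open>E\<close> may be
  replaced by the lower end of the energy interval.
\<close>

theorem theorem5p2:
  "\<exists>(M::real) (\<delta>0 :: real \<Rightarrow> real). M > 0 \<and> (\<forall>t. 0 < \<delta>0 t \<and> \<delta>0 t < 1 / 2) \<and>
     (\<forall>(\<theta>m::real) (\<theta>p::real) (L::nat) (A :: real ^ 'n \<Rightarrow> real ^ 'n ^ 'n) (\<delta>::real).
        0 < \<theta>m \<longrightarrow> 0 < \<theta>p \<longrightarrow> 1 \<le> L \<longrightarrow>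
        A \<in> borel_measurable (lebesgue_on (cube (real L))) \<longrightarrow>
        (\<forall>x\<in>cube (real L). transpose (A x) = A x) \<longrightarrow>
        (\<forall>x\<in>cube (real L). \<forall>\<xi>. \<theta>m * (norm \<xi>)\<^sup>2 \<le> \<xi> \<bullet> (A x *v \<xi>) \<and>
                                  \<xi> \<bullet> (A x *v \<xi>) \<le> \<theta>p * (norm \<xi>)\<^sup>2) \<longrightarrow>
        0 < \<delta> \<longrightarrow> \<delta> < \<delta>0 (max (inverse \<theta>m) \<theta>p) \<longrightarrow>
        (let \<kappa> = 1 / 2 * (\<delta> / 2) powr (M * (1 + \<theta>m powr (- (2 / 3)))) in
         \<forall>(Em::real) (Ep::real) (E::real) (\<psi> :: real ^ 'n \<Rightarrow> complex)
           (Z :: int ^ 'n \<Rightarrow> real ^ 'n).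
           0 < Em \<longrightarrow> Em < Ep \<longrightarrow> Ep \<le> \<kappa> \<longrightarrow> E \<in> {Em<..<Ep} \<longrightarrow>
           (\<psi>, \<lambda>x. complex_of_real E * \<psi> x) \<in> dirichlet_operator (cube (real L)) A \<longrightarrow>
           equidistributed \<delta> Z \<longrightarrow>
           (let C = 1 / 2 * (\<delta>\<^sup>2 * Em\<^sup>2 / (2 * \<theta>p * (8 * \<theta>p + \<delta>\<^sup>2 * Em)))
                      * (\<delta> / 2) powr (M * (1 + \<theta>m powr (- (2 / 3))))
            in (L2_norm (S_set Z \<delta> (real L)) (weak_grad (cube (real L)) \<psi>))\<^sup>2
                 \<ge> C * (L2_norm (cube (real L)) \<psi>)\<^sup>2)))"
proof -
  let ?d = "real CARD('n)"
  define D where "D = 512 * ?d ^ (CARD('n) + 4) * exp (8 * ?d)"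
  define M where "M = ?d + D"
  have d1: "1 \<le> ?d" by (simp add: Suc_le_eq)
  have pow1: "1 \<le> ?d ^ k" for k using d1 by simp
  have exp1: "1 \<le> exp (8 * ?d)" by simp
  have D512: "512 * ?d ^ (CARD('n) + 4) \<le> D"
    using mult_left_mono[OF exp1, of "512 * ?d ^ (CARD('n) + 4)"] by (simp add: D_def)
  then have D2: "2 \<le> D" using pow1[of "CARD('n) + 4"] by linarith
  have M0: "0 < M" using d1 D2 by (simp add: M_def)
  show ?thesis
  proof (rule exI[of _ M], rule exI[of _ "\<lambda>_. 1 / 4"], intro conjI allI impI)
    fix \<theta>m \<theta>p \<delta> :: real and L :: nat and A :: "real ^ 'n \<Rightarrow> real ^ 'n ^ 'n"
    assume \<theta>: "0 < \<theta>m" "0 < \<theta>p" and L: "1 \<le> L"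
      and A: "A \<in> borel_measurable (lebesgue_on (cube (real L)))"
        "\<forall>x\<in>cube (real L). transpose (A x) = A x"
        "\<forall>x\<in>cube (real L). \<forall>\<xi>. \<theta>m * (norm \<xi>)\<^sup>2 \<le> \<xi> \<bullet> (A x *v \<xi>) \<and> \<xi> \<bullet> (A x *v \<xi>) \<le> \<theta>p * (norm \<xi>)\<^sup>2"
      and \<delta>: "0 < \<delta>" "\<delta> < 1 / 4"
    interpret bounded_domain "cube (real L) :: (real ^ 'n) set"
      by (rule bounded_domain_cube)
    interpret elliptic_problem "cube (real L) :: (real ^ 'n) set" A \<theta>m \<theta>p
      by unfold_locales (use \<theta> A in auto)
    define P where "P = (\<delta> / 2) powr (M * (1 + \<theta>m powr (- (2 / 3))))"
    have P: "P \<le> (\<delta> / 2) ^ CARD('n) / D" "P \<le> (\<delta> / 2) ^ CARD('n) / D * \<theta>m"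
      using powr_constant_bound[OF \<delta> D2 \<theta>(1), where d="CARD('n)"] by (simp_all add: P_def M_def)
    have P0: "0 \<le> P" by (simp add: P_def)
    define sd where "sd = (\<delta> / (2 * ?d)) ^ CARD('n)"
    have sd: "0 < sd" using \<delta> d1 by (simp add: sd_def)
    have half: "(\<delta> / 2) ^ CARD('n) = ?d ^ CARD('n) * sd"
      using d1 by (simp add: sd_def power_divide power_mult_distrib)
    have "\<delta>\<^sup>2 * Em\<^sup>2 / (2 * \<theta>p * (8 * \<theta>p + \<delta>\<^sup>2 * Em)) / 2 * P * (L2_norm (cube (real L)) \<psi>)\<^sup>2
        \<le> (L2_norm (S_set Z \<delta> (real L)) (weak_grad (cube (real L)) \<psi>))\<^sup>2"
      if E: "0 < Em" "Em < Ep" "Ep \<le> 1 / 2 * P" "E \<in> {Em<..<Ep}"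
        and eig: "(\<psi>, \<lambda>x. complex_of_real E * \<psi> x) \<in> dirichlet_operator (cube (real L)) A"
        and Z: "equidistributed \<delta> Z"
      for Em Ep E :: real and \<psi> :: "real ^ 'n \<Rightarrow> complex" and Z :: "int ^ 'n \<Rightarrow> real ^ 'n"
    proof -
      let ?I = "(L2_norm (cube (real L)) \<psi>)\<^sup>2"
        and ?GS = "(L2_norm (S_set Z \<delta> (real L)) (weak_grad (cube (real L)) \<psi>))\<^sup>2"
      have E0: "0 < E" "Em \<le> E" "E \<le> P / 2" using E by auto
      have small: "16 * ?d * E \<le> \<theta>m * sd"
      proof -
        have "16 * ?d * E \<le> 16 * ?d * (P / 2)" using E0 by (intro mult_left_mono) auto
        also have "\<dots> = 8 * ?d * P" by simp
        also have "\<dots> \<le> 8 * ?d * ((\<delta> / 2) ^ CARD('n) / D * \<theta>m)"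
          using P(2) by (intro mult_left_mono) auto
        also have "\<dots> = (8 * ?d ^ (CARD('n) + 1) / D) * (\<theta>m * sd)"
          by (simp add: half)
        also have "\<dots> \<le> 1 * (\<theta>m * sd)"
        proof (rule mult_right_mono)
          have "?d ^ (CARD('n) + 1) \<le> ?d ^ (CARD('n) + 4)" using d1 by (intro power_increasing) auto
          then have "8 * ?d ^ (CARD('n) + 1) \<le> D" using D512 pow1[of "CARD('n) + 4"] by linarith
          then show "8 * ?d ^ (CARD('n) + 1) / D \<le> 1" using D2 by simp
        qed (use \<theta> sd in simp)
        finally show ?thesis by simp
      qed
      have main: "\<delta>\<^sup>2 * E\<^sup>2 * ?I \<le> 16 * exp (8 * ?d) / sd
          * (2 * \<theta>p * (\<delta>\<^sup>2 * E + 128 * \<theta>p * ?d ^ 4)) * ?GS"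
        unfolding sd_def
        by (rule gradient_on_balls_lower_bound[OF refl L eig E0(1) Z \<delta>(1) _ small[unfolded sd_def]])
           (use \<delta> in simp)
      define F where "F e = 2 * \<theta>p * (8 * \<theta>p + \<delta>\<^sup>2 * e)" for e
      have F: "0 < F e" if "0 < e" for e using \<theta> that \<delta> by (simp add: F_def add_pos_pos)
      have "2 * \<theta>p * (\<delta>\<^sup>2 * E + 128 * \<theta>p * ?d ^ 4) \<le> 16 * ?d ^ 4 * F E"
      proof -
        have "\<delta>\<^sup>2 * E \<le> 16 * ?d ^ 4 * (\<delta>\<^sup>2 * E)"
          using mult_right_mono[of 1 "16 * ?d ^ 4" "\<delta>\<^sup>2 * E"] pow1[of 4] E0 by simp
        then have "2 * \<theta>p * (\<delta>\<^sup>2 * E + 128 * \<theta>p * ?d ^ 4)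
            \<le> 2 * \<theta>p * (16 * ?d ^ 4 * (\<delta>\<^sup>2 * E) + 128 * \<theta>p * ?d ^ 4)"
          using \<theta> by (intro mult_left_mono) auto
        also have "\<dots> = 16 * ?d ^ 4 * F E" by (simp add: F_def algebra_simps)
        finally show ?thesis .
      qed
      then have "\<delta>\<^sup>2 * E\<^sup>2 * ?I \<le> 16 * exp (8 * ?d) / sd * (16 * ?d ^ 4 * F E) * ?GS"
        by (intro order_trans[OF main] mult_right_mono mult_left_mono) (use sd in auto)
      then have "\<delta>\<^sup>2 * E\<^sup>2 * ?I \<le> F E * (16 * exp (8 * ?d) / sd * (16 * ?d ^ 4) * ?GS)"
        by (simp add: mult_ac)
      then have TE: "\<delta>\<^sup>2 * E\<^sup>2 / F E * ?I \<le> 16 * exp (8 * ?d) / sd * (16 * ?d ^ 4) * ?GS"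
        using F[OF E0(1)] by (simp add: pos_divide_le_eq mult.commute)
      have "\<delta>\<^sup>2 * Em\<^sup>2 / F Em \<le> \<delta>\<^sup>2 * E\<^sup>2 / F E"
      proof -
        have "Em\<^sup>2 * (8 * \<theta>p) \<le> E\<^sup>2 * (8 * \<theta>p)"
          using E0 E(1) \<theta> by (intro mult_right_mono power_mono) auto
        moreover have "(Em * E) * (\<delta>\<^sup>2 * Em) \<le> (Em * E) * (\<delta>\<^sup>2 * E)"
          using E0 E(1) by (intro mult_left_mono) auto
        ultimately have "Em\<^sup>2 * (8 * \<theta>p + \<delta>\<^sup>2 * E) \<le> E\<^sup>2 * (8 * \<theta>p + \<delta>\<^sup>2 * Em)"
          by (simp add: power2_eq_square algebra_simps)
        then have "(2 * \<theta>p * \<delta>\<^sup>2) * (Em\<^sup>2 * (8 * \<theta>p + \<delta>\<^sup>2 * E)) \<le> (2 * \<theta>p * \<delta>\<^sup>2) * (E\<^sup>2 * (8 * \<theta>p + \<delta>\<^sup>2 * Em))"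
          using \<theta> by (intro mult_left_mono) auto
        then have "\<delta>\<^sup>2 * Em\<^sup>2 * F E \<le> \<delta>\<^sup>2 * E\<^sup>2 * F Em"
          unfolding F_def by (simp only: mult_ac)
        then show ?thesis using F[OF E0(1)] F[OF E(1)] by (simp add: divide_le_eq le_divide_eq)
      qed
      then have "\<delta>\<^sup>2 * Em\<^sup>2 / F Em * ?I \<le> 16 * exp (8 * ?d) / sd * (16 * ?d ^ 4) * ?GS"
        by (intro order_trans[OF mult_right_mono TE]) simp_all
      then have "P / 2 * (\<delta>\<^sup>2 * Em\<^sup>2 / F Em * ?I) \<le> P / 2 * (16 * exp (8 * ?d) / sd * (16 * ?d ^ 4) * ?GS)"
        using P0 by (intro mult_left_mono) auto
      also have "\<dots> \<le> (?d ^ CARD('n) * sd / D) / 2 * (16 * exp (8 * ?d) / sd * (16 * ?d ^ 4) * ?GS)"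
        using P(1) sd by (intro mult_right_mono) (auto simp: half)
      also have "\<dots> = 128 * ?d ^ (CARD('n) + 4) * exp (8 * ?d) / D * ?GS"
        using sd by (simp add: power_add)
      also have "\<dots> = ?GS / 4"
        using d1 by (simp add: D_def)
      also have "\<dots> \<le> ?GS" by simp
      finally show ?thesis by (simp add: F_def mult_ac)
    qed
    then show "let \<kappa> = 1 / 2 * (\<delta> / 2) powr (M * (1 + \<theta>m powr (- (2 / 3)))) in
         \<forall>(Em::real) (Ep::real) (E::real) (\<psi> :: real ^ 'n \<Rightarrow> complex)
           (Z :: int ^ 'n \<Rightarrow> real ^ 'n).
           0 < Em \<longrightarrow> Em < Ep \<longrightarrow> Ep \<le> \<kappa> \<longrightarrow> E \<in> {Em<..<Ep} \<longrightarrow>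
           (\<psi>, \<lambda>x. complex_of_real E * \<psi> x) \<in> dirichlet_operator (cube (real L)) A \<longrightarrow>
           equidistributed \<delta> Z \<longrightarrow>
           (let C = 1 / 2 * (\<delta>\<^sup>2 * Em\<^sup>2 / (2 * \<theta>p * (8 * \<theta>p + \<delta>\<^sup>2 * Em)))
                      * (\<delta> / 2) powr (M * (1 + \<theta>m powr (- (2 / 3))))
            in (L2_norm (S_set Z \<delta> (real L)) (weak_grad (cube (real L)) \<psi>))\<^sup>2
                 \<ge> C * (L2_norm (cube (real L)) \<psi>)\<^sup>2)"
      unfolding Let_def P_def[symmetric] by (intro allI impI) simp
  qed (use M0 in auto)
qed

end
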